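(* In the setting described in the context, let $\Lambda=(\lambda_1,\dots,\lambda_r,-\mu_1,\dots,-\mu_s)$ be a polarization for $(W,G)$ with associated polarization $\tilde\Lambda=(\alpha_1,\dots,\alpha_r,-\beta_1,\dots,-\beta_s)$ for $(\mathbf{W},\mathbf{G})$. Suppose that all $\alpha_i>0$ and all $\beta_l>0$, and that $$\lambda_2\ge a_{21}\sum_{l}\mu_l\,c_l(m)\qquad\text{and}\qquad \mu_{s-1}\ge b_{s,s-1}\,d_1(n)\sum_i\alpha_i\,a_{i1}$$ (the second inequality being imposed only when $s\ge 2$), where for the cases below $c_l(m)=c_l(m_2)$ and $d_1(n)=d_1(n_1)$. Let $Z=\mathbf{G}\,\zeta(W)$, with closure $\overline Z$ in $\mathbf{W}$. Then $\overline{Z}\smallsetminus Z$ contains no semi-stable point, i.e. $(\overline{Z}\smallsetminus Z)\cap\mathbf{W}^{ss}(\mathbf{G},\tilde\Lambda)=\emptyset$, in the following cases: (i) $(r,s)=(2,1)$ and $\lambda_2\ge c_1(m_2)\,a_{21}\,\mu_1$; (ii) $(r,s)=(2,2)$ and $$\lambda_2\ge\bigl(\mu_1c_1(m_2)+\mu_2(c_2(m_2)-b_{21}c_1(m_2))\bigr)a_{21},\qquad \mu_1\ge\bigl(\lambda_1(d_1(n_1)-d_2(n_1)a_{21})+\lambda_2d_2(n_1)\bigr)b_{21}.$$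
   Context: Setting. Over $\mathbb{C}$, let $r,s\ge 1$ and let $A_{ji}$ ($1\le i\le j\le r$), $B_{ml}$ ($1\le l\le m\le s$), $H_{li}$ ($1\le i\le r$, $1\le l\le s$) be finite dimensional vector spaces, $A_{ii}=\mathbb{C}$, $B_{ll}=\mathbb{C}$, with linear composition maps $H_{lj}\otimes A_{ji}\to H_{li}$, $A_{kj}\otimes A_{ji}\to A_{ki}$, $B_{ml}\otimes H_{li}\to H_{mi}$, $B_{nm}\otimes B_{ml}\to B_{nl}$ (for $i\le j\le k$, $l\le m\le n$), which are the identities when a factor is $A_{ii}$ or $B_{ll}$, and which are associative in all possible combinations. All these maps and the induced maps $H_{li}^*\otimes A_{ji}\to H_{lj}^*$, $H_{mi}^*\otimes B_{ml}\to H_{li}^*$ are assumed surjective. Let $M_1,\dots,M_r$, $N_1,\dots,N_s$ be finite dimensional vector spaces. Lower-case letters denote dimensions ($a_{ji}=\dim A_{ji}$, $b_{ml}=\dim B_{ml}$, $m_i=\dim M_i$, $n_l=\dim N_l$). $W=\bigoplus_{i,l}\mathrm{Hom}(M_i,N_l\otimes H_{li})=\bigoplus_{i,l}\mathrm{Hom}(H_{li}^*\otimes M_i,N_l)$, with elements $w=(\phi_{li})$. ($G$ is the group $G_L\times G_R$, where $G_L$ consists of lower triangular matrices with diagonal entries in $GL(M_i)$ and entries $u_{ji}\in\mathrm{Hom}(M_i,M_j\otimes A_{ji})$, $i<j$, and similarly $G_R$ with $N_l$, $B_{ml}$; it acts by $(g,h).w=hwg^{-1}$.) Larger space. $P_i=\bigoplus_{j\ge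 i}M_j\otimes A_{ji}$, $Q_l=\bigoplus_{m\le l}N_m\otimes B_{lm}^*$; $\xi_i:P_i\otimes A_{i,i-1}\to P_{i-1}$ ($2\le i\le r$) and $\eta_l:Q_{l+1}\otimes B_{l+1,l}\to Q_l$ ($1\le l<s$) are the maps induced by the compositions ($\eta_l$ is zero on the component $N_{l+1}$). $$\mathbf{W}=\bigoplus_{2\le i\le r}\mathrm{Hom}(P_i\otimes A_{i,i-1},P_{i-1})\oplus\mathrm{Hom}(P_1\otimes H_{s1}^*,Q_s)\oplus\bigoplus_{1\le l<s}\mathrm{Hom}(Q_{l+1}\otimes B_{l+1,l},Q_l),$$ with the natural action of $\mathbf{G}=\prod_iGL(P_i)\times\prod_lGL(Q_l)$: components $x_i,\psi,y_l$ are sent to $g_{i-1}x_i(g_i\otimes\mathrm{id})^{-1}$, $h_s\psi(g_1\otimes\mathrm{id})^{-1}$, $h_ly_l(h_{l+1}\otimes\mathrm{id})^{-1}$. For $w=(\phi_{li})$, $\gamma(w)\in\mathrm{Hom}(P_1,Q_s\otimes H_{s1})=\mathrm{Hom}(P_1\otimes H_{s1}^*,Q_s)$ has components $M_i\otimes A_{i1}\to N_l\otimes H_{li}\otimes A_{i1}\to N_l\otimes H_{l1}\to N_l\otimes B_{sl}^*\otimes H_{s1}$ (induced by $\phi_{li}$, by composition, and by the map $H_{l1}\to B_{sl}^*\otimes H_{s1}$ coming from the composition $B_{sl}\otimes H_{l1}\to H_{s1}$). $\zeta(w)=((\xi_2,\dots,\xi_r),\gamma(w),(\eta_1,\dots,\eta_{s-1}))$.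 Polarizations. A polarization for $(W,G)$ is $\Lambda=(\lambda_1,\dots,\lambda_r,-\mu_1,\dots,-\mu_s)$ with rational $\lambda_i,\mu_l$ and $\sum\lambda_im_i=\sum\mu_ln_l=1$. The associated polarization is $\tilde\Lambda=(\alpha_1,\dots,\alpha_r,-\beta_1,\dots,-\beta_s)$, determined by $\lambda_j=\sum_{i\le j}a_{ji}\alpha_i$ and $\mu_l=\sum_{m\ge l}b_{ml}\beta_m$. Semi-stability. A point $(x_2,\dots,x_r,\psi,y_1,\dots,y_{s-1})\in\mathbf{W}$ is semi-stable w.r.t. $\tilde\Lambda$, i.e. in $\mathbf{W}^{ss}(\mathbf{G},\tilde\Lambda)$, if $\sum\alpha_i\dim P_i'-\sum\beta_l\dim Q_l'\le0$ for all families of subspaces $P_i'\subset P_i$, $Q_l'\subset Q_l$, not all zero and not all full, with $x_i(P_i'\otimes A_{i,i-1})\subset P_{i-1}'$, $\psi(P_1'\otimes H_{s1}^* )\subset Q_s'$, $y_l(Q_{l+1}'\otimes B_{l+1,l})\subset Q_l'$. Constants (here $r=2$). Let $\delta_l:M_2\otimes A_{21}\otimes H_{l1}^*\to M_2\otimes H_{l2}^*$ be induced by $A_{21}\otimes H_{l1}^*\to H_{l2}^*$. $c_l(m_2)=\sup_K\mathrm{codim}(\delta_l(K\otimes H_{l1}^* ))/\mathrm{codim}(K)$ over proper subspaces $K\subset M_2\otimes A_{21}$ not contained in $M_2'\otimes A_{21}$ for any proper subspace $M_2'\subset M_2$. For $s=2$ let $\delta_i^\vee:N_1^*\otimes B_{21}\otimes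 H_{2i}^*\to N_1^*\otimes H_{1i}^*$ be induced by $B_{21}\otimes H_{2i}^*\to H_{1i}^*$. $d_i(n_1)=\sup_L\mathrm{codim}(\delta_i^\vee(L\otimes H_{2i}^* ))/\mathrm{codim}(L)$ over proper subspaces $L\subset N_1^*\otimes B_{21}$ not contained in $N_1'\otimes B_{21}$ for any proper subspace $N_1'\subset N_1^*$. (Supremum of the empty set is $0$.) *)

theory Defs
  imports Complex_Main "HOL-Library.Function_Algebras" "HOL-Library.Product_Plus"
begin

section \<open>Complex vector spaces\<close>

class complex_vector = ab_group_add +
  fixes scaleC :: "complex \<Rightarrow> 'a \<Rightarrow> 'a"  (infixr \<open>*\<^sub>C\<close> 75)
  assumes scaleC_add_right: "c *\<^sub>C (x + y) = c *\<^sub>C x + c *\<^sub>C y"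
    and scaleC_add_left: "(c + d) *\<^sub>C x = c *\<^sub>C x + d *\<^sub>C x"
    and scaleC_scaleC: "c *\<^sub>C d *\<^sub>C x = (c * d) *\<^sub>C x"
    and scaleC_one: "1 *\<^sub>C x = x"

global_interpretation complex_vector: vector_space "scaleC :: complex \<Rightarrow> 'a \<Rightarrow> 'a :: complex_vector"
  defines csubspace = complex_vector.subspace
    and cspan = complex_vector.span
    and cdependent = complex_vector.dependent
    and crepresentation = complex_vector.representation
    and cextend_basis = complex_vector.extend_basis
    and cdim = complex_vector.dim
  by unfold_locales (simp_all add: scaleC_add_right scaleC_add_left scaleC_scaleC scaleC_one)

instantiation complex :: complex_vector
begin
definition scaleC_complex_def: "c *\<^sub>C (z::complex) = c * z"
instance by standard (simp_all add: scaleC_complex_def algebra_simps)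
end

instantiation "fun" :: (type, complex_vector) complex_vector
begin
definition scaleC_fun_def: "c *\<^sub>C f = (\<lambda>x. c *\<^sub>C f x)"
instance
  by standard (simp_all add: scaleC_fun_def plus_fun_def scaleC_add_right scaleC_add_left
      scaleC_scaleC scaleC_one)
end

instantiation prod :: (complex_vector, complex_vector) complex_vector
begin
definition scaleC_prod_def: "c *\<^sub>C p = (c *\<^sub>C fst p, c *\<^sub>C snd p)"
instance
  by standard (simp_all add: scaleC_prod_def plus_prod_def scaleC_add_right scaleC_add_left
      scaleC_scaleC scaleC_one)
end

text \<open>
  The vector spaces below are linear subspaces \<open>V\<close> of types of class \<open>complex_vector\<close>, so that
  families of spaces of varying dimension (including 0) can be indexed by numbers.
\<close>

definition fin_dim :: "'a::complex_vector set \<Rightarrow> bool" where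
  "fin_dim V \<longleftrightarrow> csubspace V \<and> (\<exists>S. finite S \<and> cspan S = V)"

definition codim :: "'a::complex_vector set \<Rightarrow> 'a set \<Rightarrow> real" where
  "codim V U = real (cdim V) - real (cdim U)"

text \<open>
  A map defined on a subspace \<open>V\<close> is represented by the function that is \<open>0\<close> off \<open>V\<close>, so that
  equality of maps on \<open>V\<close> is equality of functions.
\<close>

definition res :: "'a set \<Rightarrow> ('a \<Rightarrow> 'b::zero) \<Rightarrow> 'a \<Rightarrow> 'b" where
  "res V f = (\<lambda>x. if x \<in> V then f x else 0)"

definition Hom :: "'a::complex_vector set \<Rightarrow> 'b::complex_vector set \<Rightarrow> ('a \<Rightarrow> 'b) set" where
  "Hom V W = {f. (\<forall>x\<in>V. f x \<in> W) \<and> (\<forall>x\<in>V. \<forall>y\<in>V. f (x + y) = f x + f y) \<and>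
                 (\<forall>c. \<forall>x\<in>V. f (c *\<^sub>C x) = c *\<^sub>C f x) \<and> (\<forall>x. x \<notin> V \<longrightarrow> f x = 0)}"

definition dual :: "'a::complex_vector set \<Rightarrow> ('a \<Rightarrow> complex) set" where
  "dual V = Hom V UNIV"

definition GL :: "'a::complex_vector set \<Rightarrow> ('a \<Rightarrow> 'a) set" where
  "GL V = {f \<in> Hom V V. bij_betw f V V}"

text \<open>
  Bilinear maps \<open>U \<times> V \<rightarrow> W\<close>, in other words linear maps \<open>U \<otimes> V \<rightarrow> W\<close>, are the elements of
  \<open>Hom U (Hom V W)\<close>.  Surjectivity is that of the linear map on \<open>U \<otimes> V\<close>.
\<close>

definition tsurj ::
  "('a::complex_vector \<Rightarrow> 'b::complex_vector \<Rightarrow> 'c::complex_vector) \<Rightarrow> 'a set \<Rightarrow> 'b set \<Rightarrow> 'c set \<Rightarrow> bool"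
  where "tsurj \<beta> U V W \<longleftrightarrow> cspan {\<beta> u v |u v. u \<in> U \<and> v \<in> V} = W"

definition dsum :: "'i set \<Rightarrow> ('i \<Rightarrow> 'a::zero set) \<Rightarrow> ('i \<Rightarrow> 'a) set" where
  "dsum I V = {f. (\<forall>i\<in>I. f i \<in> V i) \<and> (\<forall>i. i \<notin> I \<longrightarrow> f i = 0)}"


section \<open>Tensor products\<close>

text \<open>
  \<open>U \<otimes> V\<close> is realised inside the dual of the space of bilinear forms on \<open>U \<times> V\<close>, the pure tensor
  \<open>u \<otimes> v\<close> being evaluation at \<open>(u, v)\<close>.  For subspaces \<open>U' \<subseteq> U\<close> and \<open>V' \<subseteq> V\<close>,
  \<open>subtensor U V U' V'\<close> is \<open>U' \<otimes> V'\<close> regarded as a subspace of \<open>U \<otimes> V\<close>.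
\<close>

definition pure_tensor ::
  "'u::complex_vector set \<Rightarrow> 'v::complex_vector set \<Rightarrow> 'u \<Rightarrow> 'v \<Rightarrow> ('u \<Rightarrow> 'v \<Rightarrow> complex) \<Rightarrow> complex" where
  "pure_tensor U V u v = res (Hom U (dual V)) (\<lambda>\<beta>. \<beta> u v)"

definition subtensor ::
  "'u::complex_vector set \<Rightarrow> 'v::complex_vector set \<Rightarrow> 'u set \<Rightarrow> 'v set \<Rightarrow>
    (('u \<Rightarrow> 'v \<Rightarrow> complex) \<Rightarrow> complex) set" where
  "subtensor U V U' V' = cspan {pure_tensor U V u v |u v. u \<in> U' \<and> v \<in> V'}"

definition tensor ::
  "'u::complex_vector set \<Rightarrow> 'v::complex_vector set \<Rightarrow> (('u \<Rightarrow> 'v \<Rightarrow> complex) \<Rightarrow> complex) set" where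
  "tensor U V = subtensor U V U V"

text \<open>
  The linear map on \<open>U \<otimes> V\<close> with \<open>u \<otimes> v \<mapsto> \<beta> u v\<close>, for a bilinear map \<open>\<beta>\<close> on \<open>U \<times> V\<close> with values
  in a space of complex-valued functions (tensor products are such spaces); see
  \<open>tensor_lift_pure\<close> and \<open>tensor_lift_Hom\<close> below.
\<close>

definition tensor_lift ::
  "'u set \<Rightarrow> 'v set \<Rightarrow> ('u \<Rightarrow> 'v \<Rightarrow> 'z \<Rightarrow> complex) \<Rightarrow> (('u \<Rightarrow> 'v \<Rightarrow> complex) \<Rightarrow> complex) \<Rightarrow> 'z \<Rightarrow> complex" where
  "tensor_lift U V \<beta> t = (\<lambda>z. t (res U (\<lambda>u. res V (\<lambda>v. \<beta> u v z))))"

definition id_tensor ::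
  "'u::complex_vector set \<Rightarrow> 'v::complex_vector set \<Rightarrow> 'w::complex_vector set \<Rightarrow> ('v \<Rightarrow> 'w) \<Rightarrow>
    (('u \<Rightarrow> 'v \<Rightarrow> complex) \<Rightarrow> complex) \<Rightarrow> ('u \<Rightarrow> 'w \<Rightarrow> complex) \<Rightarrow> complex" where
  "id_tensor U V W f = tensor_lift U V (\<lambda>u v. pure_tensor U W u (f v))"

lemma tensor_lift_pure:
  assumes U: "csubspace U" and V: "csubspace V"
    and b: "\<beta> \<in> Hom U (Hom V UNIV)" and u: "u \<in> U" and v: "v \<in> V"
  shows "tensor_lift U V \<beta> (pure_tensor U V u v) = \<beta> u v"
proof
  fix z
  have "res U (\<lambda>u. res V (\<lambda>v. \<beta> u v z)) \<in> Hom U (dual V)"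
    using U V b by (auto simp: complex_vector.subspace_def Hom_def dual_def res_def fun_eq_iff plus_fun_def scaleC_fun_def zero_fun_def
        scaleC_complex_def)
  then show "tensor_lift U V \<beta> (pure_tensor U V u v) z = \<beta> u v z"
    using u v by (simp add: tensor_lift_def pure_tensor_def res_def)
qed

lemma csubspace_tensor: "csubspace (tensor U V)"
  unfolding tensor_def subtensor_def by (rule complex_vector.subspace_span)

lemma tensor_lift_Hom:
  assumes U: "csubspace U" and V: "csubspace V" and X: "csubspace X"
    and b: "\<beta> \<in> Hom U (Hom V X)"
  shows "res (tensor U V) (tensor_lift U V \<beta>) \<in> Hom (tensor U V) X"
proof -
  have b': "\<beta> \<in> Hom U (Hom V UNIV)" using b by (auto simp: Hom_def)
  have add: "tensor_lift U V \<beta> (s + t) = tensor_lift U V \<beta> s + tensor_lift U V \<beta> t" for s t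
    by (simp add: tensor_lift_def fun_eq_iff plus_fun_def)
  have sc: "tensor_lift U V \<beta> (c *\<^sub>C t) = c *\<^sub>C tensor_lift U V \<beta> t" for c t
    by (simp add: tensor_lift_def fun_eq_iff scaleC_fun_def)
  have z: "tensor_lift U V \<beta> 0 = 0"
    by (simp add: tensor_lift_def fun_eq_iff)
  have "csubspace {t. tensor_lift U V \<beta> t \<in> X}"
    using X by (auto simp: complex_vector.subspace_def add sc z)
  moreover have "{pure_tensor U V u v |u v. u \<in> U \<and> v \<in> V} \<subseteq> {t. tensor_lift U V \<beta> t \<in> X}"
    using b by (auto simp: tensor_lift_pure[OF U V b'] Hom_def)
  ultimately have "tensor U V \<subseteq> {t. tensor_lift U V \<beta> t \<in> X}"
    unfolding tensor_def subtensor_def by (rule complex_vector.span_minimal[rotated])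
  then show ?thesis
    using csubspace_tensor[of U V]
    by (auto simp: Hom_def res_def add sc complex_vector.subspace_def)
qed


section \<open>Zariski closure\<close>

text \<open>
  Polynomial functions on the affine space \<open>V\<close>, without coordinates: the algebra generated by the
  linear forms.
\<close>

inductive_set poly_fun :: "'a::complex_vector set \<Rightarrow> ('a \<Rightarrow> complex) set" for V where
  const: "(\<lambda>_. c) \<in> poly_fun V"
| linear: "f \<in> dual V \<Longrightarrow> f \<in> poly_fun V"
| add: "f \<in> poly_fun V \<Longrightarrow> g \<in> poly_fun V \<Longrightarrow> (\<lambda>x. f x + g x) \<in> poly_fun V"
| mult: "f \<in> poly_fun V \<Longrightarrow> g \<in> poly_fun V \<Longrightarrow> (\<lambda>x. f x * g x) \<in> poly_fun V"

definition zariski_closure :: "'a::complex_vector set \<Rightarrow> 'a set \<Rightarrow> 'a set" where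
  "zariski_closure V S = {v \<in> V. \<forall>f\<in>poly_fun V. (\<forall>s\<in>S. f s = 0) \<longrightarrow> f v = 0}"


section \<open>Systems of spaces with compositions\<close>

text \<open>
  \<open>cAA D k j i\<close>, \<open>cHA D l j i\<close>, \<open>cBH D m l i\<close>, \<open>cBB D n m l\<close> are the compositions
  \<open>A\<^sub>k\<^sub>j \<otimes> A\<^sub>j\<^sub>i \<rightarrow> A\<^sub>k\<^sub>i\<close>, \<open>H\<^sub>l\<^sub>j \<otimes> A\<^sub>j\<^sub>i \<rightarrow> H\<^sub>l\<^sub>i\<close>, \<open>B\<^sub>m\<^sub>l \<otimes> H\<^sub>l\<^sub>i \<rightarrow> H\<^sub>m\<^sub>i\<close>, \<open>B\<^sub>n\<^sub>m \<otimes> B\<^sub>m\<^sub>l \<rightarrow> B\<^sub>n\<^sub>l\<close>;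
  \<open>eA D i\<close> and \<open>eB D l\<close> are the elements \<open>1\<close> of \<open>A\<^sub>i\<^sub>i = \<complex>\<close> and \<open>B\<^sub>l\<^sub>l = \<complex>\<close>.
\<close>

record ('a, 'b, 'h, 'm, 'n) comp_system =
  nr :: nat
  ns :: nat
  spA :: "nat \<Rightarrow> nat \<Rightarrow> 'a set"
  spB :: "nat \<Rightarrow> nat \<Rightarrow> 'b set"
  spH :: "nat \<Rightarrow> nat \<Rightarrow> 'h set"
  spM :: "nat \<Rightarrow> 'm set"
  spN :: "nat \<Rightarrow> 'n set"
  eA :: "nat \<Rightarrow> 'a"
  eB :: "nat \<Rightarrow> 'b"
  cAA :: "nat \<Rightarrow> nat \<Rightarrow> nat \<Rightarrow> 'a \<Rightarrow> 'a \<Rightarrow> 'a"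
  cHA :: "nat \<Rightarrow> nat \<Rightarrow> nat \<Rightarrow> 'h \<Rightarrow> 'a \<Rightarrow> 'h"
  cBH :: "nat \<Rightarrow> nat \<Rightarrow> nat \<Rightarrow> 'b \<Rightarrow> 'h \<Rightarrow> 'h"
  cBB :: "nat \<Rightarrow> nat \<Rightarrow> nat \<Rightarrow> 'b \<Rightarrow> 'b \<Rightarrow> 'b"

text \<open>The induced maps \<open>H\<^sub>l\<^sub>i\<^sup>* \<otimes> A\<^sub>j\<^sub>i \<rightarrow> H\<^sub>l\<^sub>j\<^sup>*\<close>, \<open>H\<^sub>m\<^sub>i\<^sup>* \<otimes> B\<^sub>m\<^sub>l \<rightarrow> H\<^sub>l\<^sub>i\<^sup>*\<close> and
  \<open>B\<^sub>n\<^sub>l\<^sup>* \<otimes> B\<^sub>n\<^sub>m \<rightarrow> B\<^sub>m\<^sub>l\<^sup>*\<close>.\<close>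

definition dHA :: "('a, 'b, 'h, 'm, 'n) comp_system \<Rightarrow> nat \<Rightarrow> nat \<Rightarrow> nat \<Rightarrow>
    ('h \<Rightarrow> complex) \<Rightarrow> 'a \<Rightarrow> 'h \<Rightarrow> complex" where
  "dHA D l j i \<chi> a = res (spH D l j) (\<lambda>h. \<chi> (cHA D l j i h a))"

definition dHB :: "('a, 'b, 'h, 'm, 'n) comp_system \<Rightarrow> nat \<Rightarrow> nat \<Rightarrow> nat \<Rightarrow>
    ('h \<Rightarrow> complex) \<Rightarrow> 'b \<Rightarrow> 'h \<Rightarrow> complex" where
  "dHB D m l i \<chi> b = res (spH D l i) (\<lambda>h. \<chi> (cBH D m l i b h))"

definition dBB :: "('a, 'b, 'h, 'm, 'n) comp_system \<Rightarrow> nat \<Rightarrow> nat \<Rightarrow> nat \<Rightarrow>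
    ('b \<Rightarrow> complex) \<Rightarrow> 'b \<Rightarrow> 'b \<Rightarrow> complex" where
  "dBB D n m l f b = res (spB D m l) (\<lambda>b'. f (cBB D n m l b b'))"

locale composition_system =
  fixes D :: "('a::complex_vector, 'b::complex_vector, 'h::complex_vector,
               'm::complex_vector, 'n::complex_vector) comp_system" (structure)
  assumes nr: "1 \<le> nr D" and ns: "1 \<le> ns D"
    and fin_A: "\<lbrakk>1 \<le> i; i \<le> j; j \<le> nr D\<rbrakk> \<Longrightarrow> fin_dim (spA D j i)"
    and fin_B: "\<lbrakk>1 \<le> l; l \<le> m; m \<le> ns D\<rbrakk> \<Longrightarrow> fin_dim (spB D m l)"
    and fin_H: "\<lbrakk>1 \<le> i; i \<le> nr D; 1 \<le> l; l \<le> ns D\<rbrakk> \<Longrightarrow> fin_dim (spH D l i)"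
    and fin_M: "\<lbrakk>1 \<le> i; i \<le> nr D\<rbrakk> \<Longrightarrow> fin_dim (spM D i)"
    and fin_N: "\<lbrakk>1 \<le> l; l \<le> ns D\<rbrakk> \<Longrightarrow> fin_dim (spN D l)"
    and A_diag: "\<lbrakk>1 \<le> i; i \<le> nr D\<rbrakk> \<Longrightarrow> eA D i \<noteq> 0 \<and> spA D i i = range (\<lambda>z. z *\<^sub>C eA D i)"
    and B_diag: "\<lbrakk>1 \<le> l; l \<le> ns D\<rbrakk> \<Longrightarrow> eB D l \<noteq> 0 \<and> spB D l l = range (\<lambda>z. z *\<^sub>C eB D l)"
    and cAA: "\<lbrakk>1 \<le> i; i \<le> j; j \<le> k; k \<le> nr D\<rbrakk> \<Longrightarrow>
        cAA D k j i \<in> Hom (spA D k j) (Hom (spA D j i) (spA D k i))"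
    and cHA: "\<lbrakk>1 \<le> i; i \<le> j; j \<le> nr D; 1 \<le> l; l \<le> ns D\<rbrakk> \<Longrightarrow>
        cHA D l j i \<in> Hom (spH D l j) (Hom (spA D j i) (spH D l i))"
    and cBH: "\<lbrakk>1 \<le> i; i \<le> nr D; 1 \<le> l; l \<le> m; m \<le> ns D\<rbrakk> \<Longrightarrow>
        cBH D m l i \<in> Hom (spB D m l) (Hom (spH D l i) (spH D m i))"
    and cBB: "\<lbrakk>1 \<le> l; l \<le> m; m \<le> n; n \<le> ns D\<rbrakk> \<Longrightarrow>
        cBB D n m l \<in> Hom (spB D n m) (Hom (spB D m l) (spB D n l))"
    and AA_unit: "\<lbrakk>1 \<le> i; i \<le> j; j \<le> nr D; a \<in> spA D j i\<rbrakk> \<Longrightarrow>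
        cAA D j i i a (eA D i) = a \<and> cAA D j j i (eA D j) a = a"
    and HA_unit: "\<lbrakk>1 \<le> i; i \<le> nr D; 1 \<le> l; l \<le> ns D; h \<in> spH D l i\<rbrakk> \<Longrightarrow>
        cHA D l i i h (eA D i) = h"
    and BH_unit: "\<lbrakk>1 \<le> i; i \<le> nr D; 1 \<le> l; l \<le> ns D; h \<in> spH D l i\<rbrakk> \<Longrightarrow>
        cBH D l l i (eB D l) h = h"
    and BB_unit: "\<lbrakk>1 \<le> l; l \<le> m; m \<le> ns D; b \<in> spB D m l\<rbrakk> \<Longrightarrow>
        cBB D m l l b (eB D l) = b \<and> cBB D m m l (eB D m) b = b"
    and AAA_assoc: "\<lbrakk>1 \<le> i; i \<le> j; j \<le> k; k \<le> q; q \<le> nr D;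
        x \<in> spA D q k; y \<in> spA D k j; z \<in> spA D j i\<rbrakk> \<Longrightarrow>
        cAA D q j i (cAA D q k j x y) z = cAA D q k i x (cAA D k j i y z)"
    and HAA_assoc: "\<lbrakk>1 \<le> i; i \<le> j; j \<le> k; k \<le> nr D; 1 \<le> l; l \<le> ns D;
        h \<in> spH D l k; y \<in> spA D k j; z \<in> spA D j i\<rbrakk> \<Longrightarrow>
        cHA D l j i (cHA D l k j h y) z = cHA D l k i h (cAA D k j i y z)"
    and BHA_assoc: "\<lbrakk>1 \<le> i; i \<le> j; j \<le> nr D; 1 \<le> l; l \<le> m; m \<le> ns D;
        b \<in> spB D m l; h \<in> spH D l j; a \<in> spA D j i\<rbrakk> \<Longrightarrow>
        cHA D m j i (cBH D m l j b h) a = cBH D m l i b (cHA D l j i h a)"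
    and BBH_assoc: "\<lbrakk>1 \<le> i; i \<le> nr D; 1 \<le> l; l \<le> m; m \<le> n; n \<le> ns D;
        b \<in> spB D n m; b' \<in> spB D m l; h \<in> spH D l i\<rbrakk> \<Longrightarrow>
        cBH D n l i (cBB D n m l b b') h = cBH D n m i b (cBH D m l i b' h)"
    and BBB_assoc: "\<lbrakk>1 \<le> l; l \<le> m; m \<le> n; n \<le> q; q \<le> ns D;
        b \<in> spB D q n; b' \<in> spB D n m; b'' \<in> spB D m l\<rbrakk> \<Longrightarrow>
        cBB D q m l (cBB D q n m b b') b'' = cBB D q n l b (cBB D n m l b' b'')"
    and cAA_surj: "\<lbrakk>1 \<le> i; i \<le> j; j \<le> k; k \<le> nr D\<rbrakk> \<Longrightarrow>
        tsurj (cAA D k j i) (spA D k j) (spA D j i) (spA D k i)"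
    and cHA_surj: "\<lbrakk>1 \<le> i; i \<le> j; j \<le> nr D; 1 \<le> l; l \<le> ns D\<rbrakk> \<Longrightarrow>
        tsurj (cHA D l j i) (spH D l j) (spA D j i) (spH D l i)"
    and cBH_surj: "\<lbrakk>1 \<le> i; i \<le> nr D; 1 \<le> l; l \<le> m; m \<le> ns D\<rbrakk> \<Longrightarrow>
        tsurj (cBH D m l i) (spB D m l) (spH D l i) (spH D m i)"
    and cBB_surj: "\<lbrakk>1 \<le> l; l \<le> m; m \<le> n; n \<le> ns D\<rbrakk> \<Longrightarrow>
        tsurj (cBB D n m l) (spB D n m) (spB D m l) (spB D n l)"
    and dHA_surj: "\<lbrakk>1 \<le> i; i \<le> j; j \<le> nr D; 1 \<le> l; l \<le> ns D\<rbrakk> \<Longrightarrow>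
        tsurj (dHA D l j i) (dual (spH D l i)) (spA D j i) (dual (spH D l j))"
    and dHB_surj: "\<lbrakk>1 \<le> i; i \<le> nr D; 1 \<le> l; l \<le> m; m \<le> ns D\<rbrakk> \<Longrightarrow>
        tsurj (dHB D m l i) (dual (spH D m i)) (spB D m l) (dual (spH D l i))"

abbreviation dimA where "dimA D j i \<equiv> real (cdim (spA D j i))"
abbreviation dimB where "dimB D m l \<equiv> real (cdim (spB D m l))"
abbreviation dimM where "dimM D i \<equiv> real (cdim (spM D i))"
abbreviation dimN where "dimN D l \<equiv> real (cdim (spN D l))"


section \<open>The space \<open>W\<close>, the larger space and its group action\<close>

type_synonym ('u, 'v) tens = "('u \<Rightarrow> 'v \<Rightarrow> complex) \<Rightarrow> complex"
type_synonym ('m, 'a) Pvec = "nat \<Rightarrow> ('m, 'a) tens"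
type_synonym ('n, 'b) Qvec = "nat \<Rightarrow> ('n, 'b \<Rightarrow> complex) tens"
type_synonym ('a, 'b, 'h, 'm, 'n) bigpoint =
  "(nat \<Rightarrow> ('m, 'a) Pvec \<Rightarrow> 'a \<Rightarrow> ('m, 'a) Pvec) \<times>
   (('m, 'a) Pvec \<Rightarrow> ('h \<Rightarrow> complex) \<Rightarrow> ('n, 'b) Qvec) \<times>
   (nat \<Rightarrow> ('n, 'b) Qvec \<Rightarrow> 'b \<Rightarrow> ('n, 'b) Qvec)"

definition smallW :: "('a::complex_vector, 'b, 'h::complex_vector, 'm::complex_vector,
    'n::complex_vector) comp_system \<Rightarrow> (nat \<Rightarrow> nat \<Rightarrow> 'm \<Rightarrow> ('n, 'h) tens) set" where
  "smallW D = dsum {1..ns D} (\<lambda>l. dsum {1..nr D} (\<lambda>i. Hom (spM D i) (tensor (spN D l) (spH D l i))))"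

definition spP :: "('a::complex_vector, 'b, 'h, 'm::complex_vector, 'n) comp_system \<Rightarrow> nat \<Rightarrow>
    ('m, 'a) Pvec set" where
  "spP D i = dsum {i..nr D} (\<lambda>j. tensor (spM D j) (spA D j i))"

definition spQ :: "('a, 'b::complex_vector, 'h, 'm, 'n::complex_vector) comp_system \<Rightarrow> nat \<Rightarrow>
    ('n, 'b) Qvec set" where
  "spQ D l = dsum {1..l} (\<lambda>m. tensor (spN D m) (dual (spB D l m)))"

definition bigW :: "('a::complex_vector, 'b::complex_vector, 'h::complex_vector, 'm::complex_vector,
    'n::complex_vector) comp_system \<Rightarrow> ('a, 'b, 'h, 'm, 'n) bigpoint set" where
  "bigW D =
     dsum {2..nr D} (\<lambda>i. Hom (spP D i) (Hom (spA D i (i - 1)) (spP D (i - 1)))) \<times>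
     Hom (spP D 1) (Hom (dual (spH D (ns D) 1)) (spQ D (ns D))) \<times>
     dsum {1..<ns D} (\<lambda>l. Hom (spQ D (Suc l)) (Hom (spB D (Suc l) l) (spQ D l)))"

definition act :: "('a::complex_vector, 'b::complex_vector, 'h::complex_vector, 'm::complex_vector,
    'n::complex_vector) comp_system \<Rightarrow>
    (nat \<Rightarrow> ('m, 'a) Pvec \<Rightarrow> ('m, 'a) Pvec) \<Rightarrow> (nat \<Rightarrow> ('n, 'b) Qvec \<Rightarrow> ('n, 'b) Qvec) \<Rightarrow>
    ('a, 'b, 'h, 'm, 'n) bigpoint \<Rightarrow> ('a, 'b, 'h, 'm, 'n) bigpoint" where
  "act D g h = (\<lambda>(x, \<psi>, y).
     (res {2..nr D} (\<lambda>i. res (spP D i) (\<lambda>p. res (spA D i (i - 1)) (\<lambda>a.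
         g (i - 1) (x i (inv_into (spP D i) (g i) p) a)))),
      res (spP D 1) (\<lambda>p. res (dual (spH D (ns D) 1)) (\<lambda>\<chi>.
         h (ns D) (\<psi> (inv_into (spP D 1) (g 1) p) \<chi>))),
      res {1..<ns D} (\<lambda>l. res (spQ D (Suc l)) (\<lambda>q. res (spB D (Suc l) l) (\<lambda>b.
         h l (y l (inv_into (spQ D (Suc l)) (h (Suc l)) q) b))))))"

definition xi :: "('a::complex_vector, 'b, 'h, 'm::complex_vector, 'n) comp_system \<Rightarrow> nat \<Rightarrow>
    ('m, 'a) Pvec \<Rightarrow> 'a \<Rightarrow> ('m, 'a) Pvec" where
  "xi D i = res (spP D i) (\<lambda>p. res (spA D i (i - 1)) (\<lambda>a. res {i..nr D} (\<lambda>j.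
     id_tensor (spM D j) (spA D j i) (spA D j (i - 1)) (\<lambda>a'. cAA D j i (i - 1) a' a) (p j))))"

definition eta :: "('a, 'b::complex_vector, 'h, 'm, 'n::complex_vector) comp_system \<Rightarrow> nat \<Rightarrow>
    ('n, 'b) Qvec \<Rightarrow> 'b \<Rightarrow> ('n, 'b) Qvec" where
  "eta D l = res (spQ D (Suc l)) (\<lambda>q. res (spB D (Suc l) l) (\<lambda>b. res {1..l} (\<lambda>m.
     id_tensor (spN D m) (dual (spB D (Suc l) m)) (dual (spB D l m)) (\<lambda>f. dBB D (Suc l) l m f b) (q m))))"

text \<open>
  On \<open>\<mu> \<otimes> a \<in> M\<^sub>i \<otimes> A\<^sub>i\<^sub>1\<close> and \<open>\<chi> \<in> H\<^sub>s\<^sub>1\<^sup>*\<close>, the \<open>N\<^sub>l \<otimes> B\<^sub>s\<^sub>l\<^sup>*\<close>-component of \<open>\<gamma>(w)\<close> is the image of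
  \<open>\<phi>\<^sub>l\<^sub>i(\<mu>)\<close> under \<open>n \<otimes> h \<mapsto> n \<otimes> (b \<mapsto> \<chi>(b \<circ> (h \<circ> a)))\<close>.
\<close>

definition gamma :: "('a::complex_vector, 'b::complex_vector, 'h::complex_vector, 'm::complex_vector,
    'n::complex_vector) comp_system \<Rightarrow> (nat \<Rightarrow> nat \<Rightarrow> 'm \<Rightarrow> ('n, 'h) tens) \<Rightarrow>
    ('m, 'a) Pvec \<Rightarrow> ('h \<Rightarrow> complex) \<Rightarrow> ('n, 'b) Qvec" where
  "gamma D \<phi> = res (spP D 1) (\<lambda>p. res (dual (spH D (ns D) 1)) (\<lambda>\<chi>. res {1..ns D} (\<lambda>l.
     \<Sum>i = 1..nr D. tensor_lift (spM D i) (spA D i 1)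
       (\<lambda>\<mu> a. tensor_lift (spN D l) (spH D l i)
          (\<lambda>n h. pure_tensor (spN D l) (dual (spB D (ns D) l)) n
             (res (spB D (ns D) l) (\<lambda>b. \<chi> (cBH D (ns D) l 1 b (cHA D l i 1 h a)))))
          (\<phi> l i \<mu>))
       (p i))))"

definition zeta :: "('a::complex_vector, 'b::complex_vector, 'h::complex_vector, 'm::complex_vector,
    'n::complex_vector) comp_system \<Rightarrow> (nat \<Rightarrow> nat \<Rightarrow> 'm \<Rightarrow> ('n, 'h) tens) \<Rightarrow>
    ('a, 'b, 'h, 'm, 'n) bigpoint" where
  "zeta D \<phi> = (res {2..nr D} (xi D), gamma D \<phi>, res {1..<ns D} (eta D))"

definition Zset :: "('a::complex_vector, 'b::complex_vector, 'h::complex_vector, 'm::complex_vector,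
    'n::complex_vector) comp_system \<Rightarrow> ('a, 'b, 'h, 'm, 'n) bigpoint set" where
  "Zset D = {act D g h (zeta D w) |g h w.
     (\<forall>i\<in>{1..nr D}. g i \<in> GL (spP D i)) \<and> (\<forall>l\<in>{1..ns D}. h l \<in> GL (spQ D l)) \<and> w \<in> smallW D}"


section \<open>Polarizations and semi-stability\<close>

definition polarization :: "('a, 'b, 'h, 'm::complex_vector, 'n::complex_vector) comp_system \<Rightarrow>
    (nat \<Rightarrow> real) \<Rightarrow> (nat \<Rightarrow> real) \<Rightarrow> bool" where
  "polarization D lam mu \<longleftrightarrow>
     (\<forall>i\<in>{1..nr D}. lam i \<in> \<rat>) \<and> (\<forall>l\<in>{1..ns D}. mu l \<in> \<rat>) \<and>
     (\<Sum>i = 1..nr D. lam i * dimM D i) = 1 \<and> (\<Sum>l = 1..ns D. mu l * dimN D l) = 1"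

definition associated_polarization ::
  "('a::complex_vector, 'b::complex_vector, 'h, 'm, 'n) comp_system \<Rightarrow>
    (nat \<Rightarrow> real) \<Rightarrow> (nat \<Rightarrow> real) \<Rightarrow> (nat \<Rightarrow> real) \<Rightarrow> (nat \<Rightarrow> real) \<Rightarrow> bool" where
  "associated_polarization D lam mu al be \<longleftrightarrow>
     (\<forall>j\<in>{1..nr D}. lam j = (\<Sum>i = 1..j. dimA D j i * al i)) \<and>
     (\<forall>l\<in>{1..ns D}. mu l = (\<Sum>m = l..ns D. dimB D m l * be m))"

definition semistable :: "('a::complex_vector, 'b::complex_vector, 'h::complex_vector,
    'm::complex_vector, 'n::complex_vector) comp_system \<Rightarrow> (nat \<Rightarrow> real) \<Rightarrow> (nat \<Rightarrow> real) \<Rightarrow>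
    ('a, 'b, 'h, 'm, 'n) bigpoint set" where
  "semistable D al be = {(x, \<psi>, y) \<in> bigW D. \<forall>P' Q'.
     (\<forall>i\<in>{1..nr D}. csubspace (P' i) \<and> P' i \<subseteq> spP D i) \<and>
     (\<forall>l\<in>{1..ns D}. csubspace (Q' l) \<and> Q' l \<subseteq> spQ D l) \<and>
     \<not> ((\<forall>i\<in>{1..nr D}. P' i = {0}) \<and> (\<forall>l\<in>{1..ns D}. Q' l = {0})) \<and>
     \<not> ((\<forall>i\<in>{1..nr D}. P' i = spP D i) \<and> (\<forall>l\<in>{1..ns D}. Q' l = spQ D l)) \<and>
     (\<forall>i\<in>{2..nr D}. \<forall>p\<in>P' i. \<forall>a\<in>spA D i (i - 1). x i p a \<in> P' (i - 1)) \<and>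
     (\<forall>p\<in>P' 1. \<forall>\<chi>\<in>dual (spH D (ns D) 1). \<psi> p \<chi> \<in> Q' (ns D)) \<and>
     (\<forall>l\<in>{1..<ns D}. \<forall>q\<in>Q' (Suc l). \<forall>b\<in>spB D (Suc l) l. y l q b \<in> Q' l)
     \<longrightarrow> (\<Sum>i = 1..nr D. al i * real (cdim (P' i))) - (\<Sum>l = 1..ns D. be l * real (cdim (Q' l))) \<le> 0}"


section \<open>The constants\<close>

text \<open>
  Let \<open>\<kappa> : X \<otimes> V \<rightarrow> Y\<close> and let \<open>\<delta> : T \<otimes> V \<otimes> X \<rightarrow> T \<otimes> Y\<close> be the induced map.
  The ratios are \<open>codim (\<delta>(K \<otimes> X)) / codim K\<close>, for proper subspaces \<open>K\<close> of \<open>T \<otimes> V\<close> not contained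
  in \<open>T' \<otimes> V\<close> for a proper subspace \<open>T'\<close> of \<open>T\<close>.
\<close>

definition codim_ratios :: "'t::complex_vector set \<Rightarrow> 'v::complex_vector set \<Rightarrow>
    'x::complex_vector set \<Rightarrow> 'y::complex_vector set \<Rightarrow> ('x \<Rightarrow> 'v \<Rightarrow> 'y) \<Rightarrow> real set" where
  "codim_ratios T V X Y \<kappa> =
     {codim (tensor T Y) (cspan {id_tensor T V Y (\<kappa> \<chi>) t |t \<chi>. t \<in> K \<and> \<chi> \<in> X})
        / codim (tensor T V) K |K.
      csubspace K \<and> K \<subset> tensor T V \<and>
      (\<forall>T'. csubspace T' \<and> T' \<subset> T \<longrightarrow> \<not> K \<subseteq> subtensor T V T' V)}"

definition sup0 :: "real set \<Rightarrow> real" where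
  "sup0 S = (if S = {} then 0 else Sup S)"

definition c_const :: "('a::complex_vector, 'b, 'h::complex_vector, 'm::complex_vector, 'n) comp_system \<Rightarrow>
    nat \<Rightarrow> real" where
  "c_const D l = sup0 (codim_ratios (spM D 2) (spA D 2 1)
     (dual (spH D l 1)) (dual (spH D l 2)) (dHA D l 2 1))"

definition d_const :: "('a, 'b::complex_vector, 'h::complex_vector, 'm, 'n::complex_vector) comp_system \<Rightarrow>
    nat \<Rightarrow> real" where
  "d_const D i = sup0 (codim_ratios (dual (spN D 1)) (spB D 2 1)
     (dual (spH D 2 i)) (dual (spH D 1 i)) (dHB D 2 1 i))"

end

theory Submission
  imports Defs
begin

text \<open>
  A point \<open>(x, \<psi>, y)\<close> of \<open>\<^bold>W\<close> lies in \<open>Z\<close> if and only if \<open>x : P\<^sub>2 \<otimes> A\<^sub>2\<^sub>1 \<rightarrow> P\<^sub>1\<close> is injective,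
  \<open>y : Q\<^sub>2 \<rightarrow> Q\<^sub>1 \<otimes> B\<^sub>2\<^sub>1\<^sup>*\<close> is surjective (if \<open>s = 2\<close>), and all composites of \<open>x\<close>, \<open>\<psi>\<close> and \<open>y\<close> factor
  through the spaces \<open>H\<^sub>l\<^sub>i\<^sup>*\<close>.  The last condition is closed, so at a boundary point \<open>x\<close> has a
  kernel \<open>K \<noteq> 0\<close> or \<open>y\<close> is not surjective.  In the first case let \<open>M' \<subseteq> M\<^sub>2\<close> be the smallest subspace
  with \<open>K \<subseteq> M' \<otimes> A\<^sub>2\<^sub>1\<close>.  The subspaces generated by \<open>P\<^sub>2' = M'\<close> have \<open>dim P\<^sub>1' = \<kappa> < a\<^sub>2\<^sub>1 dim M'\<close> and,
  since the factored maps \<open>P\<^sub>2' \<otimes> H\<^sub>l\<^sub>2\<^sup>* \<rightarrow> Q\<^sub>l\<close> vanish on \<open>\<delta>\<^sub>l(K \<otimes> H\<^sub>l\<^sub>1\<^sup>*)\<close>, \<open>dim Q\<^sub>l' \<le> c\<^sub>l \<kappa>\<close>; the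
  inequality on \<open>\<lambda>\<^sub>2\<close> then says that they destabilise the point.  The second case is dual.
\<close>

section \<open>Linear algebra in subspaces\<close>

text \<open>Everything is decided in the weights of the larger space. For r = 2 one has lambda_1 =
  alpha_1 and lambda_2 = a_21 alpha_1 + alpha_2; for s = 2 also mu_1 = beta_1 + b_21 beta_2 and mu_2
  = beta_2. The combinations in case (ii) are therefore just beta_1 c_1 + beta_2 c_2 and alpha_1 d_1
  + alpha_2 d_2; this is where the differences c_2 - b_21 c_1 and d_1 - d_2 a_21 come from. With
  kappa = dim P_1' < a_21 dim M', semi-stability would give alpha_1 kappa + alpha_2 dim M' <= (sum
  of beta_l c_l) kappa; multiplied by a_21 and combined with the inequality on lambda_2 it becomes
  a_21 dim M' <= kappa. The closure enters only through polynomial identities: a point that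
  satisfies the factorisations and has injective x and surjective y already lies in Z. The dual case
  tests annihilators, so its estimates concern codimensions, and the normalisation of both weight
  sums to 1 is what turns the stability inequality around.\<close>

definition lin_on :: "'a::complex_vector set \<Rightarrow> 'b::complex_vector set \<Rightarrow> ('a \<Rightarrow> 'b) \<Rightarrow> bool" where
  "lin_on V W f \<longleftrightarrow> (\<forall>x\<in>V. f x \<in> W) \<and> (\<forall>x\<in>V. \<forall>y\<in>V. f (x + y) = f x + f y) \<and>
     (\<forall>c. \<forall>x\<in>V. f (c *\<^sub>C x) = c *\<^sub>C f x)"

lemma lin_onI:
  assumes "\<And>x. x \<in> V \<Longrightarrow> f x \<in> W"
    and "\<And>x y. x \<in> V \<Longrightarrow> y \<in> V \<Longrightarrow> f (x + y) = f x + f y"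
    and "\<And>c x. x \<in> V \<Longrightarrow> f (c *\<^sub>C x) = c *\<^sub>C f x"
  shows "lin_on V W f"
  using assms by (simp add: lin_on_def)

lemma lin_on_mem: "lin_on V W f \<Longrightarrow> x \<in> V \<Longrightarrow> f x \<in> W"
  and lin_on_add: "lin_on V W f \<Longrightarrow> x \<in> V \<Longrightarrow> y \<in> V \<Longrightarrow> f (x + y) = f x + f y"
  and lin_on_scale: "lin_on V W f \<Longrightarrow> x \<in> V \<Longrightarrow> f (c *\<^sub>C x) = c *\<^sub>C f x"
  by (simp_all add: lin_on_def)

lemma Hom_iff: "f \<in> Hom V W \<longleftrightarrow> lin_on V W f \<and> (\<forall>x. x \<notin> V \<longrightarrow> f x = 0)"
  by (auto simp: Hom_def lin_on_def)

lemma Hom_lin: "f \<in> Hom V W \<Longrightarrow> lin_on V W f"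
  by (simp add: Hom_iff)

lemma Hom_mem: "f \<in> Hom V W \<Longrightarrow> x \<in> V \<Longrightarrow> f x \<in> W"
  by (auto simp: Hom_def)

lemma Hom_off: "f \<in> Hom V W \<Longrightarrow> x \<notin> V \<Longrightarrow> f x = 0"
  by (auto simp: Hom_def)

lemma lin_on_cong:
  assumes "csubspace V" "\<And>x. x \<in> V \<Longrightarrow> f x = g x"
  shows "lin_on V W f \<longleftrightarrow> lin_on V W g"
  using assms by (auto simp: lin_on_def complex_vector.subspace_def)

lemma lin_on_res: "csubspace V \<Longrightarrow> lin_on V W (res V f) \<longleftrightarrow> lin_on V W f"
  by (rule lin_on_cong) (auto simp: res_def)

text \<open>\<open>Hom\<close> prescribes the value 0 off the domain, while lambda terms that arise
  by composition do not respect this. Linearity is therefore handled by \<open>lin_on\<close>, which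
  ignores the outside, and \<open>res\<close> is applied only where an element of \<open>Hom\<close>
  is demanded.\<close>

lemma res_Hom: "csubspace V \<Longrightarrow> lin_on V W f \<Longrightarrow> res V f \<in> Hom V W"
  by (simp add: Hom_iff lin_on_res) (simp add: res_def)

lemma lin_on_0: "csubspace V \<Longrightarrow> lin_on V W f \<Longrightarrow> f 0 = 0"
  using lin_on_scale[of V W f 0 0] complex_vector.subspace_0[of V] by simp

lemma lin_on_neg: "lin_on V W f \<Longrightarrow> x \<in> V \<Longrightarrow> f (- x) = - f x"
  using lin_on_scale[of V W f x "-1"] by simp

lemma lin_on_diff: "csubspace V \<Longrightarrow> lin_on V W f \<Longrightarrow> x \<in> V \<Longrightarrow> y \<in> V \<Longrightarrow> f (x - y) = f x - f y"
  using lin_on_add[of V W f x "- y"] lin_on_neg[of V W f y] complex_vector.subspace_neg[of V y] by simp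

lemma lin_on_sum: "csubspace V \<Longrightarrow> lin_on V W f \<Longrightarrow> (\<And>i. i \<in> I \<Longrightarrow> g i \<in> V) \<Longrightarrow>
    f (\<Sum>i\<in>I. g i) = (\<Sum>i\<in>I. f (g i))"
  by (induction I rule: infinite_finite_induct)
    (auto simp: lin_on_0 lin_on_add complex_vector.subspace_sum)

lemma lin_on_subset: "lin_on V W f \<Longrightarrow> U \<subseteq> V \<Longrightarrow> W \<subseteq> X \<Longrightarrow> lin_on U X f"
  unfolding lin_on_def by blast

lemma lin_on_compose: "lin_on U V f \<Longrightarrow> lin_on V W g \<Longrightarrow> lin_on U W (\<lambda>x. g (f x))"
  by (simp add: lin_on_def)

lemma lin_on_zero_map: "csubspace W \<Longrightarrow> lin_on V W (\<lambda>_. 0)"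
  by (simp add: lin_on_def complex_vector.subspace_0)

lemma lin_on_plus: "csubspace W \<Longrightarrow> lin_on V W f \<Longrightarrow> lin_on V W g \<Longrightarrow> lin_on V W (\<lambda>x. f x + g x)"
  by (simp add: lin_on_def complex_vector.subspace_add scaleC_add_right)

lemma lin_on_sum_map: "csubspace W \<Longrightarrow> (\<And>i. i \<in> I \<Longrightarrow> lin_on V W (f i)) \<Longrightarrow> lin_on V W (\<lambda>x. \<Sum>i\<in>I. f i x)"
  by (induction I rule: infinite_finite_induct) (auto intro: lin_on_zero_map lin_on_plus)

lemma lin_on_scale_map: "csubspace W \<Longrightarrow> lin_on V W f \<Longrightarrow> lin_on V W (\<lambda>x. c *\<^sub>C f x)"
  by (simp add: lin_on_def complex_vector.subspace_scale scaleC_add_right scaleC_scaleC mult.commute)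

lemma lin_on_coeff: "csubspace W \<Longrightarrow> lin_on V UNIV f \<Longrightarrow> w \<in> W \<Longrightarrow> lin_on V W (\<lambda>x. f x *\<^sub>C w)"
  by (simp add: lin_on_def complex_vector.subspace_scale scaleC_add_left scaleC_scaleC scaleC_complex_def)

lemma lin_on_image_subspace: "csubspace V \<Longrightarrow> lin_on V W f \<Longrightarrow> csubspace (f ` V)"
  using lin_on_0[of V W f] lin_on_add[of V W f, symmetric] lin_on_scale[of V W f, symmetric]
  unfolding complex_vector.subspace_def by (auto simp: image_iff)

lemma lin_on_preimage_subspace:
  "csubspace V \<Longrightarrow> csubspace X \<Longrightarrow> lin_on V W f \<Longrightarrow> csubspace {v \<in> V. f v \<in> X}"
  by (auto simp: complex_vector.subspace_def lin_on_add lin_on_scale lin_on_0)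

lemma lin_on_ker_subspace: "csubspace V \<Longrightarrow> lin_on V W f \<Longrightarrow> csubspace {v \<in> V. f v = 0}"
  by (auto simp: complex_vector.subspace_def lin_on_add lin_on_scale lin_on_0)

lemma lin_on_span_into:
  assumes "csubspace V" "lin_on V W f" "csubspace X" "S \<subseteq> V" "\<And>s. s \<in> S \<Longrightarrow> f s \<in> X" "v \<in> cspan S"
  shows "f v \<in> X"
proof -
  have "cspan S \<subseteq> {v \<in> V. f v \<in> X}"
    using assms by (intro complex_vector.span_minimal lin_on_preimage_subspace) auto
  then show ?thesis using assms by auto
qed

lemma lin_on_eq_span:
  assumes "csubspace V" "lin_on V W f" "lin_on V X g" "S \<subseteq> V" "\<And>s. s \<in> S \<Longrightarrow> f s = g s" "v \<in> cspan S"
  shows "f v = g v"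
proof -
  have "csubspace {v \<in> V. f v = g v}"
    using assms by (auto simp: complex_vector.subspace_def lin_on_add lin_on_scale lin_on_0)
  then have "cspan S \<subseteq> {v \<in> V. f v = g v}"
    using assms by (intro complex_vector.span_minimal) auto
  then show ?thesis using assms by auto
qed

lemma csubspace_Hom:
  assumes "csubspace W"
  shows "csubspace (Hom V W)"
  using assms
  by (auto simp: complex_vector.subspace_def Hom_def plus_fun_def scaleC_fun_def zero_fun_def
      scaleC_add_right scaleC_scaleC mult.commute)

lemma csubspace_dual: "csubspace (dual V)"
  unfolding dual_def by (rule csubspace_Hom) simp

lemma fin_dim_sub: "fin_dim V \<Longrightarrow> csubspace V"
  by (simp add: fin_dim_def)


subsection \<open>Bases\<close>

definition cbasis :: "'a::complex_vector set \<Rightarrow> 'a set \<Rightarrow> bool" where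
  "cbasis B V \<longleftrightarrow> finite B \<and> \<not> cdependent B \<and> cspan B = V"

lemma cbasis_finite: "cbasis B V \<Longrightarrow> finite B"
  by (simp add: cbasis_def)

lemma cbasis_mem: "cbasis B V \<Longrightarrow> b \<in> B \<Longrightarrow> b \<in> V"
  unfolding cbasis_def using complex_vector.span_base by auto

lemma cbasis_sub: "cbasis B V \<Longrightarrow> csubspace V"
  unfolding cbasis_def by auto

lemma cbasis_fin_dim: "cbasis B V \<Longrightarrow> fin_dim V"
  unfolding cbasis_def fin_dim_def by auto

lemma cbasis_card: "cbasis B V \<Longrightarrow> cdim V = card B"
  unfolding cbasis_def using complex_vector.dim_span_eq_card_independent by blast

text \<open>A basis extracted from the finite spanning set has \<open>cdim V\<close> elements; the
  exchange bound against it gives finiteness and the estimate at once.\<close>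

lemma independent_fin_dim:
  assumes "fin_dim V" "\<not> cdependent B" "B \<subseteq> V"
  shows "finite B \<and> card B \<le> cdim V"
proof -
  obtain S where S: "finite S" "cspan S = V" using assms(1) by (auto simp: fin_dim_def)
  obtain C where C: "C \<subseteq> S" "\<not> cdependent C" "S \<subseteq> cspan C"
    using complex_vector.maximal_independent_subset[of S] by blast
  then have "cbasis C V"
    using S unfolding cbasis_def
    by (metis complex_vector.span_mono complex_vector.span_span finite_subset subset_antisym)
  then have "cspan C = V" "finite C" "cdim V = card C" by (auto simp: cbasis_card) (auto simp: cbasis_def)
  then show ?thesis
    using complex_vector.independent_span_bound[of C B] assms by auto
qed

lemma cbasis_extend:
  assumes V: "fin_dim V" and C: "\<not> cdependent C" "C \<subseteq> V"
  obtains B where "cbasis B V" "C \<subseteq> B"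
proof -
  obtain B where B: "C \<subseteq> B" "B \<subseteq> V" "\<not> cdependent B" "V \<subseteq> cspan B"
    using complex_vector.maximal_independent_subset_extend[OF C(2,1)] by metis
  have "cspan B = V"
    using B V complex_vector.span_minimal[of B V] by (auto simp: fin_dim_def)
  then have "cbasis B V"
    using B independent_fin_dim[OF V B(3,2)] by (simp add: cbasis_def)
  then show ?thesis using B that by auto
qed

lemma fin_dim_cbasis:
  assumes "fin_dim V" obtains B where "cbasis B V"
  using cbasis_extend[OF assms complex_vector.independent_empty] by blast

lemma fin_dim_subspace:
  assumes "fin_dim V" "csubspace U" "U \<subseteq> V"
  shows "fin_dim U"
proof -
  obtain B where B: "B \<subseteq> U" "\<not> cdependent B" "U \<subseteq> cspan B"
    using complex_vector.maximal_independent_subset[of U] by blast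
  have "finite B" using independent_fin_dim[OF assms(1) B(2)] B assms by auto
  moreover have "cspan B = U" using B assms complex_vector.span_minimal[of B U] by auto
  ultimately show ?thesis using assms by (auto simp: fin_dim_def)
qed

lemma cdim_mono:
  assumes "fin_dim V" "csubspace U" "U \<subseteq> V"
  shows "cdim U \<le> cdim V"
proof -
  obtain B where "cbasis B U" using fin_dim_subspace[OF assms] fin_dim_cbasis by blast
  then show ?thesis
    using independent_fin_dim[OF assms(1), of B] cbasis_card[of B U] assms(3)
    by (auto simp: cbasis_def complex_vector.span_base subset_iff)
qed

lemma cdim_eq_imp_eq:
  assumes "fin_dim V" "csubspace U" "U \<subseteq> V" "cdim U = cdim V"
  shows "U = V"
proof -
  obtain B where B: "cbasis B U" using fin_dim_subspace[OF assms(1-3)] fin_dim_cbasis by blast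
  have "B \<subseteq> V" using cbasis_mem[OF B] assms(3) by auto
  then obtain C where C: "cbasis C V" "B \<subseteq> C"
    using cbasis_extend[OF assms(1), of B] B by (auto simp: cbasis_def)
  then have "card B = card C" using B assms(4) by (simp add: cbasis_card)
  then have "B = C" using C card_subset_eq by (auto simp: cbasis_def)
  then show ?thesis using B C by (simp add: cbasis_def)
qed

lemma cdim_psubset:
  assumes "fin_dim V" "csubspace U" "U \<subset> V"
  shows "cdim U < cdim V"
  using cdim_mono[of V U] cdim_eq_imp_eq[of V U] assms by auto

lemma fin_dim_span: "finite S \<Longrightarrow> fin_dim (cspan S)"
  by (auto simp: fin_dim_def)

text \<open>The arguments are exchanged so that \<open>co B b\<close> is itself the coordinate
  functional of \<open>b\<close>.\<close>

abbreviation co :: "'a::complex_vector set \<Rightarrow> 'a \<Rightarrow> 'a \<Rightarrow> complex" where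
  "co B b v \<equiv> crepresentation B v b"

lemma co_lin: "cbasis B V \<Longrightarrow> lin_on V UNIV (co B b)"
  by (intro lin_onI)
    (auto simp: cbasis_def complex_vector.representation_add complex_vector.representation_scale scaleC_complex_def)

lemma co_sum: "cbasis B V \<Longrightarrow> v \<in> V \<Longrightarrow> (\<Sum>b\<in>B. co B b v *\<^sub>C b) = v"
  by (rule complex_vector.sum_representation_eq) (auto simp: cbasis_def)

lemma co_basis: "cbasis B V \<Longrightarrow> b \<in> B \<Longrightarrow> co B b' b = (if b' = b then 1 else 0)"
  by (auto simp: cbasis_def complex_vector.representation_basis)

lemma lin_on_co_expand:
  assumes "cbasis B V" "lin_on V W f" "v \<in> V"
  shows "f v = (\<Sum>b\<in>B. co B b v *\<^sub>C f b)"
proof -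
  have "f v = f (\<Sum>b\<in>B. co B b v *\<^sub>C b)" using co_sum[OF assms(1,3)] by simp
  also have "\<dots> = (\<Sum>b\<in>B. co B b v *\<^sub>C f b)"
    using assms cbasis_sub[OF assms(1)] cbasis_mem[OF assms(1)]
    by (subst lin_on_sum) (auto simp: lin_on_scale complex_vector.subspace_scale)
  finally show ?thesis .
qed

lemma lin_on_extend:
  assumes "cbasis B V" "csubspace W" "\<And>b. b \<in> B \<Longrightarrow> f b \<in> W"
  obtains F where "lin_on V W F" "\<And>b. b \<in> B \<Longrightarrow> F b = f b"
proof -
  let ?F = "\<lambda>v. \<Sum>b\<in>B. co B b v *\<^sub>C f b"
  have "lin_on V W ?F"
    using assms by (intro lin_on_sum_map lin_on_coeff co_lin) auto
  moreover have "?F b = f b" if "b \<in> B" for b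
  proof -
    have "?F b = (\<Sum>c\<in>B. if c = b then f c else 0)"
      using that assms(1) by (intro sum.cong) (auto simp: co_basis scaleC_one)
    then show ?thesis using that cbasis_finite[OF assms(1)] by simp
  qed
  ultimately show ?thesis using that by blast
qed

lemma sum_zero_basis:
  assumes "cbasis B V" "(\<Sum>b\<in>B. c b *\<^sub>C b) = 0" "b \<in> B"
  shows "c b = 0"
  using complex_vector.independentD[of B B c b] assms by (auto simp: cbasis_def)

section \<open>Images, kernels and rank\<close>

lemma image_span: "csubspace V \<Longrightarrow> lin_on V W f \<Longrightarrow> S \<subseteq> V \<Longrightarrow> f ` cspan S = cspan (f ` S)"
proof
  assume V: "csubspace V" and f: "lin_on V W f" and S: "S \<subseteq> V"
  have "f v \<in> cspan (f ` S)" if "v \<in> cspan S" for v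
    by (rule lin_on_span_into[OF V f _ S _ that]) (auto intro: complex_vector.span_base)
  then show "f ` cspan S \<subseteq> cspan (f ` S)" by auto
  have "cspan S \<subseteq> V" using V S by (rule complex_vector.span_minimal[rotated])
  then have "csubspace (f ` cspan S)"
    using f by (intro lin_on_image_subspace[of _ W]) (auto intro: lin_on_subset)
  then show "cspan (f ` S) \<subseteq> f ` cspan S"
    by (rule complex_vector.span_minimal[rotated]) (auto intro: complex_vector.span_base)
qed

text \<open>A set of vectors forgets repetitions, so injectivity of the indexing has to accompany
  independence before cardinalities can be counted. Two equal members would satisfy the relation
  with coefficients 1 and -1.\<close>

lemma independent_family:
  assumes "finite I" "\<And>r i. (\<Sum>i\<in>I. r i *\<^sub>C p i) = 0 \<Longrightarrow> i \<in> I \<Longrightarrow> r i = 0"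
  shows "inj_on p I" "\<not> cdependent (p ` I)"
proof -
  show inj: "inj_on p I"
  proof (rule inj_onI, rule ccontr)
    fix x y assume xy: "x \<in> I" "y \<in> I" "p x = p y" "x \<noteq> y"
    let ?r = "\<lambda>z. if z = x then 1 else if z = y then -1 else (0::complex)"
    have "(\<Sum>z\<in>I. ?r z *\<^sub>C p z) = (\<Sum>z\<in>I. (if z = x then p x else 0) - (if z = y then p x else 0))"
      using xy by (intro sum.cong) (auto simp: scaleC_one)
    also have "\<dots> = 0" using xy assms(1) by (simp add: sum_subtractf)
    finally show False using assms(2)[of ?r x] xy by auto
  qed
  show "\<not> cdependent (p ` I)"
  proof (rule complex_vector.independent_if_scalars_zero)
    fix r x assume "(\<Sum>x\<in>p ` I. r x *\<^sub>C x) = 0" "x \<in> p ` I"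
    then show "r x = 0" using assms(2)[of "\<lambda>x. r (p x)"] inj by (auto simp: sum.reindex)
  qed (use assms(1) in auto)
qed

text \<open>Complete a basis of the kernel to a basis of \<open>V\<close>; the images of the added
  vectors form a basis of the image.\<close>

lemma rank_nullity:
  assumes V: "fin_dim V" and f: "lin_on V W f"
  shows "cdim (f ` V) + cdim {v \<in> V. f v = 0} = cdim V"
proof -
  let ?K = "{v \<in> V. f v = 0}"
  note sV = fin_dim_sub[OF V]
  have K: "csubspace ?K" by (rule lin_on_ker_subspace[OF sV f])
  have "fin_dim ?K" using fin_dim_subspace[OF V K] by auto
  then obtain C where C: "cbasis C ?K" by (rule fin_dim_cbasis)
  obtain B where B: "cbasis B V" "C \<subseteq> B"
    using cbasis_extend[OF V, of C] C cbasis_mem[OF C] by (auto simp: cbasis_def)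
  let ?E = "B - C"
  have fin: "finite ?E" using B by (simp add: cbasis_def)
  have EV: "e \<in> V" if "e \<in> ?E" for e using that cbasis_mem[OF B(1)] by auto
  have key: "c e = 0" if s: "(\<Sum>e\<in>?E. c e *\<^sub>C f e) = 0" and e: "e \<in> ?E" for c e
  proof -
    let ?v = "\<Sum>e\<in>?E. c e *\<^sub>C e"
    have v: "?v \<in> V" using EV sV by (auto intro!: complex_vector.subspace_sum complex_vector.subspace_scale)
    have "f ?v = 0"
      using s EV sV f by (subst lin_on_sum) (auto simp: lin_on_scale complex_vector.subspace_scale)
    then have vK: "?v \<in> ?K" using v by simp
    then have "(\<Sum>b\<in>C. co C b ?v *\<^sub>C b) = ?v" by (rule co_sum[OF C])
    \<comment> \<open>A relation between the images puts the same combination of the vectors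
      themselves into the kernel; subtracting its expansion in \<open>C\<close> gives a relation on
      the basis \<open>B\<close>, so all coefficients vanish.\<close>
    let ?d = "\<lambda>b. if b \<in> C then - co C b ?v else c b"
    have "(\<Sum>b\<in>B. ?d b *\<^sub>C b) = (\<Sum>b\<in>?E. ?d b *\<^sub>C b) + (\<Sum>b\<in>C. ?d b *\<^sub>C b)"
      using B by (intro sum.subset_diff) (auto simp: cbasis_def)
    also have "\<dots> = ?v - (\<Sum>b\<in>C. co C b ?v *\<^sub>C b)"
      by (simp add: sum_negf)
    also have "\<dots> = 0" using \<open>(\<Sum>b\<in>C. co C b ?v *\<^sub>C b) = ?v\<close> by simp
    finally show "c e = 0" using sum_zero_basis[OF B(1), of ?d e] e by auto
  qed
  have inj: "inj_on f ?E" and ind: "\<not> cdependent (f ` ?E)"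
    using independent_family[OF fin, of f] key by auto
  have "f ` V = cspan (f ` B)"
    using image_span[OF sV f, of B] B cbasis_mem[OF B(1)] by (auto simp: cbasis_def)
  also have "f ` B \<subseteq> insert 0 (f ` ?E)" using cbasis_mem[OF C] by auto
  then have "cspan (f ` B) = cspan (f ` ?E)"
    by (metis (no_types, lifting) Diff_subset complex_vector.span_insert_0 complex_vector.span_mono image_mono subset_antisym)
  finally have "cbasis (f ` ?E) (f ` V)" using ind fin by (simp add: cbasis_def)
  then have "cdim (f ` V) = card ?E" using inj by (simp add: cbasis_card card_image)
  then show ?thesis
    using C B cbasis_card[OF C] cbasis_card[OF B(1)]
    by (simp add: card_Diff_subset cbasis_def card_mono)
qed

lemma fin_dim_image:
  assumes V: "fin_dim V" and f: "lin_on V W f"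
  shows "fin_dim (f ` V)"
proof -
  obtain B where "cbasis B V" using V by (rule fin_dim_cbasis)
  then have "f ` V = cspan (f ` B)" "finite (f ` B)"
    using image_span[OF fin_dim_sub[OF V] f, of B] cbasis_mem[of B V] by (auto simp: cbasis_def)
  then show ?thesis by (simp add: fin_dim_span)
qed

lemma lin_on_inj_iff:
  assumes "csubspace V" "lin_on V W f"
  shows "inj_on f V \<longleftrightarrow> (\<forall>v\<in>V. f v = 0 \<longrightarrow> v = 0)"
proof
  assume "inj_on f V"
  then show "\<forall>v\<in>V. f v = 0 \<longrightarrow> v = 0"
    using lin_on_0[OF assms] complex_vector.subspace_0[OF assms(1)] by (metis inj_onD)
next
  assume a: "\<forall>v\<in>V. f v = 0 \<longrightarrow> v = 0"
  show "inj_on f V"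
  proof (rule inj_onI)
    fix x y assume "x \<in> V" "y \<in> V" "f x = f y"
    then have "f (x - y) = 0" "x - y \<in> V"
      using assms by (auto simp: lin_on_diff complex_vector.subspace_diff)
    then show "x = y" using a by auto
  qed
qed

lemma cdim_0 [simp]: "cdim ({0}::'a::complex_vector set) = 0"
  using complex_vector.dim_span_eq_card_independent[OF complex_vector.independent_empty] by simp

lemma cdim_image_inj:
  assumes V: "fin_dim V" and f: "lin_on V W f" and i: "\<And>v. v \<in> V \<Longrightarrow> f v = 0 \<Longrightarrow> v = 0"
  shows "cdim (f ` V) = cdim V"
proof -
  have "{v \<in> V. f v = 0} = {0}"
    using i lin_on_0[OF fin_dim_sub[OF V] f] complex_vector.subspace_0[OF fin_dim_sub[OF V]] by auto
  then show ?thesis using rank_nullity[OF V f] by simp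
qed

lemma fin_dim_0 [simp]: "fin_dim ({0}::'a::complex_vector set)"
  using fin_dim_span[of "{}::'a set"] by simp

lemma projection_exists:
  assumes V: "fin_dim V" and U: "csubspace U" "U \<subseteq> V"
  obtains p where "lin_on V U p" "\<And>u. u \<in> U \<Longrightarrow> p u = u"
proof -
  obtain C where C: "cbasis C U" using fin_dim_subspace[OF V U] by (rule fin_dim_cbasis)
  obtain B where B: "cbasis B V" "C \<subseteq> B"
    using cbasis_extend[OF V, of C] C U cbasis_mem[OF C] by (auto simp: cbasis_def)
  obtain p where p: "lin_on V U p" "\<And>b. b \<in> B \<Longrightarrow> p b = (if b \<in> C then b else 0)"
    using lin_on_extend[OF B(1) U(1), of "\<lambda>b. if b \<in> C then b else 0"] cbasis_mem[OF C]
      complex_vector.subspace_0[OF U(1)] by (metis (mono_tags))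
  have "p u = u" if "u \<in> U" for u
    by (rule lin_on_eq_span[OF fin_dim_sub[OF V] p(1), of UNIV "\<lambda>x. x" C])
      (use p(2) B C that U cbasis_mem[OF C] in \<open>auto simp: lin_on_def cbasis_def\<close>)
  then show ?thesis using p that by blast
qed

section \<open>Separation by linear forms\<close>

lemma dual_iff: "f \<in> dual V \<longleftrightarrow> f \<in> Hom V UNIV"
  by (simp add: dual_def)

lemma dual_separates:
  assumes V: "fin_dim V" and v: "v \<in> V" "v \<noteq> 0"
  obtains f where "f \<in> dual V" "f v \<noteq> 0"
proof -
  obtain B where B: "cbasis B V" using V by (rule fin_dim_cbasis)
  have "\<exists>b\<in>B. co B b v \<noteq> 0"
  proof (rule ccontr)
    assume "\<not> ?thesis"
    then have "(\<Sum>b\<in>B. co B b v *\<^sub>C b) = 0" by (auto intro!: sum.neutral)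
    then show False using co_sum[OF B v(1)] v(2) by simp
  qed
  then obtain b where "co B b v \<noteq> 0" by blast
  then have "res V (co B b) \<in> dual V" "res V (co B b) v \<noteq> 0"
    using res_Hom[OF cbasis_sub[OF B] co_lin[OF B]] v by (auto simp: dual_def res_def)
  then show ?thesis using that by blast
qed

lemma dual_eqI:
  assumes V: "fin_dim V" and "v \<in> V" "w \<in> V" "\<And>f. f \<in> dual V \<Longrightarrow> f v = f w"
  shows "v = w"
proof (rule ccontr)
  assume "v \<noteq> w"
  moreover have "v - w \<in> V" using assms fin_dim_sub complex_vector.subspace_diff by blast
  ultimately obtain f where f: "f \<in> dual V" "f (v - w) \<noteq> 0" using dual_separates[OF V, of "v - w"] by auto
  have "f (v - w) = f v - f w"
    using f assms fin_dim_sub[OF V] by (intro lin_on_diff[of V UNIV]) (auto simp: dual_def Hom_iff)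
  then show False using f assms(4) by simp
qed

text \<open>A functional that is nonzero at \<open>v - p v\<close> for some \<open>v\<close> outside
  \<open>U\<close>, precomposed with the complementary projection. It later yields a nonzero
  functional that kills the image of \<open>y\<close>.\<close>

lemma dual_annihilates_proper:
  assumes V: "fin_dim V" and U: "csubspace U" "U \<subset> V"
  obtains f where "f \<in> dual V" "\<And>u. u \<in> U \<Longrightarrow> f u = 0" "\<exists>v\<in>V. f v \<noteq> 0"
proof -
  obtain p where p: "lin_on V U p" "\<And>u. u \<in> U \<Longrightarrow> p u = u"
    using projection_exists[OF V U(1)] U(2) by blast
  obtain v where v: "v \<in> V" "v \<notin> U" using U by auto
  have sV: "csubspace V" using V by (rule fin_dim_sub)
  have pV: "lin_on V V p" using p U by (auto intro: lin_on_subset)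
  have q: "lin_on V V (\<lambda>v. v - p v)"
    using pV sV by (auto simp: lin_on_def complex_vector.subspace_diff algebra_simps complex_vector.scale_right_diff_distrib)
  have "v - p v \<noteq> 0" using v lin_on_mem[OF p(1) v(1)] by auto
  moreover have "v - p v \<in> V" using lin_on_mem[OF q v(1)] .
  ultimately obtain g where g: "g \<in> dual V" "g (v - p v) \<noteq> 0" using dual_separates[OF V] by blast
  let ?f = "res V (\<lambda>v. g (v - p v))"
  have "?f \<in> dual V"
    unfolding dual_def by (rule res_Hom[OF sV lin_on_compose[OF q]]) (use g in \<open>auto simp: dual_def Hom_iff\<close>)
  moreover have "?f u = 0" if "u \<in> U" for u
    using that p U lin_on_0[OF sV, of UNIV g] g by (auto simp: res_def dual_def Hom_iff)
  moreover have "?f v \<noteq> 0" using g v by (simp add: res_def)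
  ultimately show ?thesis using that v by blast
qed

lemma spanning_card_cbasis:
  assumes "finite S" "cspan S = V" "card S \<le> cdim V"
  shows "cbasis S V"
proof -
  obtain C where C: "C \<subseteq> S" "\<not> cdependent C" "S \<subseteq> cspan C"
    using complex_vector.maximal_independent_subset[of S] by blast
  have "cspan C = V"
    using C assms by (metis complex_vector.span_mono complex_vector.span_span subset_antisym)
  then have b: "cbasis C V" using C assms finite_subset by (auto simp: cbasis_def)
  then have "C = S" using assms C by (intro card_seteq) (auto simp: cbasis_card)
  then show ?thesis using b by simp
qed

text \<open>Direct sums are treated by splitting off one summand, and \<open>rank_nullity\<close>
  cannot be applied there before the total space is known to be finite dimensional. Lifted
  generators of the image together with generators of the kernel supply this.\<close>

lemma fin_dim_extension:
  assumes V: "csubspace V" and f: "lin_on V W f"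
    and im: "fin_dim (f ` V)" and k: "fin_dim {v \<in> V. f v = 0}"
  shows "fin_dim V"
proof -
  obtain C where C: "cbasis C (f ` V)" using im by (rule fin_dim_cbasis)
  obtain E where E: "cbasis E {v \<in> V. f v = 0}" using k by (rule fin_dim_cbasis)
  have "\<forall>c\<in>C. \<exists>v\<in>V. f v = c" using cbasis_mem[OF C] by auto
  then obtain s where s: "\<And>c. c \<in> C \<Longrightarrow> s c \<in> V \<and> f (s c) = c" by metis
  let ?S = "s ` C \<union> E"
  have SV: "?S \<subseteq> V" using s cbasis_mem[OF E] by auto
  have "v \<in> cspan ?S" if v: "v \<in> V" for v
  proof -
    let ?w = "\<Sum>c\<in>C. co C c (f v) *\<^sub>C s c"
    have w: "?w \<in> V" using s V by (auto intro!: complex_vector.subspace_sum complex_vector.subspace_scale)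
    have "f ?w = (\<Sum>c\<in>C. co C c (f v) *\<^sub>C c)"
      using s V f by (subst lin_on_sum) (auto simp: lin_on_scale complex_vector.subspace_scale)
    also have "\<dots> = f v" using v by (intro co_sum[OF C]) auto
    finally have "v - ?w \<in> {v \<in> V. f v = 0}"
      using v w V f by (auto simp: lin_on_diff complex_vector.subspace_diff)
    then have "v - ?w \<in> cspan E" using E by (simp add: cbasis_def)
    then have "v - ?w \<in> cspan ?S" using complex_vector.span_mono[of E ?S] by auto
    moreover have "?w \<in> cspan ?S"
      by (auto intro!: complex_vector.span_sum complex_vector.span_scale intro: complex_vector.span_base)
    ultimately have "(v - ?w) + ?w \<in> cspan ?S" by (rule complex_vector.span_add)
    then show ?thesis by simp
  qed
  then have "cspan ?S = V" using SV complex_vector.span_minimal[OF SV V] by auto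
  then show ?thesis using fin_dim_span[of ?S] C E by (simp add: cbasis_def)
qed

lemma iso_exists:
  assumes U: "fin_dim U" and U': "fin_dim U'" and d: "cdim U = cdim U'"
  obtains k where "lin_on U U' k" "\<And>u. u \<in> U \<Longrightarrow> k u = 0 \<Longrightarrow> u = 0"
proof -
  obtain B where B: "cbasis B U" using U by (rule fin_dim_cbasis)
  obtain C where C: "cbasis C U'" using U' by (rule fin_dim_cbasis)
  have "card B = card C" using d B C by (simp add: cbasis_card)
  then obtain g where g: "bij_betw g B C"
    using finite_same_card_bij cbasis_finite[OF B] cbasis_finite[OF C] by blast
  obtain k where k: "lin_on U U' k" "\<And>b. b \<in> B \<Longrightarrow> k b = g b"
    using lin_on_extend[OF B cbasis_sub[OF C], of g] cbasis_mem[OF C] g by (auto simp: bij_betw_def)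
  have "k ` U = U'"
    using image_span[OF cbasis_sub[OF B] k(1), of B] cbasis_mem[OF B] B C g k(2)
    by (auto simp: cbasis_def bij_betw_def)
  then have "cdim {u \<in> U. k u = 0} = 0" using rank_nullity[OF U k(1)] d by simp
  then have "{0} = {u \<in> U. k u = 0}"
    using cdim_eq_imp_eq[of "{u \<in> U. k u = 0}" "{0}"] fin_dim_subspace[OF U] lin_on_ker_subspace[OF _ k(1)]
      fin_dim_sub[OF U] lin_on_0[OF _ k(1)] complex_vector.subspace_0[of U] by auto
  then have "\<And>u. u \<in> U \<Longrightarrow> k u = 0 \<Longrightarrow> u = 0" by blast
  with k(1) show ?thesis by (rule that)
qed


subsection \<open>Automorphisms\<close>

text \<open>Finite dimension makes an injective endomorphism onto; \<open>res\<close> is there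
  because elements of \<open>GL\<close> vanish off \<open>V\<close>.\<close>

lemma GL_I:
  assumes V: "fin_dim V" and u: "lin_on V V u" and i: "\<And>v. v \<in> V \<Longrightarrow> u v = 0 \<Longrightarrow> v = 0"
  shows "res V u \<in> GL V"
proof -
  note sV = fin_dim_sub[OF V]
  have "cdim (u ` V) = cdim V" using cdim_image_inj[OF V u i] by auto
  then have "u ` V = V"
    using u by (intro cdim_eq_imp_eq[OF V] lin_on_image_subspace[OF sV u]) (auto simp: lin_on_def)
  moreover have "inj_on u V" using lin_on_inj_iff[OF sV u] i by blast
  ultimately have "bij_betw (res V u) V V"
    by (auto simp: bij_betw_def res_def inj_on_def cong: image_cong)
  then show ?thesis using res_Hom[OF sV u] by (simp add: GL_def)
qed

lemma GL_lin: "u \<in> GL V \<Longrightarrow> lin_on V V u"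
  by (simp add: GL_def Hom_iff)

lemma GL_mem: "u \<in> GL V \<Longrightarrow> v \<in> V \<Longrightarrow> u v \<in> V"
  by (auto simp: GL_def Hom_def)

lemma GL_inv_right: "u \<in> GL V \<Longrightarrow> v \<in> V \<Longrightarrow> u (inv_into V u v) = v"
  by (auto simp: GL_def bij_betw_def f_inv_into_f)

lemma GL_inv_left: "u \<in> GL V \<Longrightarrow> v \<in> V \<Longrightarrow> inv_into V u (u v) = v"
  by (auto simp: GL_def bij_betw_def)

lemma GL_inv_mem: "u \<in> GL V \<Longrightarrow> v \<in> V \<Longrightarrow> inv_into V u v \<in> V"
  by (auto simp: GL_def bij_betw_def inv_into_into)

lemma GL_inv_lin:
  assumes V: "csubspace V" and u: "u \<in> GL V" shows "lin_on V V (inv_into V u)"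
proof (rule lin_onI)
  note i = GL_inv_mem[OF u] GL_inv_right[OF u]
  show "inv_into V u (x + y) = inv_into V u x + inv_into V u y" if "x \<in> V" "y \<in> V" for x y
  proof -
    have "u (inv_into V u x + inv_into V u y) = x + y"
      using that i by (simp add: lin_on_add[OF GL_lin[OF u]])
    then show ?thesis
      using GL_inv_left[OF u, of "inv_into V u x + inv_into V u y"] that i V
      by (simp add: complex_vector.subspace_add)
  qed
  show "inv_into V u (c *\<^sub>C x) = c *\<^sub>C inv_into V u x" if "x \<in> V" for c x
  proof -
    have "u (c *\<^sub>C inv_into V u x) = c *\<^sub>C x"
      using that i by (simp add: lin_on_scale[OF GL_lin[OF u]])
    then show ?thesis
      using GL_inv_left[OF u, of "c *\<^sub>C inv_into V u x"] that i V
      by (simp add: complex_vector.subspace_scale)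
  qed
qed (use GL_inv_mem[OF u] in auto)

lemma GL_id: "csubspace V \<Longrightarrow> res V (\<lambda>v. v) \<in> GL V"
  by (auto simp: GL_def bij_betw_def inj_on_def res_def Hom_def complex_vector.subspace_def)

lemma lin_section:
  assumes T: "fin_dim T" and V: "csubspace V" and f: "lin_on V T f" and s: "f ` V = T"
  obtains g where "lin_on T V g" "\<And>t. t \<in> T \<Longrightarrow> f (g t) = t"
proof -
  obtain B where B: "cbasis B T" using T by (rule fin_dim_cbasis)
  have "\<forall>b\<in>B. \<exists>v\<in>V. f v = b" using cbasis_mem[OF B] s by (metis imageE)
  then obtain h where h: "\<And>b. b \<in> B \<Longrightarrow> h b \<in> V \<and> f (h b) = b" by metis
  obtain g where g: "lin_on T V g" "\<And>b. b \<in> B \<Longrightarrow> g b = h b"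
    using lin_on_extend[OF B V, of h] h by metis
  have "f (g t) = t" if "t \<in> T" for t
    by (rule lin_on_eq_span[OF fin_dim_sub[OF T] lin_on_compose[OF g(1) f], of UNIV "\<lambda>t. t" B])
      (use that g(2) h B cbasis_mem[OF B] in \<open>auto simp: lin_on_def cbasis_def\<close>)
  with g(1) show ?thesis by (rule that)
qed

text \<open>Each pair splits \<open>V\<close> into the image of a section and a kernel:
  \<open>r(T)\<close> and \<open>Ker g\<close> on one side, \<open>s(T)\<close> and
  \<open>Ker f\<close> on the other. The two kernels have equal dimension, so an isomorphism
  \<open>k\<close> between them exists, and \<open>u\<close> is the composite of \<open>g\<close>
  and \<open>s\<close> plus \<open>k\<close> on the part \<open>v - r (g v)\<close> in
  \<open>Ker g\<close>. The two conclusions serve surjections and injections respectively.\<close>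

lemma GL_conjugate:
  assumes V: "fin_dim V" and T: "fin_dim T"
    and f: "lin_on V T f" and s: "lin_on T V s" "\<And>t. t \<in> T \<Longrightarrow> f (s t) = t"
    and g: "lin_on V T g" and r: "lin_on T V r" "\<And>t. t \<in> T \<Longrightarrow> g (r t) = t"
  obtains u where "u \<in> GL V" "\<And>v. v \<in> V \<Longrightarrow> f (u v) = g v" "\<And>t. t \<in> T \<Longrightarrow> u (r t) = s t"
proof -
  note sV = fin_dim_sub[OF V] and sT = fin_dim_sub[OF T]
  let ?Kf = "{v \<in> V. f v = 0}" and ?Kg = "{v \<in> V. g v = 0}"
  have Kf: "csubspace ?Kf" and Kg: "csubspace ?Kg"
    using lin_on_ker_subspace[OF sV f] lin_on_ker_subspace[OF sV g] by auto
  have "f ` V = T"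
    using lin_on_mem[OF f] lin_on_mem[OF s(1)] s(2) by (force simp: image_iff)
  moreover have "g ` V = T"
    using lin_on_mem[OF g] lin_on_mem[OF r(1)] r(2) by (force simp: image_iff)
  ultimately have "cdim ?Kg = cdim ?Kf" using rank_nullity[OF V f] rank_nullity[OF V g] by simp
  moreover have "fin_dim ?Kf" "fin_dim ?Kg" using fin_dim_subspace[OF V] Kf Kg by auto
  ultimately obtain k where k: "lin_on ?Kg ?Kf k" "\<And>u. u \<in> ?Kg \<Longrightarrow> k u = 0 \<Longrightarrow> u = 0"
    using iso_exists[of ?Kg ?Kf] by blast
  let ?d = "\<lambda>v. v - r (g v)"
  have rg: "lin_on V V (\<lambda>v. r (g v))" by (rule lin_on_compose[OF g r(1)])
  have "lin_on V V ?d"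
    using rg sV by (auto simp: lin_on_def complex_vector.subspace_diff algebra_simps complex_vector.scale_right_diff_distrib)
  moreover have "g (?d v) = 0" if "v \<in> V" for v
    using that lin_on_mem[OF rg that] r(2)[OF lin_on_mem[OF g that]] by (simp add: lin_on_diff[OF sV g])
  ultimately have d: "lin_on V ?Kg ?d" by (simp add: lin_on_def)
  have dk: "lin_on V V (\<lambda>v. k (?d v))"
    using lin_on_compose[OF d k(1)] by (rule lin_on_subset) auto
  have fk: "f (k (?d v)) = 0" if "v \<in> V" for v
    using lin_on_mem[OF lin_on_compose[OF d k(1)] that] by simp
  let ?u = "\<lambda>v. s (g v) + k (?d v)"
  have sg: "lin_on V V (\<lambda>v. s (g v))" by (rule lin_on_compose[OF g s(1)])
  have u: "lin_on V V ?u" using lin_on_plus[OF sV sg dk] .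
  have fu: "f (?u v) = g v" if "v \<in> V" for v
    using that lin_on_mem[OF sg that] lin_on_mem[OF dk that] lin_on_add[OF f] fk[OF that]
      s(2)[OF lin_on_mem[OF g that]] by simp
  have "v = 0" if v: "v \<in> V" and 0: "?u v = 0" for v
  proof -
    have "g v = 0" using fu[OF v] 0 lin_on_0[OF sV f] by simp
    then have "k v = 0" "v \<in> ?Kg" using 0 v lin_on_0[OF sT s(1)] lin_on_0[OF sT r(1)] by auto
    then show ?thesis using k(2) by blast
  qed
  then have "res V ?u \<in> GL V" by (rule GL_I[OF V u])
  moreover have "f (res V ?u v) = g v" if "v \<in> V" for v using that fu[OF that] by (simp add: res_def)
  moreover have "res V ?u (r t) = s t" if "t \<in> T" for t
    using that r(2) lin_on_mem[OF r(1) that] lin_on_0[OF Kg k(1)] by (simp add: res_def)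
  ultimately show ?thesis by (rule that)
qed

lemma GL_conjugate_surj:
  assumes V: "fin_dim V" and f: "lin_on V T f" "f ` V = T" and g: "lin_on V T g" "g ` V = T"
  obtains u where "u \<in> GL V" "\<And>v. v \<in> V \<Longrightarrow> f (u v) = g v"
proof -
  have T: "fin_dim T" using fin_dim_image[OF V f(1)] f(2) by simp
  obtain s where s: "lin_on T V s" "\<And>t. t \<in> T \<Longrightarrow> f (s t) = t" using lin_section[OF T fin_dim_sub[OF V] f] by blast
  obtain r where r: "lin_on T V r" "\<And>t. t \<in> T \<Longrightarrow> g (r t) = t" using lin_section[OF T fin_dim_sub[OF V] g] by blast
  show ?thesis using GL_conjugate[OF V T f(1) s g(1) r] that by blast
qed

lemma lin_retraction:
  assumes V: "fin_dim V" and T: "csubspace T" and f: "lin_on T V f" and i: "\<And>t. t \<in> T \<Longrightarrow> f t = 0 \<Longrightarrow> t = 0"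
  obtains h where "lin_on V T h" "\<And>t. t \<in> T \<Longrightarrow> h (f t) = t"
proof -
  have fT: "csubspace (f ` T)" "f ` T \<subseteq> V"
    using lin_on_image_subspace[OF T f] f by (auto simp: lin_on_def)
  obtain p where p: "lin_on V (f ` T) p" "\<And>u. u \<in> f ` T \<Longrightarrow> p u = u"
    using projection_exists[OF V fT] by blast
  have inj: "inj_on f T" using lin_on_inj_iff[OF T f] i by blast
  have l: "lin_on (f ` T) T (inv_into T f)"
    using inj fT(1) f T
    by (intro lin_onI) (auto simp: inv_into_into lin_on_add[OF f, symmetric] lin_on_scale[OF f, symmetric]
        complex_vector.subspace_add complex_vector.subspace_scale)
  show ?thesis
    by (rule that[OF lin_on_compose[OF p(1) l]]) (use p(2) inj in auto)
qed

text \<open>Here the injections are the sections of \<open>GL_conjugate\<close>, and their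
  retractions are the surjections; the order is exchanged because \<open>u\<close> has to carry
  \<open>f\<close> to \<open>g\<close>.\<close>

lemma GL_conjugate_inj:
  assumes V: "fin_dim V" and T: "fin_dim T"
    and f: "lin_on T V f" "\<And>t. t \<in> T \<Longrightarrow> f t = 0 \<Longrightarrow> t = 0"
    and g: "lin_on T V g" "\<And>t. t \<in> T \<Longrightarrow> g t = 0 \<Longrightarrow> t = 0"
  obtains u where "u \<in> GL V" "\<And>t. t \<in> T \<Longrightarrow> u (f t) = g t"
proof -
  obtain h where h: "lin_on V T h" "\<And>t. t \<in> T \<Longrightarrow> h (f t) = t" using lin_retraction[OF V fin_dim_sub[OF T] f] by blast
  obtain k where k: "lin_on V T k" "\<And>t. t \<in> T \<Longrightarrow> k (g t) = t" using lin_retraction[OF V fin_dim_sub[OF T] g] by blast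
  show ?thesis using GL_conjugate[OF V T k(1) g(1) k(2) h(1) f(1) h(2)] that by blast
qed


subsection \<open>Spaces of linear maps, duals and annihilators\<close>

lemma cbasis_complex: "cbasis {1::complex} UNIV"
proof -
  have "z \<in> cspan {1::complex}" for z
    using complex_vector.span_scale[OF complex_vector.span_base[of "1::complex" "{1}"], of z]
    by (simp add: scaleC_complex_def)
  then show ?thesis by (auto simp: cbasis_def)
qed

lemma fin_dim_complex: "fin_dim (UNIV::complex set)"
  using cbasis_complex by (rule cbasis_fin_dim)

lemma sum_fun_apply: "(\<Sum>i\<in>I. f i) x = (\<Sum>i\<in>I. f i x)"
  by (induction I rule: infinite_finite_induct) (auto simp: zero_fun_def plus_fun_def)

lemma fin_dim_Hom:
  assumes V: "fin_dim V" and W: "fin_dim W"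
  shows "fin_dim (Hom V W)"
proof -
  obtain B where B: "cbasis B V" using V by (rule fin_dim_cbasis)
  obtain C where C: "cbasis C W" using W by (rule fin_dim_cbasis)
  let ?e = "\<lambda>(b, c). res V (\<lambda>v. co B b v *\<^sub>C c)"
  have e: "?e (b, c) \<in> Hom V W" if "c \<in> C" for b c
    using cbasis_mem[OF C that] fin_dim_sub[OF V] fin_dim_sub[OF W]
    by (auto intro!: res_Hom lin_on_coeff co_lin[OF B])
  have "f \<in> cspan (?e ` (B \<times> C))" if f: "f \<in> Hom V W" for f
  proof -
    have "f = (\<Sum>b\<in>B. \<Sum>c\<in>C. co C c (f b) *\<^sub>C ?e (b, c))"
    proof
      fix v
      show "f v = (\<Sum>b\<in>B. \<Sum>c\<in>C. co C c (f b) *\<^sub>C ?e (b, c)) v"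
      proof (cases "v \<in> V")
        case True
        have "f v = (\<Sum>b\<in>B. co B b v *\<^sub>C f b)" by (rule lin_on_co_expand[OF B Hom_lin[OF f] True])
        also have "\<dots> = (\<Sum>b\<in>B. co B b v *\<^sub>C (\<Sum>c\<in>C. co C c (f b) *\<^sub>C c))"
          using Hom_mem[OF f] cbasis_mem[OF B] by (intro sum.cong) (auto simp: co_sum[OF C])
        finally show ?thesis
          using True by (simp add: sum_fun_apply scaleC_fun_def res_def complex_vector.scale_sum_right scaleC_scaleC mult.commute)
      next
        case False
        then show ?thesis using Hom_off[OF f] by (simp add: sum_fun_apply scaleC_fun_def res_def)
      qed
    qed
    also have "\<dots> \<in> cspan (?e ` (B \<times> C))"
      by (intro complex_vector.span_sum complex_vector.span_scale complex_vector.span_base) auto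
    finally show ?thesis .
  qed
  moreover have "?e ` (B \<times> C) \<subseteq> Hom V W" using e by auto
  then have "cspan (?e ` (B \<times> C)) \<subseteq> Hom V W"
    using csubspace_Hom[OF fin_dim_sub[OF W]] by (rule complex_vector.span_minimal)
  ultimately have "cspan (?e ` (B \<times> C)) = Hom V W" by blast
  moreover have "finite (?e ` (B \<times> C))" using B C by (simp add: cbasis_def)
  ultimately show ?thesis using fin_dim_span by metis
qed

lemma fin_dim_dual: "fin_dim V \<Longrightarrow> fin_dim (dual V)"
  unfolding dual_def by (intro fin_dim_Hom fin_dim_complex)

definition ann :: "'a::complex_vector set \<Rightarrow> ('a \<Rightarrow> complex) set \<Rightarrow> 'a set" where
  "ann V R = {v \<in> V. \<forall>F\<in>R. F v = 0}"

lemma dual_lin: "F \<in> dual V \<Longrightarrow> lin_on V UNIV F"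
  by (simp add: dual_def Hom_iff)

lemma csubspace_ann:
  assumes "csubspace V" "R \<subseteq> dual V" shows "csubspace (ann V R)"
proof -
  have l: "lin_on V UNIV F" if "F \<in> R" for F using that assms(2) dual_lin by auto
  have "csubspace {v \<in> V. F v = 0}" if "F \<in> R" for F by (rule lin_on_ker_subspace[OF assms(1) l[OF that]])
  then have "csubspace (V \<inter> (\<Inter>F\<in>R. {v \<in> V. F v = 0}))"
    by (intro complex_vector.subspace_inter complex_vector.subspace_Int assms(1))
  moreover have "V \<inter> (\<Inter>F\<in>R. {v \<in> V. F v = 0}) = ann V R" by (auto simp: ann_def)
  ultimately show ?thesis by simp
qed

text \<open>Two counts. Functionals in \<open>R\<close> vanish on a basis \<open>C\<close> of the
  annihilator, so they are combinations of the coordinates of the remaining basis vectors, which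
  bounds \<open>cdim R\<close>. Conversely, evaluation at a basis of \<open>R\<close> has the
  annihilator as kernel and rank at most \<open>cdim R\<close>.\<close>

lemma cdim_ann:
  assumes V: "fin_dim V" and R: "csubspace R" "R \<subseteq> dual V"
  shows "cdim (ann V R) + cdim R = cdim V"
proof (rule antisym)
  note sV = fin_dim_sub[OF V]
  let ?U = "ann V R"
  have U: "csubspace ?U" "?U \<subseteq> V" using csubspace_ann[OF sV R(2)] by (auto simp: ann_def)
  obtain C where C: "cbasis C ?U" using fin_dim_subspace[OF V U] by (rule fin_dim_cbasis)
  obtain B where B: "cbasis B V" "C \<subseteq> B"
    using cbasis_extend[OF V, of C] C U cbasis_mem[OF C] by (auto simp: cbasis_def)
  let ?E = "B - C"
  let ?S = "(\<lambda>b. res V (co B b)) ` ?E"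
  have fE: "finite ?E" using B by (simp add: cbasis_def)
  have "R \<subseteq> cspan ?S"
  proof
    fix F assume F: "F \<in> R"
    then have Fd: "F \<in> dual V" using R by auto
    have "F = (\<Sum>b\<in>?E. F b *\<^sub>C res V (co B b))"
    proof
      fix v show "F v = (\<Sum>b\<in>?E. F b *\<^sub>C res V (co B b)) v"
      proof (cases "v \<in> V")
        case True
        have "F v = (\<Sum>b\<in>B. co B b v *\<^sub>C F b)" by (rule lin_on_co_expand[OF B(1) dual_lin[OF Fd] True])
        also have "\<dots> = (\<Sum>b\<in>?E. co B b v *\<^sub>C F b)"
          using F cbasis_mem[OF C] B by (intro sum.mono_neutral_right) (auto simp: ann_def cbasis_def)
        finally show ?thesis using True by (simp add: sum_fun_apply scaleC_fun_def res_def scaleC_complex_def mult.commute)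
      next
        case False
        then show ?thesis using Fd by (simp add: sum_fun_apply scaleC_fun_def res_def scaleC_complex_def dual_def Hom_def)
      qed
    qed
    also have "\<dots> \<in> cspan ?S"
      by (intro complex_vector.span_sum complex_vector.span_scale complex_vector.span_base) auto
    finally show "F \<in> cspan ?S" .
  qed
  then have "cdim R \<le> card ?S" using fE by (intro complex_vector.dim_le_card) auto
  also have "\<dots> \<le> card ?E" using fE by (rule card_image_le)
  finally show "cdim ?U + cdim R \<le> cdim V"
    using card_Diff_subset[OF cbasis_finite[OF C] B(2)] card_mono[OF cbasis_finite[OF B(1)] B(2)]
      cbasis_card[OF C] cbasis_card[OF B(1)] by linarith
next
  note sV = fin_dim_sub[OF V]
  have "fin_dim R" using fin_dim_subspace[OF fin_dim_dual[OF V] R] .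
  then obtain A where A: "cbasis A R" by (rule fin_dim_cbasis)
  \<comment> \<open>Evaluation at the basis \<open>A\<close> of \<open>R\<close>, extended by 0 so
    that its values lie in the span of \<open>card A\<close> indicator functions.\<close>
  let ?\<Phi> = "\<lambda>v F. if F \<in> A then F v else 0"
  have Al: "lin_on V UNIV F" if "F \<in> A" for F using that cbasis_mem[OF A] R by (auto intro: dual_lin)
  have \<Phi>: "lin_on V UNIV ?\<Phi>"
    by (intro lin_onI) (auto simp: fun_eq_iff plus_fun_def scaleC_fun_def lin_on_add[OF Al] lin_on_scale[OF Al])
  have "?\<Phi> ` V \<subseteq> cspan ((\<lambda>F G. if G = F then 1 else 0) ` A)"
  proof safe
    fix v assume "v \<in> V"
    have "?\<Phi> v = (\<Sum>F\<in>A. F v *\<^sub>C (\<lambda>G. if G = F then 1 else 0))"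
      using cbasis_finite[OF A]
      by (intro ext) (simp add: sum_fun_apply scaleC_fun_def scaleC_complex_def if_distrib cong: if_cong)
    also have "\<dots> \<in> cspan ((\<lambda>F G. if G = F then 1 else 0) ` A)"
      by (intro complex_vector.span_sum complex_vector.span_scale complex_vector.span_base) auto
    finally show "?\<Phi> v \<in> cspan ((\<lambda>F G. if G = F then 1 else 0) ` A)" .
  qed
  then have "cdim (?\<Phi> ` V) \<le> card ((\<lambda>F G. if G = F then 1 else (0::complex)) ` A)"
    using cbasis_finite[OF A] by (intro complex_vector.dim_le_card) auto
  also have "\<dots> \<le> card A" using cbasis_finite[OF A] by (rule card_image_le)
  finally have 1: "cdim (?\<Phi> ` V) \<le> cdim R" using cbasis_card[OF A] by simp
  have "{v \<in> V. ?\<Phi> v = 0} = ann V R"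
  proof safe
    fix v assume v: "v \<in> V" "?\<Phi> v = 0"
    have "F v = 0" if F: "F \<in> R" for F
    proof -
      have "F = (\<Sum>G\<in>A. co A G F *\<^sub>C G)" using co_sum[OF A F] by simp
      then have "F v = (\<Sum>G\<in>A. co A G F *\<^sub>C G) v" by simp
      also have "\<dots> = (\<Sum>G\<in>A. co A G F *\<^sub>C G v)"
        by (simp add: sum_fun_apply scaleC_fun_def)
      also have "\<dots> = 0"
        using v(2) by (auto simp: fun_eq_iff scaleC_complex_def split: if_splits intro!: sum.neutral)
      finally show ?thesis .
    qed
    then show "v \<in> ann V R" using v by (simp add: ann_def)
  next
    fix v assume v: "v \<in> ann V R"
    then show "v \<in> V" "?\<Phi> v = 0" using cbasis_mem[OF A] by (auto simp: ann_def fun_eq_iff)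
  qed
  then show "cdim V \<le> cdim (ann V R) + cdim R" using rank_nullity[OF V \<Phi>] 1 by simp
qed

lemma cdim_dual:
  assumes V: "fin_dim V" shows "cdim (dual V) = cdim V"
proof -
  have "ann V (dual V) = {0}"
  proof
    show "ann V (dual V) \<subseteq> {0}" using dual_separates[OF V] unfolding ann_def by blast
    show "{0} \<subseteq> ann V (dual V)"
      using complex_vector.subspace_0[OF csubspace_ann[OF fin_dim_sub[OF V] subset_refl]] by simp
  qed
  then show ?thesis using cdim_ann[OF V csubspace_dual subset_refl] by simp
qed


subsection \<open>Direct sums\<close>

lemma csubspace_dsum: "(\<And>i. i \<in> I \<Longrightarrow> csubspace (V i)) \<Longrightarrow> csubspace (dsum I V)"
  by (auto simp: dsum_def complex_vector.subspace_def scaleC_fun_def)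

lemma dsum_fin_dim:
  assumes "finite I" "\<And>i. i \<in> I \<Longrightarrow> fin_dim (V i)"
  shows "fin_dim (dsum I V) \<and> cdim (dsum I V) = (\<Sum>i\<in>I. cdim (V i))"
  using assms
proof (induction I rule: finite_induct)
  case empty
  have "dsum {} V = {0}" by (auto simp: dsum_def fun_eq_iff)
  then show ?case by simp
next
  case (insert i I)
  let ?D = "dsum (insert i I) V" and ?f = "\<lambda>x. x i"
  have s: "csubspace ?D" using insert.prems fin_dim_sub by (intro csubspace_dsum) auto
  have f: "lin_on ?D UNIV ?f" by (auto simp: lin_on_def scaleC_fun_def)
  have im: "?f ` ?D = V i"
  proof
    show "?f ` ?D \<subseteq> V i" by (auto simp: dsum_def)
    show "V i \<subseteq> ?f ` ?D"
    proof
      fix v assume "v \<in> V i"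
      then have "(\<lambda>j. if j = i then v else 0) \<in> ?D"
        using insert.prems fin_dim_sub complex_vector.subspace_0 by (auto simp: dsum_def)
      then show "v \<in> ?f ` ?D" by (auto simp: image_iff intro!: bexI[of _ "\<lambda>j. if j = i then v else 0"])
    qed
  qed
  have k: "{x \<in> ?D. ?f x = 0} = dsum I V"
    using insert.hyps insert.prems fin_dim_sub[of "V i"] complex_vector.subspace_0[of "V i"]
    by (fastforce simp: dsum_def)
  have IH: "fin_dim (dsum I V)" "cdim (dsum I V) = (\<Sum>i\<in>I. cdim (V i))" using insert by auto
  have fd: "fin_dim ?D"
    by (rule fin_dim_extension[OF s f]) (use im k IH insert.prems in auto)
  then show ?case using rank_nullity[OF fd f] im k IH insert.hyps by simp
qed

section \<open>Bilinear maps and tensor products\<close>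

definition bilin_on :: "'a::complex_vector set \<Rightarrow> 'b::complex_vector set \<Rightarrow> 'c::complex_vector set \<Rightarrow>
    ('a \<Rightarrow> 'b \<Rightarrow> 'c) \<Rightarrow> bool" where
  "bilin_on U V X \<beta> \<longleftrightarrow> (\<forall>v\<in>V. lin_on U X (\<lambda>u. \<beta> u v)) \<and> (\<forall>u\<in>U. lin_on V X (\<beta> u))"

lemma bilin_left: "bilin_on U V X \<beta> \<Longrightarrow> v \<in> V \<Longrightarrow> lin_on U X (\<lambda>u. \<beta> u v)"
  and bilin_right: "bilin_on U V X \<beta> \<Longrightarrow> u \<in> U \<Longrightarrow> lin_on V X (\<beta> u)"
  by (simp_all add: bilin_on_def)

lemma bilin_mem: "bilin_on U V X \<beta> \<Longrightarrow> u \<in> U \<Longrightarrow> v \<in> V \<Longrightarrow> \<beta> u v \<in> X"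
  by (simp add: bilin_on_def lin_on_def)

lemma Hom_bilin: "\<beta> \<in> Hom U (Hom V X) \<Longrightarrow> bilin_on U V X \<beta>"
  by (auto simp: bilin_on_def lin_on_def Hom_def plus_fun_def scaleC_fun_def)

lemma bilin_Hom:
  assumes "csubspace U" "csubspace V" "bilin_on U V X \<beta>"
  shows "res U (\<lambda>u. res V (\<beta> u)) \<in> Hom U (Hom V X)"
proof (rule res_Hom[OF assms(1) lin_onI])
  show "res V (\<beta> u) \<in> Hom V X" if "u \<in> U" for u
    using res_Hom[OF assms(2) bilin_right[OF assms(3) that]] .
qed (auto simp: res_def fun_eq_iff plus_fun_def scaleC_fun_def
    lin_on_add[OF bilin_left[OF assms(3)]] lin_on_scale[OF bilin_left[OF assms(3)]])

lemma bilin_0_left: "csubspace U \<Longrightarrow> bilin_on U V X \<beta> \<Longrightarrow> v \<in> V \<Longrightarrow> \<beta> 0 v = 0"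
  by (rule lin_on_0[OF _ bilin_left])

lemma bilin_compose:
  assumes "lin_on U' U f" "bilin_on U V X \<beta>" "lin_on V' V g" "lin_on X Y h"
  shows "bilin_on U' V' Y (\<lambda>u v. h (\<beta> (f u) (g v)))"
  unfolding bilin_on_def
proof (intro conjI ballI)
  show "lin_on U' Y (\<lambda>u. h (\<beta> (f u) (g v)))" if "v \<in> V'" for v
    using lin_on_compose[OF lin_on_compose[OF assms(1) bilin_left[OF assms(2)]] assms(4)]
      lin_on_mem[OF assms(3) that] by blast
  show "lin_on V' Y (\<lambda>v. h (\<beta> (f u) (g v)))" if "u \<in> U'" for u
    using lin_on_compose[OF lin_on_compose[OF assms(3) bilin_right[OF assms(2)]] assms(4)]
      lin_on_mem[OF assms(1) that] by blast
qed

lemma lin_on_id: "lin_on V V (\<lambda>v. v)"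
  by (simp add: lin_on_def)

text \<open>Transposition of a bilinear map in its first variable. The maps \<open>dHA\<close>,
  \<open>dHB\<close>, \<open>dBB\<close> are of this form, and so are the transposes of
  \<open>y\<close> and of the factored maps in the dual case.\<close>

lemma dual_comp_bilin:
  assumes P: "csubspace P" and G: "bilin_on P V Z G"
  shows "bilin_on (dual Z) V (dual P) (\<lambda>F v. res P (\<lambda>p. F (G p v)))"
  unfolding bilin_on_def
proof (intro conjI ballI lin_onI)
  show "res P (\<lambda>p. F (G p v)) \<in> dual P" if "F \<in> dual Z" "v \<in> V" for F v
    unfolding dual_def by (rule res_Hom[OF P lin_on_compose[OF bilin_left[OF G that(2)] dual_lin[OF that(1)]]])
  then show "res P (\<lambda>p. F (G p v)) \<in> dual P" if "v \<in> V" "F \<in> dual Z" for F v using that by blast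
qed (auto simp: res_def fun_eq_iff plus_fun_def scaleC_fun_def lin_on_add[OF bilin_right[OF G]] lin_on_scale[OF bilin_right[OF G]]
    lin_on_add[OF dual_lin] lin_on_scale[OF dual_lin] bilin_mem[OF G])

lemma bilin_swap: "bilin_on U V X \<beta> \<Longrightarrow> bilin_on V U X (\<lambda>v u. \<beta> u v)"
  by (simp add: bilin_on_def)

section \<open>Tensor products through pure tensors\<close>

lemma bilin_pure: "bilin_on U V (tensor U V) (pure_tensor U V)"
proof -
  have "pure_tensor U V u v \<in> tensor U V" if "u \<in> U" "v \<in> V" for u v
    unfolding tensor_def subtensor_def using that by (intro complex_vector.span_base) auto
  moreover have b: "bilin_on U V UNIV \<beta>" if "\<beta> \<in> Hom U (dual V)" for \<beta>
    using that by (auto simp: dual_def intro: Hom_bilin)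
  ultimately show ?thesis
    unfolding bilin_on_def
    by (intro conjI ballI lin_onI)
      (auto simp: pure_tensor_def res_def plus_fun_def scaleC_fun_def fun_eq_iff
        lin_on_add[OF bilin_left[OF b]] lin_on_add[OF bilin_right[OF b]]
        lin_on_scale[OF bilin_left[OF b]] lin_on_scale[OF bilin_right[OF b]])
qed

lemmas pure_mem = bilin_mem[OF bilin_pure]

lemma tensor_ext:
  assumes "lin_on (tensor U V) X f" "lin_on (tensor U V) Y g"
    and "\<And>u v. u \<in> U \<Longrightarrow> v \<in> V \<Longrightarrow> f (pure_tensor U V u v) = g (pure_tensor U V u v)"
    and "t \<in> tensor U V"
  shows "f t = g t"
proof (rule lin_on_eq_span[OF csubspace_tensor assms(1,2)])
  show "t \<in> cspan {pure_tensor U V u v |u v. u \<in> U \<and> v \<in> V}"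
    using assms(4) by (simp add: tensor_def subtensor_def)
qed (use assms(3) pure_mem in auto)

lemma tensor_into:
  assumes "lin_on (tensor U V) X f" "csubspace Y"
    and "\<And>u v. u \<in> U \<Longrightarrow> v \<in> V \<Longrightarrow> f (pure_tensor U V u v) \<in> Y"
    and "t \<in> tensor U V"
  shows "f t \<in> Y"
proof (rule lin_on_span_into[OF csubspace_tensor assms(1,2)])
  show "t \<in> cspan {pure_tensor U V u v |u v. u \<in> U \<and> v \<in> V}"
    using assms(4) by (simp add: tensor_def subtensor_def)
qed (use assms(3) pure_mem in auto)

lemma tensor_lift_lin_UNIV: "lin_on W UNIV (tensor_lift U V \<beta>)"
  by (simp add: lin_on_def tensor_lift_def fun_eq_iff plus_fun_def scaleC_fun_def)

lemma tensor_lift_res: "tensor_lift U V \<beta> = tensor_lift U V (res U (\<lambda>u. res V (\<beta> u)))"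
proof -
  have *: "res U (\<lambda>u. res V (\<lambda>v. \<beta> u v z)) = res U (\<lambda>u. res V (\<lambda>v. res U (\<lambda>u. res V (\<beta> u)) u v z))" for z
    by (intro ext) (simp add: res_def)
  show ?thesis unfolding tensor_lift_def by (subst *) (rule refl)
qed

lemma tensor_lift_cong:
  assumes "\<And>u v. u \<in> U \<Longrightarrow> v \<in> V \<Longrightarrow> \<beta> u v = \<beta>' u v"
  shows "tensor_lift U V \<beta> = tensor_lift U V \<beta>'"
proof -
  have "res U (\<lambda>u. res V (\<beta> u)) = res U (\<lambda>u. res V (\<beta>' u))"
    using assms by (auto simp: res_def fun_eq_iff)
  then show ?thesis by (metis tensor_lift_res)
qed

lemma tensor_lift_pure_bilin:
  assumes "csubspace U" "csubspace V" "bilin_on U V X \<beta>" "u \<in> U" "v \<in> V"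
  shows "tensor_lift U V \<beta> (pure_tensor U V u v) = \<beta> u v"
proof -
  have "res U (\<lambda>u. res V (\<beta> u)) \<in> Hom U (Hom V X)" using assms by (intro bilin_Hom)
  then have "res U (\<lambda>u. res V (\<beta> u)) \<in> Hom U (Hom V UNIV)" by (auto simp: Hom_def)
  from tensor_lift_pure[OF assms(1,2) this assms(4,5)] have
    "tensor_lift U V \<beta> (pure_tensor U V u v) = res U (\<lambda>u. res V (\<beta> u)) u v"
    by (simp flip: tensor_lift_res)
  then show ?thesis using assms(4,5) by (simp add: res_def)
qed

lemma tensor_lift_lin:
  assumes "csubspace U" "csubspace V" "csubspace X" "bilin_on U V X \<beta>"
  shows "lin_on (tensor U V) X (tensor_lift U V \<beta>)"
proof -
  have "tensor_lift U V \<beta> t \<in> X" if "t \<in> tensor U V" for t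
    by (rule tensor_into[OF tensor_lift_lin_UNIV assms(3) _ that])
      (use assms in \<open>simp add: tensor_lift_pure_bilin bilin_mem\<close>)
  then show ?thesis using tensor_lift_lin_UNIV[of "tensor U V" U V \<beta>] by (simp add: lin_on_def)
qed

lemma lin_on_eval: "lin_on W UNIV (\<lambda>t. t x)"
  by (simp add: lin_on_def scaleC_fun_def)

lemma pure_apply: "\<beta> \<in> Hom U (dual V) \<Longrightarrow> pure_tensor U V u v \<beta> = \<beta> u v"
  by (simp add: pure_tensor_def res_def)

text \<open>Every tensor is a sum of \<open>c b t \<otimes> b\<close> over a basis of
  \<open>V\<close>, with linear coordinate maps \<open>c b\<close>. Dimension counts, supports and
  lifts of bilinear maps are all read off from this normal form.\<close>

lemma tensor_expand:
  assumes U: "fin_dim U" and B: "cbasis B V"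
  obtains c where "\<And>b. b \<in> B \<Longrightarrow> lin_on (tensor U V) U (c b)"
    and "\<And>b u v. b \<in> B \<Longrightarrow> u \<in> U \<Longrightarrow> v \<in> V \<Longrightarrow> c b (pure_tensor U V u v) = co B b v *\<^sub>C u"
    and "\<And>t. t \<in> tensor U V \<Longrightarrow> t = (\<Sum>b\<in>B. pure_tensor U V (c b t) b)"
proof -
  obtain E where E: "cbasis E U" using U by (rule fin_dim_cbasis)
  note sU = cbasis_sub[OF E] and sV = cbasis_sub[OF B]
  \<comment> \<open>A tensor is a functional on bilinear forms, so its coordinates arise by
    evaluating it at products of coordinate functionals.\<close>
  let ?\<beta> = "\<lambda>b e. res U (\<lambda>u. res V (\<lambda>v. co E e u * co B b v))"
  let ?c = "\<lambda>b t. \<Sum>e\<in>E. t (?\<beta> b e) *\<^sub>C e"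
  have "bilin_on U V UNIV (\<lambda>u v. co E e u * co B b v)" for b e
    using co_lin[OF E, of e] co_lin[OF B, of b]
    by (auto simp: bilin_on_def lin_on_def scaleC_complex_def algebra_simps)
  then have \<beta>: "?\<beta> b e \<in> Hom U (dual V)" for b e unfolding dual_def using sU sV by (rule bilin_Hom[rotated 2])
  have lin: "lin_on (tensor U V) U (?c b)" for b
    using cbasis_mem[OF E] by (intro lin_on_sum_map lin_on_coeff lin_on_eval sU)
  have pure: "?c b (pure_tensor U V u v) = co B b v *\<^sub>C u" if "u \<in> U" "v \<in> V" for b u v
  proof -
    have "?c b (pure_tensor U V u v) = (\<Sum>e\<in>E. (co E e u * co B b v) *\<^sub>C e)"
      using that by (simp add: pure_apply[OF \<beta>]) (simp add: res_def)
    also have "\<dots> = co B b v *\<^sub>C (\<Sum>e\<in>E. co E e u *\<^sub>C e)"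
      by (simp add: complex_vector.scale_sum_right scaleC_scaleC mult.commute)
    finally show ?thesis using co_sum[OF E that(1)] by simp
  qed
  have "t = (\<Sum>b\<in>B. pure_tensor U V (?c b t) b)" if t: "t \<in> tensor U V" for t
  proof (rule tensor_ext[where f="\<lambda>t. t", OF lin_on_id _ _ t])
    show "lin_on (tensor U V) (tensor U V) (\<lambda>t. \<Sum>b\<in>B. pure_tensor U V (?c b t) b)"
      using cbasis_mem[OF B] by (intro lin_on_sum_map csubspace_tensor lin_on_compose[OF lin bilin_left[OF bilin_pure]]) auto
    show "pure_tensor U V u v = (\<Sum>b\<in>B. pure_tensor U V (?c b (pure_tensor U V u v)) b)"
      if u: "u \<in> U" and v: "v \<in> V" for u v
    proof -
      have "pure_tensor U V u v = pure_tensor U V u (\<Sum>b\<in>B. co B b v *\<^sub>C b)" using co_sum[OF B v] by simp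
      also have "\<dots> = (\<Sum>b\<in>B. co B b v *\<^sub>C pure_tensor U V u b)"
        using lin_on_co_expand[OF B bilin_right[OF bilin_pure u] v] co_sum[OF B v] by simp
      also have "\<dots> = (\<Sum>b\<in>B. pure_tensor U V (co B b v *\<^sub>C u) b)"
        using cbasis_mem[OF B] u by (intro sum.cong) (auto simp: lin_on_scale[OF bilin_left[OF bilin_pure]])
      finally show ?thesis using pure[OF u v] by simp
    qed
  qed
  with lin pure show ?thesis using that[of ?c] by blast
qed

text \<open>\<open>tensor_lift\<close> only reaches spaces of complex-valued functions. A target
  such as \<open>spP\<close>, whose elements are families of tensors, is not one, so the linear map
  is built from the coordinates of \<open>tensor_expand\<close>.\<close>

lemma bilin_lift:
  assumes U: "fin_dim U" and V: "fin_dim V" and X: "csubspace X" and \<beta>: "bilin_on U V X \<beta>"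
  obtains L where "lin_on (tensor U V) X L"
    and "\<And>u v. u \<in> U \<Longrightarrow> v \<in> V \<Longrightarrow> L (pure_tensor U V u v) = \<beta> u v"
proof -
  obtain B where B: "cbasis B V" using V by (rule fin_dim_cbasis)
  obtain c where c: "\<And>b. b \<in> B \<Longrightarrow> lin_on (tensor U V) U (c b)"
    "\<And>b u v. b \<in> B \<Longrightarrow> u \<in> U \<Longrightarrow> v \<in> V \<Longrightarrow> c b (pure_tensor U V u v) = co B b v *\<^sub>C u"
    "\<And>t. t \<in> tensor U V \<Longrightarrow> t = (\<Sum>b\<in>B. pure_tensor U V (c b t) b)"
    by (rule tensor_expand[OF U B], rule that)
  let ?L = "\<lambda>t. \<Sum>b\<in>B. \<beta> (c b t) b"
  have "lin_on (tensor U V) X ?L"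
    using cbasis_mem[OF B] by (intro lin_on_sum_map X lin_on_compose[OF c(1) bilin_left[OF \<beta>]]) auto
  moreover have "?L (pure_tensor U V u v) = \<beta> u v" if u: "u \<in> U" and v: "v \<in> V" for u v
  proof -
    have "?L (pure_tensor U V u v) = (\<Sum>b\<in>B. co B b v *\<^sub>C \<beta> u b)"
      using u v cbasis_mem[OF B] by (intro sum.cong) (auto simp: c(2) lin_on_scale[OF bilin_left[OF \<beta>]])
    also have "\<dots> = \<beta> u v" using lin_on_co_expand[OF B bilin_right[OF \<beta> u] v] by simp
    finally show ?thesis .
  qed
  ultimately show ?thesis by (rule that)
qed

lemma subtensor_spanning:
  assumes T: "cbasis E T'" "T' \<subseteq> T" and B: "cbasis B V"
  shows "subtensor T V T' V = cspan ((\<lambda>(e, b). pure_tensor T V e b) ` (E \<times> B))"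
    (is "_ = cspan ?S")
proof
  have sT': "csubspace T'" and sV: "csubspace V" using T B by (auto intro: cbasis_sub)
  have sp: "cspan E = T'" "cspan B = V" using T B by (simp_all add: cbasis_def)
  have 0: "pure_tensor T V e b \<in> cspan ?S" if "e \<in> E" "b \<in> B" for e b
    using that by (intro complex_vector.span_base) force
  have 1: "pure_tensor T V u b \<in> cspan ?S" if u: "u \<in> T'" and b: "b \<in> B" for u b
  proof (rule lin_on_span_into[where f="\<lambda>u. pure_tensor T V u b" and S=E, OF sT' _ complex_vector.subspace_span])
    show "lin_on T' (tensor T V) (\<lambda>u. pure_tensor T V u b)"
      using bilin_left[OF bilin_pure cbasis_mem[OF B b]] T(2) by (rule lin_on_subset) simp
  qed (use 0 b u sp cbasis_mem[OF T(1)] in auto)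
  have 2: "pure_tensor T V u v \<in> cspan ?S" if u: "u \<in> T'" and v: "v \<in> V" for u v
  proof (rule lin_on_span_into[where S=B, OF sV bilin_right[OF bilin_pure] complex_vector.subspace_span])
    show "u \<in> T" using u T(2) by auto
  qed (use 1 u v sp cbasis_mem[OF B] in auto)
  then show "subtensor T V T' V \<subseteq> cspan ?S"
    unfolding subtensor_def by (intro complex_vector.span_minimal) auto
  have "?S \<subseteq> {pure_tensor T V u v |u v. u \<in> T' \<and> v \<in> V}"
    using cbasis_mem[OF T(1)] cbasis_mem[OF B] by auto
  then show "cspan ?S \<subseteq> subtensor T V T' V"
    unfolding subtensor_def by (rule complex_vector.span_mono)
qed

text \<open>The pure tensors of basis vectors are independent because the coordinate map
  \<open>c b\<close> turns a relation between them into a relation in the basis of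
  \<open>T'\<close>.\<close>

lemma subtensor_dim:
  assumes T: "fin_dim T" and T': "csubspace T'" "T' \<subseteq> T" and V: "fin_dim V"
  shows "fin_dim (subtensor T V T' V) \<and> cdim (subtensor T V T' V) = cdim T' * cdim V"
proof -
  obtain B where B: "cbasis B V" using V by (rule fin_dim_cbasis)
  obtain E where E: "cbasis E T'" using fin_dim_subspace[OF T T'] by (rule fin_dim_cbasis)
  obtain c where c: "\<And>b. b \<in> B \<Longrightarrow> lin_on (tensor T V) T (c b)"
    "\<And>b u v. b \<in> B \<Longrightarrow> u \<in> T \<Longrightarrow> v \<in> V \<Longrightarrow> c b (pure_tensor T V u v) = co B b v *\<^sub>C u"
    "\<And>t. t \<in> tensor T V \<Longrightarrow> t = (\<Sum>b\<in>B. pure_tensor T V (c b t) b)"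
    by (rule tensor_expand[OF T B], rule that)
  let ?p = "\<lambda>(e, b). pure_tensor T V e b"
  have ET: "e \<in> T" if "e \<in> E" for e using cbasis_mem[OF E that] T' by auto
  have fin: "finite (E \<times> B)" using E B by (simp add: cbasis_def)
  have p: "?p x \<in> tensor T V" if "x \<in> E \<times> B" for x
    using that pure_mem[OF ET cbasis_mem[OF B]] by auto
  have key: "r (e, b) = 0" if s: "(\<Sum>x\<in>E \<times> B. r x *\<^sub>C ?p x) = 0" and eb: "e \<in> E" "b \<in> B" for r e b
  proof -
    have "0 = c b (\<Sum>x\<in>E \<times> B. r x *\<^sub>C ?p x)"
      using s lin_on_0[OF csubspace_tensor c(1)[OF eb(2)]] by simp
    also have "\<dots> = (\<Sum>x\<in>E \<times> B. c b (r x *\<^sub>C ?p x))"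
      by (rule lin_on_sum[OF csubspace_tensor c(1)[OF eb(2)]]) (use p in \<open>auto intro: complex_vector.subspace_scale[OF csubspace_tensor]\<close>)
    also have "\<dots> = (\<Sum>x\<in>E \<times> B. r x *\<^sub>C c b (?p x))"
      by (rule sum.cong[OF refl], rule lin_on_scale[OF c(1)[OF eb(2)]], rule p)
    also have "\<dots> = (\<Sum>e\<in>E. \<Sum>b'\<in>B. r (e, b') *\<^sub>C c b (pure_tensor T V e b'))"
      by (simp add: sum.cartesian_product case_prod_unfold)
    also have "\<dots> = (\<Sum>e\<in>E. \<Sum>b'\<in>B. if b' = b then r (e, b') *\<^sub>C e else 0)"
      using ET cbasis_mem[OF B] eb by (intro sum.cong refl) (auto simp: c(2) co_basis[OF B] scaleC_one)
    also have "\<dots> = (\<Sum>e\<in>E. r (e, b) *\<^sub>C e)" using eb cbasis_finite[OF B] by simp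
    finally show ?thesis using sum_zero_basis[OF E, of "\<lambda>e. r (e, b)" e] eb by simp
  qed
  have ind: "inj_on ?p (E \<times> B)" "\<not> cdependent (?p ` (E \<times> B))"
    using independent_family[OF fin, of ?p] key by auto
  have b: "cbasis (?p ` (E \<times> B)) (subtensor T V T' V)"
    using subtensor_spanning[OF E T'(2) B] fin ind(2) by (simp add: cbasis_def)
  show ?thesis
    using ind(1) cbasis_card[OF b] cbasis_fin_dim[OF b] cbasis_card[OF E] cbasis_card[OF B]
    by (simp add: card_image card_cartesian_product)
qed

lemma fin_dim_tensor: "fin_dim U \<Longrightarrow> fin_dim V \<Longrightarrow> fin_dim (tensor U V)"
  and cdim_tensor: "fin_dim U \<Longrightarrow> fin_dim V \<Longrightarrow> cdim (tensor U V) = cdim U * cdim V"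
  unfolding tensor_def using subtensor_dim[OF _ fin_dim_sub subset_refl] by blast+

lemma id_tensor_lin:
  assumes "csubspace U" "csubspace V" "lin_on V W f"
  shows "lin_on (tensor U V) (tensor U W) (id_tensor U V W f)"
    and "u \<in> U \<Longrightarrow> v \<in> V \<Longrightarrow> id_tensor U V W f (pure_tensor U V u v) = pure_tensor U W u (f v)"
proof -
  have b: "bilin_on U V (tensor U W) (\<lambda>u v. pure_tensor U W u (f v))"
    by (rule bilin_compose[where f="\<lambda>u. u" and h="\<lambda>t. t", OF lin_on_id bilin_pure assms(3) lin_on_id])
  show "lin_on (tensor U V) (tensor U W) (id_tensor U V W f)"
    unfolding id_tensor_def by (rule tensor_lift_lin[OF assms(1,2) csubspace_tensor b])
  show "u \<in> U \<Longrightarrow> v \<in> V \<Longrightarrow> id_tensor U V W f (pure_tensor U V u v) = pure_tensor U W u (f v)"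
    unfolding id_tensor_def by (rule tensor_lift_pure_bilin[OF assms(1,2) b])
qed

lemma tensor_lift_postcompose:
  assumes "csubspace U" "csubspace V" "csubspace X" "bilin_on U V X \<beta>" "lin_on X Y L" "t \<in> tensor U V"
  shows "L (tensor_lift U V \<beta> t) = tensor_lift U V (\<lambda>u v. L (\<beta> u v)) t"
proof (rule tensor_ext[where f="\<lambda>t. L (tensor_lift U V \<beta> t)", OF _ tensor_lift_lin_UNIV _ assms(6)])
  show "lin_on (tensor U V) Y (\<lambda>t. L (tensor_lift U V \<beta> t))"
    by (rule lin_on_compose[OF tensor_lift_lin[OF assms(1-4)] assms(5)])
  have b: "bilin_on U V Y (\<lambda>u v. L (\<beta> u v))"
    by (rule bilin_compose[where f="\<lambda>u. u" and g="\<lambda>v. v", OF lin_on_id assms(4) lin_on_id assms(5)])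
  fix u v assume "u \<in> U" "v \<in> V"
  then show "L (tensor_lift U V \<beta> (pure_tensor U V u v)) = tensor_lift U V (\<lambda>u v. L (\<beta> u v)) (pure_tensor U V u v)"
    by (simp add: tensor_lift_pure_bilin[OF assms(1,2,4)] tensor_lift_pure_bilin[OF assms(1,2) b])
qed


section \<open>The codimension bound\<close>

text \<open>\<open>T'\<close> is spanned by the coordinates in \<open>T\<close> of the elements of \<open>K\<close> for a basis of \<open>V\<close>.\<close>

lemma tensor_support_exists:
  assumes T: "fin_dim T" and V: "fin_dim V" and K: "K \<subseteq> tensor T V"
  obtains T' where "csubspace T'" "T' \<subseteq> T" "K \<subseteq> subtensor T V T' V"
    and "\<And>T1. csubspace T1 \<Longrightarrow> T1 \<subseteq> T \<Longrightarrow> K \<subseteq> subtensor T V T1 V \<Longrightarrow> T' \<subseteq> T1"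
proof -
  obtain B where B: "cbasis B V" using V by (rule fin_dim_cbasis)
  obtain c where c: "\<And>b. b \<in> B \<Longrightarrow> lin_on (tensor T V) T (c b)"
    "\<And>b u v. b \<in> B \<Longrightarrow> u \<in> T \<Longrightarrow> v \<in> V \<Longrightarrow> c b (pure_tensor T V u v) = co B b v *\<^sub>C u"
    "\<And>t. t \<in> tensor T V \<Longrightarrow> t = (\<Sum>b\<in>B. pure_tensor T V (c b t) b)"
    by (rule tensor_expand[OF T B], rule that)
  let ?S = "{c b t |b t. b \<in> B \<and> t \<in> K}"
  have S: "?S \<subseteq> T" using K lin_on_mem[OF c(1)] by auto
  have sp: "cspan ?S \<subseteq> T" using S fin_dim_sub[OF T] by (rule complex_vector.span_minimal)
  show ?thesis
  proof (rule that[of "cspan ?S"])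
    show "K \<subseteq> subtensor T V (cspan ?S) V"
    proof
      fix t assume t: "t \<in> K"
      have "(\<Sum>b\<in>B. pure_tensor T V (c b t) b) \<in> subtensor T V (cspan ?S) V"
        unfolding subtensor_def
      proof (rule complex_vector.span_sum, rule complex_vector.span_base)
        fix b assume "b \<in> B"
        moreover from this have "c b t \<in> cspan ?S" using t by (intro complex_vector.span_base) auto
        ultimately show "pure_tensor T V (c b t) b \<in> {pure_tensor T V u v |u v. u \<in> cspan ?S \<and> v \<in> V}"
          using cbasis_mem[OF B] by auto
      qed
      then show "t \<in> subtensor T V (cspan ?S) V" using c(3)[of t] t K by auto
    qed
    fix T1 assume T1: "csubspace T1" "T1 \<subseteq> T" "K \<subseteq> subtensor T V T1 V"
    have "c b t \<in> T1" if b: "b \<in> B" and t: "t \<in> subtensor T V T1 V" for b t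
      by (rule lin_on_span_into[OF csubspace_tensor c(1)[OF b] T1(1) _ _ t[unfolded subtensor_def]])
        (use T1 b in \<open>auto simp: c(2) subset_iff intro!: pure_mem complex_vector.subspace_scale\<close>)
    then show "cspan ?S \<subseteq> T1" using T1 by (intro complex_vector.span_minimal) auto
  qed (use sp in auto)
qed

lemma image_tensor:
  assumes "lin_on (tensor T V) X F" "\<And>u v. u \<in> T \<Longrightarrow> v \<in> V \<Longrightarrow> F (pure_tensor T V u v) = \<gamma> u v" "T' \<subseteq> T"
  shows "F ` subtensor T V T' V = cspan {\<gamma> t v |t v. t \<in> T' \<and> v \<in> V}"
proof -
  have "F ` subtensor T V T' V = cspan (F ` {pure_tensor T V u v |u v. u \<in> T' \<and> v \<in> V})"
    unfolding subtensor_def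
    by (rule image_span[OF csubspace_tensor assms(1)]) (use assms(3) in \<open>auto intro: pure_mem\<close>)
  also have "F ` {pure_tensor T V u v |u v. u \<in> T' \<and> v \<in> V} = {\<gamma> t v |t v. t \<in> T' \<and> v \<in> V}"
  proof (intro subset_antisym subsetI)
    fix z assume "z \<in> {\<gamma> t v |t v. t \<in> T' \<and> v \<in> V}"
    then obtain t v where z: "z = \<gamma> t v" "t \<in> T'" "v \<in> V" by blast
    then have "z = F (pure_tensor T V t v)" using assms(2,3) by auto
    then show "z \<in> F ` {pure_tensor T V u v |u v. u \<in> T' \<and> v \<in> V}" using z by blast
  next
    fix z assume "z \<in> F ` {pure_tensor T V u v |u v. u \<in> T' \<and> v \<in> V}"
    then obtain u v where z: "z = F (pure_tensor T V u v)" "u \<in> T'" "v \<in> V" by blast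
    then have "z = \<gamma> u v" using assms(2,3) by auto
    then show "z \<in> {\<gamma> t v |t v. t \<in> T' \<and> v \<in> V}" using z by blast
  qed
  finally show ?thesis .
qed

lemma image_tensor_projection:
  assumes "lin_on T T' p" "\<And>u. u \<in> T' \<Longrightarrow> p u = u" "T' \<subseteq> T"
    and "lin_on (tensor T V) X F" "\<And>u v. u \<in> T \<Longrightarrow> v \<in> V \<Longrightarrow> F (pure_tensor T V u v) = \<gamma> (p u) v"
  shows "F ` tensor T V = cspan {\<gamma> t v |t v. t \<in> T' \<and> v \<in> V}"
proof -
  have "{\<gamma> (p t) v |t v. t \<in> T \<and> v \<in> V} = {\<gamma> t v |t v. t \<in> T' \<and> v \<in> V}"
  proof (intro subset_antisym subsetI)
    fix z assume "z \<in> {\<gamma> t v |t v. t \<in> T' \<and> v \<in> V}"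
    then obtain t v where "z = \<gamma> t v" "t \<in> T'" "v \<in> V" by blast
    then have "z = \<gamma> (p t) v" "t \<in> T" using assms(2,3) by auto
    then show "z \<in> {\<gamma> (p t) v |t v. t \<in> T \<and> v \<in> V}" using \<open>v \<in> V\<close> by blast
  qed (use lin_on_mem[OF assms(1)] in blast)
  then show ?thesis using image_tensor[OF assms(4,5) subset_refl] by (simp add: tensor_def)
qed

text \<open>A proper \<open>K\<close> has codimension at least 1, so no ratio exceeds the dimension
  of \<open>tensor T Y\<close>. Only with such a bound does the real supremum in \<open>sup0\<close>
  dominate each ratio.\<close>

lemma codim_ratios_bdd:
  assumes T: "fin_dim T" and V: "fin_dim V"
  shows "bdd_above (codim_ratios T V X Y \<kappa>)"
proof (rule bdd_aboveI[of _ "real (cdim (tensor T Y))"])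
  fix q assume "q \<in> codim_ratios T V X Y \<kappa>"
  then obtain K D where K: "csubspace K" "K \<subset> tensor T V"
    and q: "q = codim (tensor T Y) D / codim (tensor T V) K"
    unfolding codim_ratios_def by blast
  have "1 \<le> codim (tensor T V) K"
    using cdim_psubset[OF fin_dim_tensor[OF T V] K] by (simp add: codim_def)
  moreover have "codim (tensor T Y) D \<le> real (cdim (tensor T Y))" by (simp add: codim_def)
  ultimately have "q \<le> real (cdim (tensor T Y)) / codim (tensor T V) K"
    unfolding q by (intro divide_right_mono) auto
  also have "\<dots> \<le> real (cdim (tensor T Y))"
    using \<open>1 \<le> codim (tensor T V) K\<close> by (simp add: divide_le_eq mult_le_cancel_left1)
  finally show "q \<le> real (cdim (tensor T Y))" .
qed

text \<open>
  The kernel \<open>K\<close> of \<open>\<beta>\<close> need not satisfy the non-degeneracy condition in the definition of the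
  constants; composing \<open>\<beta>\<close> with a projection onto the support \<open>T'\<close> of \<open>K\<close> enlarges \<open>K\<close> to a
  subspace that does, and does not change the images of \<open>T'\<close>.
\<close>

lemma codim_bound:
  assumes T: "fin_dim T" and V: "fin_dim V" and Y: "fin_dim Y"
    and \<beta>: "bilin_on T V P \<beta>" and P: "csubspace P"
    and L: "lin_on (tensor T V) P L" "\<And>u v. u \<in> T \<Longrightarrow> v \<in> V \<Longrightarrow> L (pure_tensor T V u v) = \<beta> u v"
    and K: "t0 \<in> tensor T V" "t0 \<noteq> 0" "L t0 = 0"
    and T': "csubspace T'" "T' \<subseteq> T" "{t \<in> tensor T V. L t = 0} \<subseteq> subtensor T V T' V"
    and min: "\<And>T1. csubspace T1 \<Longrightarrow> T1 \<subseteq> T \<Longrightarrow> {t \<in> tensor T V. L t = 0} \<subseteq> subtensor T V T1 V \<Longrightarrow> T' \<subseteq> T1"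
    and \<kappa>: "bilin_on X V Y \<kappa>" "tsurj \<kappa> X V Y"
    and \<sigma>: "bilin_on T Y Q \<sigma>" and Q: "csubspace Q"
    and \<rho>: "bilin_on P X Q \<rho>" "\<And>t v \<chi>. t \<in> T \<Longrightarrow> v \<in> V \<Longrightarrow> \<chi> \<in> X \<Longrightarrow> \<rho> (\<beta> t v) \<chi> = \<sigma> t (\<kappa> \<chi> v)"
  shows "real (cdim (cspan {\<sigma> t y |t y. t \<in> T' \<and> y \<in> Y}))
      \<le> sup0 (codim_ratios T V X Y \<kappa>) * real (cdim (cspan {\<beta> t v |t v. t \<in> T' \<and> v \<in> V}))"
proof -
  note sT = fin_dim_sub[OF T] and sV = fin_dim_sub[OF V] and sY = fin_dim_sub[OF Y]
  obtain p where p: "lin_on T T' p" "\<And>u. u \<in> T' \<Longrightarrow> p u = u" using projection_exists[OF T T'(1,2)] by blast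
  have pT: "lin_on T T p" using p(1) T'(2) by (auto intro: lin_on_subset)
  let ?R = "cspan {\<sigma> t y |t y. t \<in> T' \<and> y \<in> Y}" and ?I = "cspan {\<beta> t v |t v. t \<in> T' \<and> v \<in> V}"
  obtain L' where L': "lin_on (tensor T V) P L'" "\<And>u v. u \<in> T \<Longrightarrow> v \<in> V \<Longrightarrow> L' (pure_tensor T V u v) = \<beta> (p u) v"
    by (rule bilin_lift[OF T V P bilin_compose[OF pT \<beta> lin_on_id lin_on_id]], rule that)
  obtain S where S: "lin_on (tensor T Y) Q S" "\<And>u y. u \<in> T \<Longrightarrow> y \<in> Y \<Longrightarrow> S (pure_tensor T Y u y) = \<sigma> (p u) y"
    by (rule bilin_lift[OF T Y Q bilin_compose[OF pT \<sigma> lin_on_id lin_on_id]], rule that)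
  have imL: "L' ` tensor T V = ?I" by (rule image_tensor_projection[OF p T'(2) L'])
  have imS: "S ` tensor T Y = ?R" by (rule image_tensor_projection[OF p T'(2) S])
  let ?K = "{t \<in> tensor T V. L' t = 0}"
  let ?D = "cspan {id_tensor T V Y (\<kappa> \<chi>) t |t \<chi>. t \<in> ?K \<and> \<chi> \<in> X}"
  have fTV: "fin_dim (tensor T V)" and fTY: "fin_dim (tensor T Y)" using T V Y by (auto intro: fin_dim_tensor)
  have sK: "csubspace ?K" by (rule lin_on_ker_subspace[OF csubspace_tensor L'(1)])
  have cK: "codim (tensor T V) ?K = real (cdim ?I)"
    using rank_nullity[OF fTV L'(1)] imL unfolding codim_def by simp
  note \<kappa>r = bilin_right[OF \<kappa>(1)]
  have SL: "S (id_tensor T V Y (\<kappa> \<chi>) t) = \<rho> (L' t) \<chi>" if \<chi>: "\<chi> \<in> X" and t: "t \<in> tensor T V" for \<chi> t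
  proof (rule tensor_ext[OF lin_on_compose[OF id_tensor_lin(1)[OF sT sV \<kappa>r[OF \<chi>]] S(1)]
        lin_on_compose[OF L'(1) bilin_left[OF \<rho>(1) \<chi>]] _ t])
    fix u v assume "u \<in> T" "v \<in> V"
    then show "S (id_tensor T V Y (\<kappa> \<chi>) (pure_tensor T V u v)) = \<rho> (L' (pure_tensor T V u v)) \<chi>"
      using id_tensor_lin(2)[OF sT sV \<kappa>r[OF \<chi>]] S(2) L'(2) \<rho>(2) \<chi> lin_on_mem[OF pT] lin_on_mem[OF \<kappa>r[OF \<chi>]]
      by simp
  qed
  \<comment> \<open>By \<open>SL\<close> the map \<open>S\<close> kills everything that generates
    \<open>?D\<close>. Hence the rank of \<open>S\<close>, which is the dimension to be estimated,
    is at most the codimension of \<open>?D\<close>.\<close>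
  have "{id_tensor T V Y (\<kappa> \<chi>) t |t \<chi>. t \<in> ?K \<and> \<chi> \<in> X} \<subseteq> {t \<in> tensor T Y. S t = 0}"
    using SL bilin_0_left[OF P \<rho>(1)] lin_on_mem[OF id_tensor_lin(1)[OF sT sV \<kappa>r]] by auto
  then have D: "?D \<subseteq> {t \<in> tensor T Y. S t = 0}"
    by (rule complex_vector.span_minimal[OF _ lin_on_ker_subspace[OF csubspace_tensor S(1)]])
  have "cdim ?D \<le> cdim {t \<in> tensor T Y. S t = 0}"
    by (rule cdim_mono[OF fin_dim_subspace[OF fTY lin_on_ker_subspace[OF csubspace_tensor S(1)]]]) (use D in auto)
  then have cD: "real (cdim ?R) \<le> codim (tensor T Y) ?D"
    using rank_nullity[OF fTY S(1)] imS unfolding codim_def by simp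
  show ?thesis
  proof (cases "?K = tensor T V")
    \<comment> \<open>The projection may enlarge the kernel to the whole space, which is not proper
      and gives no ratio. Then \<beta> and, since \<kappa> is onto, also \<sigma> vanish on
      \<open>T'\<close>, and both dimensions are 0.\<close>
    case True
    have z: "\<beta> t v = 0" if "t \<in> T'" "v \<in> V" for t v
    proof -
      have t: "t \<in> T" using that T' by auto
      have "pure_tensor T V t v \<in> ?K" using True pure_mem[OF t that(2)] by simp
      then show ?thesis using L'(2)[OF t that(2)] p(2)[OF that(1)] by simp
    qed
    have "\<sigma> t y = 0" if t: "t \<in> T'" and y: "y \<in> Y" for t y
    proof -
      have tT: "t \<in> T" using t T' by auto
      have "y \<in> cspan {\<kappa> u v |u v. u \<in> X \<and> v \<in> V}" using y \<kappa>(2) by (simp add: tsurj_def)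
      then have "\<sigma> t y \<in> {0}"
        by (rule lin_on_span_into[OF sY bilin_right[OF \<sigma> tT], rotated -1])
          (use \<rho>(2)[OF tT] z[OF t] bilin_0_left[OF P \<rho>(1)] bilin_mem[OF \<kappa>(1)] in \<open>auto simp flip: \<rho>(2)[OF tT]\<close>)
      then show ?thesis by simp
    qed
    then have "{\<sigma> t y |t y. t \<in> T' \<and> y \<in> Y} \<subseteq> {0}" by auto
    then have "?R \<subseteq> {0}" by (rule complex_vector.span_minimal) simp
    then have "cdim ?R = 0" using cdim_mono[OF fin_dim_0, of ?R] by simp
    moreover have "{\<beta> t v |t v. t \<in> T' \<and> v \<in> V} \<subseteq> {0}" using z by auto
    then have "?I \<subseteq> {0}" by (rule complex_vector.span_minimal) simp
    then have "cdim ?I = 0" using cdim_mono[OF fin_dim_0, of ?I] by simp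
    ultimately show ?thesis by simp
  next
    case False
    then have Kpr: "?K \<subset> tensor T V" by auto
    \<comment> \<open>The enlarged kernel contains \<open>Ker p \<otimes> V\<close> and the original
      kernel. A space \<open>T1\<close> supporting it thus contains \<open>Ker p\<close> and, by
      minimality, \<open>T'\<close>, hence all of \<open>T\<close>.\<close>
    have nondeg: "\<not> ?K \<subseteq> subtensor T V T1 V" if T1: "csubspace T1" "T1 \<subset> T" for T1
    proof
      assume KT1: "?K \<subseteq> subtensor T V T1 V"
      \<comment> \<open>A nonzero \<open>v\<close>, completed to a basis, is what allows
        \<open>u\<close> to be read off from \<open>u \<otimes> v\<close>.\<close>
      have "\<exists>v\<in>V. v \<noteq> 0"
      proof (rule ccontr)
        assume "\<not> ?thesis"
        then have "cdim V = 0" using cdim_mono[OF fin_dim_0 sV] by auto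
        then have "cdim (tensor T V) = 0" by (simp add: cdim_tensor[OF T V])
        then show False using cdim_eq_imp_eq[OF fTV, of "{0}"] K complex_vector.subspace_0[OF csubspace_tensor] by auto
      qed
      then obtain v where v: "v \<in> V" "v \<noteq> 0" by blast
      obtain C where C: "cbasis C V" "v \<in> C"
        using cbasis_extend[OF V, of "{v}"] v by auto
      obtain c where c: "\<And>b. b \<in> C \<Longrightarrow> lin_on (tensor T V) T (c b)"
        "\<And>b u v. b \<in> C \<Longrightarrow> u \<in> T \<Longrightarrow> v \<in> V \<Longrightarrow> c b (pure_tensor T V u v) = co C b v *\<^sub>C u"
        "\<And>t. t \<in> tensor T V \<Longrightarrow> t = (\<Sum>b\<in>C. pure_tensor T V (c b t) b)"
        by (rule tensor_expand[OF T C(1)], rule that)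
      have cT1: "c v t \<in> T1" if "t \<in> subtensor T V T1 V" for t
        by (rule lin_on_span_into[OF csubspace_tensor c(1)[OF C(2)] T1(1) _ _ that[unfolded subtensor_def]])
          (use T1 C in \<open>auto simp: c(2) subset_iff intro!: pure_mem complex_vector.subspace_scale\<close>)
      have ker: "u \<in> T1" if u: "u \<in> T" "p u = 0" for u
      proof -
        have "pure_tensor T V u v \<in> ?K"
          using u v pure_mem L'(2) bilin_0_left[OF sT \<beta>] by auto
        then have "c v (pure_tensor T V u v) \<in> T1" using KT1 cT1 by blast
        then show ?thesis using c(2)[OF C(2) u(1) v(1)] C co_basis[OF C(1,2)] by (simp add: scaleC_one)
      qed
      have "{t \<in> tensor T V. L t = 0} \<subseteq> ?K"
      proof safe
        fix t assume t: "t \<in> tensor T V" "L t = 0"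
        have "t \<in> subtensor T V T' V" using T'(3) t by auto
        then have "L' t = L t"
          unfolding subtensor_def
          by (rule lin_on_eq_span[OF csubspace_tensor L'(1) L(1), rotated -1])
            (use T'(2) L'(2) L(2) p(2) in \<open>auto simp: subset_iff intro: pure_mem\<close>)
        then show "L' t = 0" using t by simp
      qed
      then have "T' \<subseteq> T1" using min[OF T1(1)] T1(2) KT1 by auto
      have "T \<subseteq> T1"
      proof
        fix u assume u: "u \<in> T"
        have pu: "p u \<in> T'" using lin_on_mem[OF p(1) u] .
        then have "p (u - p u) = 0" "u - p u \<in> T"
          using u T'(2) p(2)[OF pu] sT by (auto simp: lin_on_diff[OF sT p(1)] complex_vector.subspace_diff subset_iff)
        then have "u - p u \<in> T1" by (intro ker)
        then have "(u - p u) + p u \<in> T1"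
          using pu \<open>T' \<subseteq> T1\<close> T1(1) by (intro complex_vector.subspace_add) auto
        then show "u \<in> T1" by simp
      qed
      then show False using T1 by auto
    qed
    have "codim (tensor T Y) ?D / codim (tensor T V) ?K \<in> codim_ratios T V X Y \<kappa>"
      unfolding codim_ratios_def using sK Kpr nondeg by blast
    then have "codim (tensor T Y) ?D / codim (tensor T V) ?K \<le> sup0 (codim_ratios T V X Y \<kappa>)"
      using codim_ratios_bdd[OF T V] by (auto simp: sup0_def intro: cSup_upper)
    moreover have "0 < codim (tensor T V) ?K"
      using cdim_psubset[OF fTV sK Kpr] by (simp add: codim_def)
    ultimately have "codim (tensor T Y) ?D \<le> sup0 (codim_ratios T V X Y \<kappa>) * codim (tensor T V) ?K"
      by (simp add: divide_le_eq)
    then show ?thesis using cD cK by simp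
  qed
qed

text \<open>The nonzero kernel vector lies in \<open>T' \<otimes> V\<close>, so the restriction of
  \<open>L\<close> to this space of dimension \<open>cdim T' * cdim V\<close> loses rank.\<close>

lemma support_image_strict:
  assumes T: "fin_dim T" and V: "fin_dim V"
    and L: "lin_on (tensor T V) P L" "\<And>u v. u \<in> T \<Longrightarrow> v \<in> V \<Longrightarrow> L (pure_tensor T V u v) = \<beta> u v"
    and K: "t0 \<in> tensor T V" "t0 \<noteq> 0" "L t0 = 0"
    and T': "csubspace T'" "T' \<subseteq> T" "{t \<in> tensor T V. L t = 0} \<subseteq> subtensor T V T' V"
  shows "cdim (cspan {\<beta> t v |t v. t \<in> T' \<and> v \<in> V}) < cdim T' * cdim V"
proof -
  let ?S = "subtensor T V T' V"
  have sub: "{pure_tensor T V u v |u v. u \<in> T' \<and> v \<in> V} \<subseteq> tensor T V" using T'(2) pure_mem by blast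
  have St: "?S \<subseteq> tensor T V" unfolding subtensor_def using sub csubspace_tensor by (rule complex_vector.span_minimal)
  have fS: "fin_dim ?S" and dS: "cdim ?S = cdim T' * cdim V" using subtensor_dim[OF T T'(1,2) V] by auto
  have LS: "lin_on ?S P L" using L(1) St by (rule lin_on_subset) auto
  have im: "L ` ?S = cspan {\<beta> t v |t v. t \<in> T' \<and> v \<in> V}" by (rule image_tensor[OF L T'(2)])
  have "cdim {t \<in> ?S. L t = 0} \<noteq> 0"
  proof
    assume 0: "cdim {t \<in> ?S. L t = 0} = 0"
    have k: "csubspace {t \<in> ?S. L t = 0}" by (rule lin_on_ker_subspace[OF fin_dim_sub[OF fS] LS])
    have "fin_dim {t \<in> ?S. L t = 0}" using fin_dim_subspace[OF fS k] by auto
    then have "{0} = {t \<in> ?S. L t = 0}"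
      by (rule cdim_eq_imp_eq) (use 0 complex_vector.subspace_0[OF k] in auto)
    then show False using K T'(3) by auto
  qed
  then show ?thesis using rank_nullity[OF fS LS] im dS by simp
qed

section \<open>Polynomial maps and closed conditions\<close>

text \<open>Testing against linear forms avoids coordinates on the target; asking for agreement only
  on \<open>W\<close> leaves \<open>F\<close> arbitrary outside.\<close>

definition poly_map :: "'w::complex_vector set \<Rightarrow> 'v::complex_vector set \<Rightarrow> ('w \<Rightarrow> 'v) \<Rightarrow> bool" where
  "poly_map W V F \<longleftrightarrow> (\<forall>w\<in>W. F w \<in> V) \<and> (\<forall>f\<in>dual V. \<exists>g\<in>poly_fun W. \<forall>w\<in>W. f (F w) = g w)"

lemma poly_map_mem: "poly_map W V F \<Longrightarrow> w \<in> W \<Longrightarrow> F w \<in> V"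
  by (simp add: poly_map_def)

lemma poly_map_lin:
  assumes "csubspace W" "lin_on W V F" shows "poly_map W V F"
  unfolding poly_map_def
proof (intro conjI ballI)
  fix f assume "f \<in> dual V"
  then have "lin_on W UNIV (\<lambda>w. f (F w))" by (intro lin_on_compose[OF assms(2)] dual_lin)
  then have "res W (\<lambda>w. f (F w)) \<in> dual W" unfolding dual_def by (intro res_Hom assms(1))
  then have "res W (\<lambda>w. f (F w)) \<in> poly_fun W" by (rule poly_fun.linear)
  then show "\<exists>g\<in>poly_fun W. \<forall>w\<in>W. f (F w) = g w" by (rule bexI[rotated]) (simp add: res_def)
qed (use assms(2) in \<open>simp add: lin_on_def\<close>)

lemma poly_map_const: "v \<in> V \<Longrightarrow> poly_map W V (\<lambda>_. v)"
  unfolding poly_map_def by (auto intro: poly_fun.const)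

lemma poly_map_zero: "csubspace V \<Longrightarrow> poly_map W V (\<lambda>_. 0)"
  by (intro poly_map_const complex_vector.subspace_0)

lemma poly_map_add:
  assumes "csubspace V" "poly_map W V F" "poly_map W V G"
  shows "poly_map W V (\<lambda>w. F w + G w)"
  unfolding poly_map_def
proof (intro conjI ballI)
  fix f assume f: "f \<in> dual V"
  obtain g h where gh: "g \<in> poly_fun W" "\<forall>w\<in>W. f (F w) = g w" "h \<in> poly_fun W" "\<forall>w\<in>W. f (G w) = h w"
    using assms f unfolding poly_map_def by metis
  then have "\<forall>w\<in>W. f (F w + G w) = g w + h w"
    using lin_on_add[OF dual_lin[OF f]] assms by (auto simp: poly_map_def)
  then show "\<exists>g\<in>poly_fun W. \<forall>w\<in>W. f (F w + G w) = g w" using poly_fun.add[OF gh(1,3)] by (rule bexI)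
qed (use assms in \<open>auto simp: poly_map_def complex_vector.subspace_add\<close>)

lemma poly_map_scale:
  assumes "csubspace V" "poly_map W V F" "c \<in> poly_fun W"
  shows "poly_map W V (\<lambda>w. c w *\<^sub>C F w)"
  unfolding poly_map_def
proof (intro conjI ballI)
  fix f assume f: "f \<in> dual V"
  obtain g where g: "g \<in> poly_fun W" "\<forall>w\<in>W. f (F w) = g w"
    using assms f unfolding poly_map_def by metis
  then have "\<forall>w\<in>W. f (c w *\<^sub>C F w) = c w * g w"
    using lin_on_scale[OF dual_lin[OF f]] assms by (auto simp: poly_map_def scaleC_complex_def)
  then show "\<exists>g\<in>poly_fun W. \<forall>w\<in>W. f (c w *\<^sub>C F w) = g w" using poly_fun.mult[OF assms(3) g(1)] by (rule bexI)
qed (use assms in \<open>auto simp: poly_map_def complex_vector.subspace_scale\<close>)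

lemma poly_map_sum:
  "csubspace V \<Longrightarrow> (\<And>i. i \<in> I \<Longrightarrow> poly_map W V (F i)) \<Longrightarrow> poly_map W V (\<lambda>w. \<Sum>i\<in>I. F i w)"
  by (induction I rule: infinite_finite_induct) (auto intro: poly_map_zero poly_map_add)

lemma poly_map_cong:
  "(\<And>w. w \<in> W \<Longrightarrow> F w = G w) \<Longrightarrow> poly_map W V F \<longleftrightarrow> poly_map W V G"
  unfolding poly_map_def by auto

text \<open>Expanding \<open>F w\<close> in a basis of \<open>V\<close> leaves scalar polynomials
  times the vectors \<open>G w b\<close>. Iterated, this shows that composites of the components of
  a point of \<open>bigW\<close> are polynomial in that point.\<close>

lemma poly_map_bilin:
  assumes V: "fin_dim V" and U: "csubspace U" and F: "poly_map W V F"
    and G: "\<And>v. v \<in> V \<Longrightarrow> poly_map W U (\<lambda>w. G w v)" and l: "\<And>w. w \<in> W \<Longrightarrow> lin_on V U (G w)"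
  shows "poly_map W U (\<lambda>w. G w (F w))"
proof -
  obtain B where B: "cbasis B V" using V by (rule fin_dim_cbasis)
  have "\<exists>g. g \<in> poly_fun W \<and> (\<forall>w\<in>W. co B b (F w) = g w)" for b
  proof -
    have "res V (co B b) \<in> dual V" unfolding dual_def by (rule res_Hom[OF fin_dim_sub[OF V] co_lin[OF B]])
    then show ?thesis using F unfolding poly_map_def by (force simp: res_def)
  qed
  then obtain g where g: "\<And>b. g b \<in> poly_fun W" "\<And>b w. w \<in> W \<Longrightarrow> co B b (F w) = g b w" by metis
  have "poly_map W U (\<lambda>w. \<Sum>b\<in>B. g b w *\<^sub>C G w b)"
    using cbasis_mem[OF B] by (intro poly_map_sum poly_map_scale U G g)
  moreover have "(\<Sum>b\<in>B. g b w *\<^sub>C G w b) = G w (F w)" if "w \<in> W" for w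
    using lin_on_co_expand[OF B l[OF that] poly_map_mem[OF F that]] g(2)[OF that] by simp
  ultimately show ?thesis using poly_map_cong[of W "\<lambda>w. \<Sum>b\<in>B. g b w *\<^sub>C G w b" "\<lambda>w. G w (F w)"] by simp
qed

text \<open>Vectors are compared through linear forms, and the difference of the two pulled back
  polynomials vanishes on \<open>Z\<close>, hence on its closure.\<close>

lemma poly_map_eq_closure:
  assumes V: "fin_dim V" and F: "poly_map W V F" "poly_map W V G" and Z: "Z \<subseteq> W"
    and eq: "\<And>z. z \<in> Z \<Longrightarrow> F z = G z" and w: "w \<in> zariski_closure W Z"
  shows "F w = G w"
proof (rule dual_eqI[OF V])
  have wW: "w \<in> W" using w by (simp add: zariski_closure_def)
  then show "F w \<in> V" "G w \<in> V" using F by (auto intro: poly_map_mem)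
  fix f assume f: "f \<in> dual V"
  obtain g h where gh: "g \<in> poly_fun W" "\<forall>w\<in>W. f (F w) = g w" "h \<in> poly_fun W" "\<forall>w\<in>W. f (G w) = h w"
    using F f unfolding poly_map_def by blast
  \<comment> \<open>\<open>poly_fun\<close> is closed under sums and products, so the minus sign is
    written as a constant factor.\<close>
  let ?d = "\<lambda>x. g x + (\<lambda>_. -1) x * h x"
  have "?d \<in> poly_fun W" by (intro poly_fun.add poly_fun.mult poly_fun.const gh)
  moreover have "\<forall>z\<in>Z. ?d z = 0"
  proof
    fix z assume z: "z \<in> Z"
    then have "g z = h z" using gh Z eq[OF z] by (metis subsetD)
    then show "?d z = 0" by simp
  qed
  moreover have "\<forall>f\<in>poly_fun W. (\<forall>s\<in>Z. f s = 0) \<longrightarrow> f w = 0" using w by (simp add: zariski_closure_def)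
  ultimately have "?d w = 0" by (metis (no_types, lifting))
  then show "f (F w) = f (G w)" using gh wW by simp
qed


section \<open>Factorisation through a quotient\<close>

text \<open>The basis is returned as a set of indices, not of vectors, because the families to be
  factored through \<open>K\<close> are given on indices.\<close>

lemma basis_from_spanning:
  assumes Y: "fin_dim Y" and K: "cspan (K ` I) = Y"
  obtains E c where "finite E" "E \<subseteq> I" "\<And>e. lin_on Y UNIV (c e)"
    "\<And>y. y \<in> Y \<Longrightarrow> y = (\<Sum>e\<in>E. c e y *\<^sub>C K e)"
proof -
  obtain C where C: "C \<subseteq> K ` I" "\<not> cdependent C" "K ` I \<subseteq> cspan C"
    using complex_vector.maximal_independent_subset[of "K ` I"] by blast
  have sp: "cspan C = Y"
    using complex_vector.span_mono[OF C(1)] complex_vector.span_minimal[OF C(3) complex_vector.subspace_span] K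
    by simp
  have "C \<subseteq> Y" using sp complex_vector.span_superset by blast
  then have B: "cbasis C Y" using independent_fin_dim[OF Y C(2)] C(2) sp by (simp add: cbasis_def)
  obtain s where s: "\<And>b. b \<in> C \<Longrightarrow> s b \<in> I \<and> K (s b) = b"
    using bchoice[of C "\<lambda>b i. i \<in> I \<and> K i = b"] C(1) by blast
  have inj: "inj_on s C" using s by (metis inj_onI)
  show ?thesis
  proof (rule that[of "s ` C" "\<lambda>e. co C (K e)"])
    show "lin_on Y UNIV (co C (K e))" for e by (rule co_lin[OF B])
    show "y = (\<Sum>e\<in>s ` C. co C (K e) y *\<^sub>C K e)" if "y \<in> Y" for y
      using co_sum[OF B that] s by (simp add: sum.reindex[OF inj])
  qed (use cbasis_finite[OF B] s in auto)
qed

text \<open>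
  The equations below, with fixed coefficients, characterise the families \<open>F\<close> that factor through
  \<open>K\<close>; this makes factorisation a closed condition on \<open>F\<close>.
\<close>

lemma factorisation_equation:
  assumes Y: "csubspace Y" and K: "\<And>i. i \<in> I \<Longrightarrow> K i \<in> Y" and E: "finite E" "E \<subseteq> I"
    and c: "\<And>y. y \<in> Y \<Longrightarrow> y = (\<Sum>e\<in>E. c e y *\<^sub>C K e)"
    and \<Gamma>: "lin_on Y Q \<Gamma>" "\<And>i. i \<in> I \<Longrightarrow> F i = \<Gamma> (K i)" and i: "i \<in> I"
  shows "F i = (\<Sum>e\<in>E. c e (K i) *\<^sub>C F e)"
proof -
  have "F i = \<Gamma> (\<Sum>e\<in>E. c e (K i) *\<^sub>C K e)" using \<Gamma>(2)[OF i] c[OF K[OF i]] by simp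
  also have "\<dots> = (\<Sum>e\<in>E. \<Gamma> (c e (K i) *\<^sub>C K e))"
    using K E by (intro lin_on_sum[OF Y \<Gamma>(1)] complex_vector.subspace_scale[OF Y]) auto
  also have "\<dots> = (\<Sum>e\<in>E. c e (K i) *\<^sub>C F e)"
    using K E \<Gamma>(2) by (intro sum.cong) (auto simp: lin_on_scale[OF \<Gamma>(1)])
  finally show ?thesis .
qed

lemma bilin_from_factorisation:
  assumes Q: "csubspace Q" and E: "E \<subseteq> I" and c: "\<And>e. lin_on Y UNIV (c e)"
    and F: "\<And>i. i \<in> I \<Longrightarrow> lin_on P Q (\<lambda>p. F p i)"
  shows "bilin_on P Y Q (\<lambda>p y. \<Sum>e\<in>E. c e y *\<^sub>C F p e)"
  unfolding bilin_on_def
proof (intro conjI ballI)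
  show "lin_on P Q (\<lambda>p. \<Sum>e\<in>E. c e y *\<^sub>C F p e)" for y
    using E F by (intro lin_on_sum_map lin_on_scale_map Q) auto
  show "lin_on Y Q (\<lambda>y. \<Sum>e\<in>E. c e y *\<^sub>C F p e)" if "p \<in> P" for p
    using E lin_on_mem[OF F] that by (intro lin_on_sum_map lin_on_coeff Q c) auto
qed

text \<open>On \<open>Z\<close> the family factors and so satisfies the equations of
  \<open>factorisation_equation\<close>. Both sides are polynomial in the point, so the equations
  survive in the closure, where they define \<Gamma>. For a point of \<open>Z\<close> the factor may
  be chosen separately for each \<open>p\<close>; linearity in \<open>p\<close> is restored by the
  explicit formula.\<close>

lemma closure_factorisation:
  assumes Y: "fin_dim Y" and K: "cspan (K ` I) = Y" and Q: "fin_dim Q"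
    and poly: "\<And>p i. p \<in> P \<Longrightarrow> i \<in> I \<Longrightarrow> poly_map W Q (\<lambda>w. F w p i)"
    and Z: "Z \<subseteq> W" and fac: "\<And>z p. z \<in> Z \<Longrightarrow> p \<in> P \<Longrightarrow> \<exists>\<Gamma>. lin_on Y Q \<Gamma> \<and> (\<forall>i\<in>I. F z p i = \<Gamma> (K i))"
    and w: "w \<in> zariski_closure W Z" and lin: "\<And>i. i \<in> I \<Longrightarrow> lin_on P Q (\<lambda>p. F w p i)"
  obtains \<Gamma> where "bilin_on P Y Q \<Gamma>" "\<And>p i. p \<in> P \<Longrightarrow> i \<in> I \<Longrightarrow> F w p i = \<Gamma> p (K i)"
proof -
  obtain E c where E: "finite E" "E \<subseteq> I" and c: "\<And>e. lin_on Y UNIV (c e)"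
    and ex: "\<And>y. y \<in> Y \<Longrightarrow> y = (\<Sum>e\<in>E. c e y *\<^sub>C K e)"
    by (rule basis_from_spanning[OF Y K], rule that)
  have KY: "K i \<in> Y" if "i \<in> I" for i using K that complex_vector.span_base by blast
  note sQ = fin_dim_sub[OF Q]
  have eq: "F w p i = (\<Sum>e\<in>E. c e (K i) *\<^sub>C F w p e)" if p: "p \<in> P" and i: "i \<in> I" for p i
  proof (rule poly_map_eq_closure[OF Q poly[OF p i] _ Z _ w])
    show "poly_map W Q (\<lambda>w. \<Sum>e\<in>E. c e (K i) *\<^sub>C F w p e)"
      using E(2) p by (intro poly_map_sum poly_map_scale sQ poly poly_fun.const) auto
    fix z assume "z \<in> Z"
    then obtain \<Gamma> where \<Gamma>: "lin_on Y Q \<Gamma>" "\<And>i. i \<in> I \<Longrightarrow> F z p i = \<Gamma> (K i)" using fac[OF _ p] by blast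
    show "F z p i = (\<Sum>e\<in>E. c e (K i) *\<^sub>C F z p e)"
      by (rule factorisation_equation[OF fin_dim_sub[OF Y] KY E ex \<Gamma> i])
  qed
  have "bilin_on P Y Q (\<lambda>p y. \<Sum>e\<in>E. c e y *\<^sub>C F w p e)"
    by (rule bilin_from_factorisation[OF sQ E(2) c lin])
  then show ?thesis using eq by (rule that)
qed

section \<open>Truncations of the map \<open>\<gamma>\<close>\<close>

lemma bilin_tensor_lift_param:
  assumes "csubspace U" "csubspace V" "csubspace X" "csubspace C"
    and b: "\<And>c. c \<in> C \<Longrightarrow> bilin_on U V X (\<beta> c)"
    and l: "\<And>u v. u \<in> U \<Longrightarrow> v \<in> V \<Longrightarrow> lin_on C X (\<lambda>c. \<beta> c u v)"
  shows "bilin_on C (tensor U V) X (\<lambda>c. tensor_lift U V (\<beta> c))"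
  unfolding bilin_on_def
proof (intro conjI ballI)
  show R: "lin_on (tensor U V) X (tensor_lift U V (\<beta> c))" if "c \<in> C" for c
    by (rule tensor_lift_lin[OF assms(1-3) b[OF that]])
  note lp = tensor_lift_pure_bilin[OF assms(1,2) b]
  show "lin_on C X (\<lambda>c. tensor_lift U V (\<beta> c) t)" if t: "t \<in> tensor U V" for t
  proof (rule lin_onI)
    show "tensor_lift U V (\<beta> (c + d)) t = tensor_lift U V (\<beta> c) t + tensor_lift U V (\<beta> d) t"
      if cd: "c \<in> C" "d \<in> C" for c d
    proof (rule tensor_ext[where f="tensor_lift U V (\<beta> (c + d))", OF R _ _ t])
      show cd': "c + d \<in> C" using cd assms(4) by (simp add: complex_vector.subspace_add)
      show "lin_on (tensor U V) X (\<lambda>t. tensor_lift U V (\<beta> c) t + tensor_lift U V (\<beta> d) t)"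
        by (intro lin_on_plus R assms(3) cd)
      show "tensor_lift U V (\<beta> (c + d)) (pure_tensor U V u v) =
          tensor_lift U V (\<beta> c) (pure_tensor U V u v) + tensor_lift U V (\<beta> d) (pure_tensor U V u v)"
        if uv: "u \<in> U" "v \<in> V" for u v
        unfolding lp[OF cd' uv] lp[OF cd(1) uv] lp[OF cd(2) uv] by (rule lin_on_add[OF l[OF uv] cd])
    qed
    show "tensor_lift U V (\<beta> (k *\<^sub>C c)) t = k *\<^sub>C tensor_lift U V (\<beta> c) t" if c: "c \<in> C" for k c
    proof (rule tensor_ext[where f="tensor_lift U V (\<beta> (k *\<^sub>C c))", OF R _ _ t])
      show c': "k *\<^sub>C c \<in> C" using c assms(4) by (simp add: complex_vector.subspace_scale)
      show "lin_on (tensor U V) X (\<lambda>t. k *\<^sub>C tensor_lift U V (\<beta> c) t)"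
        by (intro lin_on_scale_map R assms(3) c)
      show "tensor_lift U V (\<beta> (k *\<^sub>C c)) (pure_tensor U V u v) =
          k *\<^sub>C tensor_lift U V (\<beta> c) (pure_tensor U V u v)"
        if uv: "u \<in> U" "v \<in> V" for u v
        unfolding lp[OF c' uv] lp[OF c uv] by (rule lin_on_scale[OF l[OF uv] c])
    qed
  qed (use lin_on_mem[OF R t] in auto)
qed

lemma id_tensor_tensor_lift:
  assumes "csubspace U" "csubspace V" "csubspace W" "lin_on V W f" "bilin_on U W X \<beta>" "csubspace X"
    and t: "t \<in> tensor U V"
  shows "tensor_lift U W \<beta> (id_tensor U V W f t) = tensor_lift U V (\<lambda>u v. \<beta> u (f v)) t"
proof (rule tensor_ext[where f="\<lambda>t. tensor_lift U W \<beta> (id_tensor U V W f t)", OF _ tensor_lift_lin_UNIV _ t])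
  show "lin_on (tensor U V) X (\<lambda>t. tensor_lift U W \<beta> (id_tensor U V W f t))"
    by (rule lin_on_compose[OF id_tensor_lin(1)[OF assms(1,2,4)] tensor_lift_lin[OF assms(1,3,6,5)]])
  have b: "bilin_on U V X (\<lambda>u v. \<beta> u (f v))"
    by (rule bilin_compose[where f="\<lambda>u. u" and h="\<lambda>x. x", OF lin_on_id assms(5,4) lin_on_id])
  fix u v assume uv: "u \<in> U" "v \<in> V"
  show "tensor_lift U W \<beta> (id_tensor U V W f (pure_tensor U V u v)) = tensor_lift U V (\<lambda>u v. \<beta> u (f v)) (pure_tensor U V u v)"
    unfolding id_tensor_lin(2)[OF assms(1,2,4) uv] tensor_lift_pure_bilin[OF assms(1,2) b uv]
    by (rule tensor_lift_pure_bilin[OF assms(1,3,5) uv(1) lin_on_mem[OF assms(4) uv(2)]])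
qed

text \<open>The element \<open>h\<close> is carried to \<open>H\<^sub>k\<^sub>i\<close> by
  \<open>a\<close>, then by the adjoint of the composition to
  \<open>B\<^sub>l\<^sub>k\<^sup>* \<otimes> H\<^sub>l\<^sub>i\<close>, and contracted with \<chi>.
  With all four indices free it serves every pair \<open>l\<close>, \<open>i\<close>, whereas
  \<open>gamma\<close> needs only the pair s, 1.\<close>

definition theta :: "('a::complex_vector, 'b::complex_vector, 'h::complex_vector, 'm::complex_vector,
    'n::complex_vector) comp_system \<Rightarrow> nat \<Rightarrow> nat \<Rightarrow> nat \<Rightarrow> nat \<Rightarrow> ('h \<Rightarrow> complex) \<Rightarrow> 'a \<Rightarrow> 'h \<Rightarrow> 'b \<Rightarrow> complex" where
  "theta D l k j i \<chi> a h = res (spB D l k) (\<lambda>b. \<chi> (cBH D l k i b (cHA D k j i h a)))"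

definition inner :: "('a::complex_vector, 'b::complex_vector, 'h::complex_vector, 'm::complex_vector,
    'n::complex_vector) comp_system \<Rightarrow> nat \<Rightarrow> nat \<Rightarrow> nat \<Rightarrow> nat \<Rightarrow> ('h \<Rightarrow> complex) \<Rightarrow> 'a \<Rightarrow> ('n, 'h) tens \<Rightarrow>
    ('n, 'b \<Rightarrow> complex) tens" where
  "inner D l k j i \<chi> a = tensor_lift (spN D k) (spH D k j)
     (\<lambda>n h. pure_tensor (spN D k) (dual (spB D l k)) n (theta D l k j i \<chi> a h))"

text \<open>
  For \<open>i = 1\<close> and \<open>l = s\<close> this is \<open>\<gamma>(\<phi>)\<close>; for general \<open>i\<close>, \<open>l\<close> it is the analogous map
  \<open>P\<^sub>i \<otimes> H\<^sub>l\<^sub>i\<^sup>* \<rightarrow> Q\<^sub>l\<close>.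
\<close>

definition gam :: "('a::complex_vector, 'b::complex_vector, 'h::complex_vector, 'm::complex_vector,
    'n::complex_vector) comp_system \<Rightarrow> (nat \<Rightarrow> nat \<Rightarrow> 'm \<Rightarrow> ('n, 'h) tens) \<Rightarrow> nat \<Rightarrow> nat \<Rightarrow>
    ('m, 'a) Pvec \<Rightarrow> ('h \<Rightarrow> complex) \<Rightarrow> ('n, 'b) Qvec" where
  "gam D \<phi> l i p \<chi> = res {1..l} (\<lambda>k. \<Sum>j = i..nr D.
     tensor_lift (spM D j) (spA D j i) (\<lambda>\<mu> a. inner D l k j i \<chi> a (\<phi> k j \<mu>)) (p j))"

lemma gamma_gam:
  "p \<in> spP D 1 \<Longrightarrow> \<chi> \<in> dual (spH D (ns D) 1) \<Longrightarrow> gamma D \<phi> p \<chi> = gam D \<phi> (ns D) 1 p \<chi>"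
  by (simp add: gamma_def gam_def inner_def theta_def res_def)

lemma res_cong: "(\<And>i. i \<in> I \<Longrightarrow> f i = g i) \<Longrightarrow> res I f = res I g"
  by (simp add: res_def fun_eq_iff)

lemma res_add: "res I (\<lambda>i. f i + g i) = res I f + (res I g :: _ \<Rightarrow> 'b::monoid_add)"
  by (simp add: res_def fun_eq_iff plus_fun_def)

lemma res_scale: "res I (\<lambda>i. c *\<^sub>C f i) = c *\<^sub>C res I f"
  by (simp add: res_def fun_eq_iff scaleC_fun_def)

section \<open>Compatibility of gam with the compositions\<close>

context composition_system
begin

lemmas sub_A = fin_dim_sub[OF fin_A] and sub_B = fin_dim_sub[OF fin_B] and sub_H = fin_dim_sub[OF fin_H]
  and sub_M = fin_dim_sub[OF fin_M] and sub_N = fin_dim_sub[OF fin_N]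

lemmas bAA = Hom_bilin[OF cAA] and bHA = Hom_bilin[OF cHA] and bBH = Hom_bilin[OF cBH] and bBB = Hom_bilin[OF cBB]

lemma dHA_bilin:
  assumes "1 \<le> i" "i \<le> j" "j \<le> nr D" "1 \<le> l" "l \<le> ns D"
  shows "bilin_on (dual (spH D l i)) (spA D j i) (dual (spH D l j)) (dHA D l j i)"
  unfolding dHA_def[abs_def] using assms by (intro dual_comp_bilin bHA sub_H) auto

lemma dHB_bilin:
  assumes "1 \<le> i" "i \<le> nr D" "1 \<le> l" "l \<le> m" "m \<le> ns D"
  shows "bilin_on (dual (spH D m i)) (spB D m l) (dual (spH D l i)) (dHB D m l i)"
  unfolding dHB_def[abs_def] using assms by (intro dual_comp_bilin bilin_swap[OF bBH] sub_H) auto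

lemma dBB_bilin:
  assumes "1 \<le> l" "l \<le> m" "m \<le> n" "n \<le> ns D"
  shows "bilin_on (dual (spB D n l)) (spB D n m) (dual (spB D m l)) (dBB D n m l)"
  unfolding dBB_def[abs_def] using assms by (intro dual_comp_bilin bilin_swap[OF bBB] sub_B) auto

lemma theta_lin:
  assumes idx: "1 \<le> i" "i \<le> j" "j \<le> nr D" "1 \<le> k" "k \<le> l" "l \<le> ns D"
  shows "\<chi> \<in> dual (spH D l i) \<Longrightarrow> a \<in> spA D j i \<Longrightarrow> lin_on (spH D k j) (dual (spB D l k)) (theta D l k j i \<chi> a)"
    and "\<chi> \<in> dual (spH D l i) \<Longrightarrow> h \<in> spH D k j \<Longrightarrow> lin_on (spA D j i) (dual (spB D l k)) (\<lambda>a. theta D l k j i \<chi> a h)"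
    and "a \<in> spA D j i \<Longrightarrow> h \<in> spH D k j \<Longrightarrow> lin_on (dual (spH D l i)) (dual (spB D l k)) (\<lambda>\<chi>. theta D l k j i \<chi> a h)"
proof -
  have bH: "bilin_on (spH D k j) (spA D j i) (spH D k i) (cHA D k j i)" using idx by (intro bHA) auto
  have b: "bilin_on (dual (spH D l i)) (spH D k i) (dual (spB D l k)) (\<lambda>\<chi> h. res (spB D l k) (\<lambda>b. \<chi> (cBH D l k i b h)))"
    using idx by (intro dual_comp_bilin bBH sub_B) auto
  show "\<chi> \<in> dual (spH D l i) \<Longrightarrow> a \<in> spA D j i \<Longrightarrow> lin_on (spH D k j) (dual (spB D l k)) (theta D l k j i \<chi> a)"
    unfolding theta_def[abs_def] by (rule lin_on_compose[OF bilin_left[OF bH] bilin_right[OF b]])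
  show "\<chi> \<in> dual (spH D l i) \<Longrightarrow> h \<in> spH D k j \<Longrightarrow> lin_on (spA D j i) (dual (spB D l k)) (\<lambda>a. theta D l k j i \<chi> a h)"
    unfolding theta_def by (rule lin_on_compose[OF bilin_right[OF bH] bilin_right[OF b]])
  show "a \<in> spA D j i \<Longrightarrow> h \<in> spH D k j \<Longrightarrow> lin_on (dual (spH D l i)) (dual (spB D l k)) (\<lambda>\<chi>. theta D l k j i \<chi> a h)"
    unfolding theta_def by (rule bilin_left[OF b bilin_mem[OF bH]])
qed

lemma inner_bilin:
  assumes idx: "1 \<le> i" "i \<le> j" "j \<le> nr D" "1 \<le> k" "k \<le> l" "l \<le> ns D"
  shows "\<chi> \<in> dual (spH D l i) \<Longrightarrow> a \<in> spA D j i \<Longrightarrow> bilin_on (spN D k) (spH D k j) (tensor (spN D k) (dual (spB D l k)))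
      (\<lambda>n h. pure_tensor (spN D k) (dual (spB D l k)) n (theta D l k j i \<chi> a h))"
    and "\<chi> \<in> dual (spH D l i) \<Longrightarrow> bilin_on (spA D j i) (tensor (spN D k) (spH D k j))
      (tensor (spN D k) (dual (spB D l k))) (inner D l k j i \<chi>)"
    and "a \<in> spA D j i \<Longrightarrow> bilin_on (dual (spH D l i)) (tensor (spN D k) (spH D k j))
      (tensor (spN D k) (dual (spB D l k))) (\<lambda>\<chi>. inner D l k j i \<chi> a)"
proof -
  have sN: "csubspace (spN D k)" and sH: "csubspace (spH D k j)" and sA: "csubspace (spA D j i)"
    using idx by (auto intro!: sub_N sub_H sub_A)
  note t = theta_lin[OF idx]
  show b: "bilin_on (spN D k) (spH D k j) (tensor (spN D k) (dual (spB D l k)))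
      (\<lambda>n h. pure_tensor (spN D k) (dual (spB D l k)) n (theta D l k j i \<chi> a h))"
    if "\<chi> \<in> dual (spH D l i)" "a \<in> spA D j i" for \<chi> a
    by (rule bilin_compose[where f="\<lambda>n. n" and h="\<lambda>t. t", OF lin_on_id bilin_pure t(1)[OF that] lin_on_id])
  show "bilin_on (spA D j i) (tensor (spN D k) (spH D k j))
      (tensor (spN D k) (dual (spB D l k))) (inner D l k j i \<chi>)" if \<chi>: "\<chi> \<in> dual (spH D l i)" for \<chi>
    unfolding inner_def
    by (rule bilin_tensor_lift_param[OF sN sH csubspace_tensor sA b[OF \<chi>]])
      (auto intro: lin_on_compose[OF t(2)[OF \<chi>] bilin_right[OF bilin_pure]])
  show "bilin_on (dual (spH D l i)) (tensor (spN D k) (spH D k j))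
      (tensor (spN D k) (dual (spB D l k))) (\<lambda>\<chi>. inner D l k j i \<chi> a)" if a: "a \<in> spA D j i" for a
    unfolding inner_def
    by (rule bilin_tensor_lift_param[OF sN sH csubspace_tensor csubspace_dual b[OF _ a]])
      (auto intro: lin_on_compose[OF t(3)[OF a] bilin_right[OF bilin_pure]])
qed

lemma smallW_Hom:
  "\<phi> \<in> smallW D \<Longrightarrow> 1 \<le> k \<Longrightarrow> k \<le> ns D \<Longrightarrow> 1 \<le> j \<Longrightarrow> j \<le> nr D \<Longrightarrow>
    \<phi> k j \<in> Hom (spM D j) (tensor (spN D k) (spH D k j))"
  by (auto simp: smallW_def dsum_def)

lemma gam_bilin_aux:
  assumes idx: "1 \<le> i" "i \<le> j" "j \<le> nr D" "1 \<le> k" "k \<le> l" "l \<le> ns D" and \<phi>: "\<phi> \<in> smallW D"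
  shows "\<chi> \<in> dual (spH D l i) \<Longrightarrow> bilin_on (spM D j) (spA D j i) (tensor (spN D k) (dual (spB D l k)))
      (\<lambda>\<mu> a. inner D l k j i \<chi> a (\<phi> k j \<mu>))"
    and "bilin_on (dual (spH D l i)) (tensor (spM D j) (spA D j i)) (tensor (spN D k) (dual (spB D l k)))
      (\<lambda>\<chi>. tensor_lift (spM D j) (spA D j i) (\<lambda>\<mu> a. inner D l k j i \<chi> a (\<phi> k j \<mu>)))"
proof -
  have f: "lin_on (spM D j) (tensor (spN D k) (spH D k j)) (\<phi> k j)"
    using idx by (intro Hom_lin smallW_Hom[OF \<phi>]) auto
  show b: "bilin_on (spM D j) (spA D j i) (tensor (spN D k) (dual (spB D l k)))
      (\<lambda>\<mu> a. inner D l k j i \<chi> a (\<phi> k j \<mu>))" if \<chi>: "\<chi> \<in> dual (spH D l i)" for \<chi>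
    unfolding bilin_on_def
    using lin_on_compose[OF f bilin_right[OF inner_bilin(2)[OF idx \<chi>]]]
      bilin_left[OF inner_bilin(2)[OF idx \<chi>]] lin_on_mem[OF f] by blast
  have sM: "csubspace (spM D j)" and sA: "csubspace (spA D j i)" using idx by (auto intro!: sub_M sub_A)
  show "bilin_on (dual (spH D l i)) (tensor (spM D j) (spA D j i)) (tensor (spN D k) (dual (spB D l k)))
      (\<lambda>\<chi>. tensor_lift (spM D j) (spA D j i) (\<lambda>\<mu> a. inner D l k j i \<chi> a (\<phi> k j \<mu>)))"
    by (rule bilin_tensor_lift_param[OF sM sA csubspace_tensor csubspace_dual b])
      (use bilin_left[OF inner_bilin(3)[OF idx]] lin_on_mem[OF f] in auto)
qed

lemma gam_bilin:
  assumes idx: "1 \<le> i" "i \<le> nr D" "1 \<le> l" "l \<le> ns D" and \<phi>: "\<phi> \<in> smallW D"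
  shows "bilin_on (spP D i) (dual (spH D l i)) (spQ D l) (gam D \<phi> l i)"
proof -
  let ?T = "\<lambda>k. tensor (spN D k) (dual (spB D l k))"
  let ?g = "\<lambda>k p \<chi>. \<Sum>j = i..nr D. tensor_lift (spM D j) (spA D j i) (\<lambda>\<mu> a. inner D l k j i \<chi> a (\<phi> k j \<mu>)) (p j)"
  have pj: "p j \<in> tensor (spM D j) (spA D j i)" if "p \<in> spP D i" "j \<in> {i..nr D}" for p j
    using that by (auto simp: spP_def dsum_def)
  have bl: "lin_on (spP D i) (?T k) (\<lambda>p. ?g k p \<chi>)" if k: "k \<in> {1..l}" and \<chi>: "\<chi> \<in> dual (spH D l i)" for k \<chi>
  proof (rule lin_on_sum_map[OF csubspace_tensor])
    fix j assume j: "j \<in> {i..nr D}"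
    have p: "lin_on (spP D i) (tensor (spM D j) (spA D j i)) (\<lambda>p. p j)"
      using pj[OF _ j] by (simp add: lin_on_def scaleC_fun_def)
    have "bilin_on (dual (spH D l i)) (tensor (spM D j) (spA D j i)) (?T k)
      (\<lambda>\<chi>. tensor_lift (spM D j) (spA D j i) (\<lambda>\<mu> a. inner D l k j i \<chi> a (\<phi> k j \<mu>)))"
      using idx k j by (intro gam_bilin_aux(2) \<phi>) auto
    then show "lin_on (spP D i) (?T k) (\<lambda>p. tensor_lift (spM D j) (spA D j i) (\<lambda>\<mu> a. inner D l k j i \<chi> a (\<phi> k j \<mu>)) (p j))"
      by (rule lin_on_compose[OF p bilin_right[OF _ \<chi>]])
  qed
  have br: "lin_on (dual (spH D l i)) (?T k) (\<lambda>\<chi>. ?g k p \<chi>)" if k: "k \<in> {1..l}" and p: "p \<in> spP D i" for k p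
  proof (rule lin_on_sum_map[OF csubspace_tensor])
    fix j assume j: "j \<in> {i..nr D}"
    have "bilin_on (dual (spH D l i)) (tensor (spM D j) (spA D j i)) (?T k)
      (\<lambda>\<chi>. tensor_lift (spM D j) (spA D j i) (\<lambda>\<mu> a. inner D l k j i \<chi> a (\<phi> k j \<mu>)))"
      using idx k j by (intro gam_bilin_aux(2) \<phi>) auto
    then show "lin_on (dual (spH D l i)) (?T k) (\<lambda>\<chi>. tensor_lift (spM D j) (spA D j i) (\<lambda>\<mu> a. inner D l k j i \<chi> a (\<phi> k j \<mu>)) (p j))"
      by (rule bilin_left[OF _ pj[OF p j]])
  qed
  have mem: "gam D \<phi> l i p \<chi> \<in> spQ D l" if "p \<in> spP D i" "\<chi> \<in> dual (spH D l i)" for p \<chi>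
    using lin_on_mem[OF bl[OF _ that(2)] that(1)] by (simp add: gam_def spQ_def dsum_def res_def)
  have g: "gam D \<phi> l i p \<chi> = res {1..l} (\<lambda>k. ?g k p \<chi>)" for p \<chi> by (simp add: gam_def)
  show ?thesis
    unfolding bilin_on_def
  proof (intro conjI ballI lin_onI)
    show "gam D \<phi> l i (p + q) \<chi> = gam D \<phi> l i p \<chi> + gam D \<phi> l i q \<chi>"
      if "p \<in> spP D i" "q \<in> spP D i" "\<chi> \<in> dual (spH D l i)" for p q \<chi>
      unfolding g res_add[symmetric] by (rule res_cong, rule lin_on_add[OF bl]) (use that in auto)
    show "gam D \<phi> l i (c *\<^sub>C p) \<chi> = c *\<^sub>C gam D \<phi> l i p \<chi>"
      if "p \<in> spP D i" "\<chi> \<in> dual (spH D l i)" for p c \<chi>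
      unfolding g res_scale[symmetric] by (rule res_cong, rule lin_on_scale[OF bl]) (use that in auto)
    show "gam D \<phi> l i p (\<chi> + \<eta>) = gam D \<phi> l i p \<chi> + gam D \<phi> l i p \<eta>"
      if "p \<in> spP D i" "\<chi> \<in> dual (spH D l i)" "\<eta> \<in> dual (spH D l i)" for p \<chi> \<eta>
      unfolding g res_add[symmetric] by (rule res_cong, rule lin_on_add[OF br]) (use that in auto)
    show "gam D \<phi> l i p (c *\<^sub>C \<chi>) = c *\<^sub>C gam D \<phi> l i p \<chi>"
      if "p \<in> spP D i" "\<chi> \<in> dual (spH D l i)" for p c \<chi>
      unfolding g res_scale[symmetric] by (rule res_cong, rule lin_on_scale[OF br]) (use that in auto)
  qed (rule mem; assumption)+
qed

text \<open>The transposed form of \<open>BBH_assoc\<close>: contracting the resulting functional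
  with \<open>b\<close> amounts to moving \<open>b\<close> into \<chi>.\<close>

lemma theta_dHB:
  assumes idx: "1 \<le> i" "i \<le> j" "j \<le> nr D" "1 \<le> k" "k \<le> l" "l < ns D"
    and b: "b \<in> spB D (Suc l) l" and a: "a \<in> spA D j i" and h: "h \<in> spH D k j"
  shows "dBB D (Suc l) l k (theta D (Suc l) k j i \<chi> a h) b = theta D l k j i (dHB D (Suc l) l i \<chi> b) a h"
proof -
  have ha: "cHA D k j i h a \<in> spH D k i" using idx a h by (intro bilin_mem[OF bHA]) auto
  have 1: "cBB D (Suc l) l k b b' \<in> spB D (Suc l) k" if "b' \<in> spB D l k" for b'
    using idx b that by (intro bilin_mem[OF bBB]) auto
  have 2: "cBH D l k i b' (cHA D k j i h a) \<in> spH D l i" if "b' \<in> spB D l k" for b'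
    using idx ha that by (intro bilin_mem[OF bBH]) auto
  have 3: "cBH D (Suc l) k i (cBB D (Suc l) l k b b') (cHA D k j i h a) =
      cBH D (Suc l) l i b (cBH D l k i b' (cHA D k j i h a))" if "b' \<in> spB D l k" for b'
    using idx b ha that by (intro BBH_assoc) auto
  show ?thesis by (intro ext) (simp add: dBB_def theta_def dHB_def res_def 1 2 3)
qed

text \<open>Two associativity laws move \<open>a\<close> into \<chi>: \<open>HAA_assoc\<close>
  separates it from \<open>a'\<close>, and \<open>BHA_assoc\<close> takes it past the element of
  \<open>B\<close>.\<close>

lemma theta_dHA:
  assumes idx: "1 \<le> i" "i \<le> i'" "i' \<le> j" "j \<le> nr D" "1 \<le> k" "k \<le> l" "l \<le> ns D"
    and a: "a \<in> spA D i' i" and a': "a' \<in> spA D j i'" and h: "h \<in> spH D k j"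
  shows "theta D l k j i \<chi> (cAA D j i' i a' a) h = theta D l k j i' (dHA D l i' i \<chi> a) a' h"
proof -
  have ha: "cHA D k j i' h a' \<in> spH D k i'" using idx a' h by (intro bilin_mem[OF bHA]) auto
  have 1: "cHA D k j i h (cAA D j i' i a' a) = cHA D k i' i (cHA D k j i' h a') a"
    using idx a a' h by (intro HAA_assoc[symmetric]) auto
  have 2: "cBH D l k i' b (cHA D k j i' h a') \<in> spH D l i'" if "b \<in> spB D l k" for b
    using idx ha that by (intro bilin_mem[OF bBH]) auto
  have 3: "cBH D l k i b (cHA D k i' i (cHA D k j i' h a') a) = cHA D l i' i (cBH D l k i' b (cHA D k j i' h a')) a"
    if "b \<in> spB D l k" for b
    using idx a ha that by (intro BHA_assoc[symmetric]) auto
  show ?thesis by (intro ext) (simp add: theta_def dHA_def res_def 1 2 3)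
qed

text \<open>\<open>eta D l\<close> keeps only the summands \<open>k \<le> l\<close>, and there
  \<open>gam\<close> at \<open>Suc l\<close> and at \<open>l\<close> involve the same entries
  \<open>\<phi> k j\<close>. What remains is \<open>theta_dHB\<close> on pure tensors.\<close>

lemma gam_dHB:
  assumes idx: "1 \<le> i" "i \<le> nr D" "1 \<le> l" "l < ns D" and \<phi>: "\<phi> \<in> smallW D"
    and p: "p \<in> spP D i" and \<chi>: "\<chi> \<in> dual (spH D (Suc l) i)" and b: "b \<in> spB D (Suc l) l"
  shows "eta D l (gam D \<phi> (Suc l) i p \<chi>) b = gam D \<phi> l i p (dHB D (Suc l) l i \<chi> b)"
proof -
  have q: "gam D \<phi> (Suc l) i p \<chi> \<in> spQ D (Suc l)"
    using idx by (intro bilin_mem[OF gam_bilin p \<chi>] \<phi>) auto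
  have "id_tensor (spN D k) (dual (spB D (Suc l) k)) (dual (spB D l k)) (\<lambda>f. dBB D (Suc l) l k f b)
      (\<Sum>j = i..nr D. tensor_lift (spM D j) (spA D j i) (\<lambda>\<mu> a. inner D (Suc l) k j i \<chi> a (\<phi> k j \<mu>)) (p j))
    = (\<Sum>j = i..nr D. tensor_lift (spM D j) (spA D j i) (\<lambda>\<mu> a. inner D l k j i (dHB D (Suc l) l i \<chi> b) a (\<phi> k j \<mu>)) (p j))"
    if k: "k \<in> {1..l}" for k
  proof -
    let ?d = "\<lambda>f. dBB D (Suc l) l k f b"
    let ?L = "id_tensor (spN D k) (dual (spB D (Suc l) k)) (dual (spB D l k)) ?d"
    have k': "1 \<le> k" "k \<le> l" "k \<le> Suc l" "Suc l \<le> ns D" using k idx by auto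
    have sN: "csubspace (spN D k)" using k idx by (intro sub_N) auto
    have d: "lin_on (dual (spB D (Suc l) k)) (dual (spB D l k)) ?d"
      using k idx b by (intro bilin_left[OF dBB_bilin]) auto
    have L: "lin_on (tensor (spN D k) (dual (spB D (Suc l) k))) (tensor (spN D k) (dual (spB D l k))) ?L"
      by (rule id_tensor_lin(1)[OF sN csubspace_dual d])
    have pj: "p j \<in> tensor (spM D j) (spA D j i)" if "j \<in> {i..nr D}" for j
      using that p by (auto simp: spP_def dsum_def)
    have mem: "tensor_lift (spM D j) (spA D j i) (\<lambda>\<mu> a. inner D (Suc l) k j i \<chi> a (\<phi> k j \<mu>)) (p j)
        \<in> tensor (spN D k) (dual (spB D (Suc l) k))" if j: "j \<in> {i..nr D}" for j
      using idx k' j by (intro bilin_mem[OF gam_bilin_aux(2) \<chi> pj[OF j]] \<phi>) auto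
    have "?L (tensor_lift (spM D j) (spA D j i) (\<lambda>\<mu> a. inner D (Suc l) k j i \<chi> a (\<phi> k j \<mu>)) (p j))
      = tensor_lift (spM D j) (spA D j i) (\<lambda>\<mu> a. inner D l k j i (dHB D (Suc l) l i \<chi> b) a (\<phi> k j \<mu>)) (p j)"
      if j: "j \<in> {i..nr D}" for j
    proof -
      have j': "i \<le> j" "j \<le> nr D" "1 \<le> j" using j idx by auto
      have sM: "csubspace (spM D j)" and sA: "csubspace (spA D j i)" and sH: "csubspace (spH D k j)"
        using idx j' k' by (auto intro!: sub_M sub_A sub_H)
      have "?L (inner D (Suc l) k j i \<chi> a t) = inner D l k j i (dHB D (Suc l) l i \<chi> b) a t"
        if a: "a \<in> spA D j i" and t: "t \<in> tensor (spN D k) (spH D k j)" for a t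
      proof -
        have ib: "bilin_on (spN D k) (spH D k j) (tensor (spN D k) (dual (spB D (Suc l) k)))
          (\<lambda>n h. pure_tensor (spN D k) (dual (spB D (Suc l) k)) n (theta D (Suc l) k j i \<chi> a h))"
          by (rule inner_bilin(1)[OF idx(1) j'(1,2) k'(1,3,4) \<chi> a])
        have "?L (inner D (Suc l) k j i \<chi> a t) = tensor_lift (spN D k) (spH D k j)
          (\<lambda>n h. ?L (pure_tensor (spN D k) (dual (spB D (Suc l) k)) n (theta D (Suc l) k j i \<chi> a h))) t"
          unfolding inner_def by (rule tensor_lift_postcompose[OF sN sH csubspace_tensor ib L t])
        also have "\<dots> = inner D l k j i (dHB D (Suc l) l i \<chi> b) a t"
          unfolding inner_def
        proof (rule fun_cong[OF tensor_lift_cong])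
          fix n h assume nh: "n \<in> spN D k" "h \<in> spH D k j"
          have th: "theta D (Suc l) k j i \<chi> a h \<in> dual (spB D (Suc l) k)"
            by (rule lin_on_mem[OF theta_lin(1)[OF idx(1) j'(1,2) k'(1,3,4) \<chi> a] nh(2)])
          show "?L (pure_tensor (spN D k) (dual (spB D (Suc l) k)) n (theta D (Suc l) k j i \<chi> a h))
            = pure_tensor (spN D k) (dual (spB D l k)) n (theta D l k j i (dHB D (Suc l) l i \<chi> b) a h)"
            unfolding id_tensor_lin(2)[OF sN csubspace_dual d nh(1) th]
            using theta_dHB[OF idx(1) j'(1,2) k'(1,2) idx(4) b a nh(2)] by simp
        qed
        finally show ?thesis .
      qed
      moreover have "\<phi> k j \<mu> \<in> tensor (spN D k) (spH D k j)" if "\<mu> \<in> spM D j" for \<mu>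
        using idx k' j' that by (intro Hom_mem[OF smallW_Hom[OF \<phi>]]) auto
      moreover have "?L (tensor_lift (spM D j) (spA D j i) (\<lambda>\<mu> a. inner D (Suc l) k j i \<chi> a (\<phi> k j \<mu>)) (p j))
        = tensor_lift (spM D j) (spA D j i) (\<lambda>\<mu> a. ?L (inner D (Suc l) k j i \<chi> a (\<phi> k j \<mu>))) (p j)"
        by (rule tensor_lift_postcompose[OF sM sA csubspace_tensor
              gam_bilin_aux(1)[OF idx(1) j'(1,2) k'(1,3,4) \<phi> \<chi>] L pj[OF j]])
      ultimately show ?thesis by (simp cong: tensor_lift_cong)
    qed
    then show ?thesis by (subst lin_on_sum[OF csubspace_tensor L mem]) simp_all
  qed
  then show ?thesis using q b by (intro ext) (simp add: eta_def res_def, simp add: gam_def res_def)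
qed

lemma gam_dHA:
  assumes idx: "1 \<le> i" "i < nr D" "1 \<le> l" "l \<le> ns D" and \<phi>: "\<phi> \<in> smallW D"
    and p: "p \<in> spP D (Suc i)" and \<chi>: "\<chi> \<in> dual (spH D l i)" and a: "a \<in> spA D (Suc i) i"
  shows "xi D (Suc i) p a \<in> spP D i"
    and "gam D \<phi> l i (xi D (Suc i) p a) \<chi> = gam D \<phi> l (Suc i) p (dHA D l (Suc i) i \<chi> a)"
proof -
  let ?d = "\<lambda>j a'. cAA D j (Suc i) i a' a"
  let ?L = "\<lambda>j. id_tensor (spM D j) (spA D j (Suc i)) (spA D j i) (?d j)"
  have x: "xi D (Suc i) p a = res {Suc i..nr D} (\<lambda>j. ?L j (p j))" using p a by (simp add: xi_def res_def)
  have pj: "p j \<in> tensor (spM D j) (spA D j (Suc i))" if "j \<in> {Suc i..nr D}" for j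
    using that p by (auto simp: spP_def dsum_def)
  have d: "lin_on (spA D j (Suc i)) (spA D j i) (?d j)" if "j \<in> {Suc i..nr D}" for j
    using that idx a by (intro bilin_left[OF bAA]) auto
  have sM: "csubspace (spM D j)" and sA: "csubspace (spA D j (Suc i))" and sA': "csubspace (spA D j i)"
    if "j \<in> {Suc i..nr D}" for j
    using that idx by (auto intro!: sub_M sub_A)
  have Lp: "?L j (p j) \<in> tensor (spM D j) (spA D j i)" if "j \<in> {Suc i..nr D}" for j
    using lin_on_mem[OF id_tensor_lin(1)[OF sM sA d] pj] that by auto
  then show "xi D (Suc i) p a \<in> spP D i"
    unfolding x using complex_vector.subspace_0[OF csubspace_tensor]
    by (auto simp: spP_def dsum_def res_def)
  have "(\<Sum>j = i..nr D. tensor_lift (spM D j) (spA D j i) (\<lambda>\<mu> a. inner D l k j i \<chi> a (\<phi> k j \<mu>)) (xi D (Suc i) p a j))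
    = (\<Sum>j = Suc i..nr D. tensor_lift (spM D j) (spA D j (Suc i))
        (\<lambda>\<mu> a'. inner D l k j (Suc i) (dHA D l (Suc i) i \<chi> a) a' (\<phi> k j \<mu>)) (p j))" (is "?l = _")
    if k: "k \<in> {1..l}" for k
  proof -
    have "?l = (\<Sum>j = Suc i..nr D. tensor_lift (spM D j) (spA D j i) (\<lambda>\<mu> a. inner D l k j i \<chi> a (\<phi> k j \<mu>)) (?L j (p j)))"
    \<comment> \<open>Nothing of \<open>xi D (Suc i) p a\<close> lies in the summand of
      \<open>M\<^sub>i\<close>, so the sum effectively starts at \<open>Suc i\<close>.\<close>
    proof (rule sum.mono_neutral_cong_right)
      show "\<forall>j\<in>{i..nr D} - {Suc i..nr D}. tensor_lift (spM D j) (spA D j i) (\<lambda>\<mu> a. inner D l k j i \<chi> a (\<phi> k j \<mu>)) (xi D (Suc i) p a j) = 0"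
        unfolding x by (auto simp: res_def tensor_lift_def)
    qed (auto simp: x res_def)
    also have "\<dots> = (\<Sum>j = Suc i..nr D. tensor_lift (spM D j) (spA D j (Suc i))
        (\<lambda>\<mu> a'. inner D l k j (Suc i) (dHA D l (Suc i) i \<chi> a) a' (\<phi> k j \<mu>)) (p j))"
    proof (rule sum.cong[OF refl])
      fix j assume j: "j \<in> {Suc i..nr D}"
      then have j': "i \<le> j" "j \<le> nr D" "1 \<le> j" "Suc i \<le> j" using idx by auto
      have k': "1 \<le> k" "k \<le> l" "k \<le> ns D" using k idx by auto
      have "tensor_lift (spM D j) (spA D j i) (\<lambda>\<mu> a. inner D l k j i \<chi> a (\<phi> k j \<mu>)) (?L j (p j))
        = tensor_lift (spM D j) (spA D j (Suc i)) (\<lambda>\<mu> a'. inner D l k j i \<chi> (?d j a') (\<phi> k j \<mu>)) (p j)"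
        by (rule id_tensor_tensor_lift[OF sM[OF j] sA[OF j] sA'[OF j] d[OF j]
              gam_bilin_aux(1)[OF idx(1) j'(1,2) k'(1,2) idx(4) \<phi> \<chi>] csubspace_tensor pj[OF j]])
      also have "\<dots> = tensor_lift (spM D j) (spA D j (Suc i))
        (\<lambda>\<mu> a'. inner D l k j (Suc i) (dHA D l (Suc i) i \<chi> a) a' (\<phi> k j \<mu>)) (p j)"
      proof (rule fun_cong[OF tensor_lift_cong])
        fix \<mu> a' assume a': "a' \<in> spA D j (Suc i)"
        show "inner D l k j i \<chi> (?d j a') (\<phi> k j \<mu>) = inner D l k j (Suc i) (dHA D l (Suc i) i \<chi> a) a' (\<phi> k j \<mu>)"
          unfolding inner_def
          by (rule fun_cong[OF tensor_lift_cong])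
            (use theta_dHA[OF idx(1) _ j'(4,2) k'(1,2) idx(4) a a'] in simp)
      qed
      finally show "tensor_lift (spM D j) (spA D j i) (\<lambda>\<mu> a. inner D l k j i \<chi> a (\<phi> k j \<mu>)) (?L j (p j))
        = tensor_lift (spM D j) (spA D j (Suc i))
        (\<lambda>\<mu> a'. inner D l k j (Suc i) (dHA D l (Suc i) i \<chi> a) a' (\<phi> k j \<mu>)) (p j)" .
    qed
    finally show ?thesis .
  qed
  then show "gam D \<phi> l i (xi D (Suc i) p a) \<chi> = gam D \<phi> l (Suc i) p (dHA D l (Suc i) i \<chi> a)"
    by (intro ext) (simp add: gam_def res_def)
qed

end

section \<open>The image of \<open>\<zeta>\<close>\<close>

lemma id_tensor_param:
  assumes "csubspace U" "csubspace V" "csubspace C" "bilin_on C V W f"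
  shows "bilin_on C (tensor U V) (tensor U W) (\<lambda>c. id_tensor U V W (f c))"
  unfolding id_tensor_def
  by (rule bilin_tensor_lift_param[OF assms(1,2) csubspace_tensor assms(3)
        bilin_compose[where f="\<lambda>u. u" and h="\<lambda>t. t", OF lin_on_id bilin_pure bilin_right[OF assms(4)] lin_on_id]])
    (auto intro: lin_on_compose[OF bilin_left[OF assms(4)] bilin_right[OF bilin_pure]])

lemma bilin_dsum_res:
  assumes "\<And>i. i \<in> I \<Longrightarrow> bilin_on U V (X i) (\<beta> i)"
  shows "bilin_on U V (dsum I X) (\<lambda>u v. res I (\<lambda>i. \<beta> i u v))"
  unfolding bilin_on_def
proof (intro conjI ballI lin_onI)
  show "res I (\<lambda>i. \<beta> i (u + u') v) = res I (\<lambda>i. \<beta> i u v) + res I (\<lambda>i. \<beta> i u' v)"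
    if "v \<in> V" "u \<in> U" "u' \<in> U" for u u' v
    unfolding res_add[symmetric] by (rule res_cong, rule lin_on_add[OF bilin_left[OF assms]]) (use that in auto)
  show "res I (\<lambda>i. \<beta> i (c *\<^sub>C u) v) = c *\<^sub>C res I (\<lambda>i. \<beta> i u v)"
    if "v \<in> V" "u \<in> U" for c u v
    unfolding res_scale[symmetric] by (rule res_cong, rule lin_on_scale[OF bilin_left[OF assms]]) (use that in auto)
  show "res I (\<lambda>i. \<beta> i u (v + v')) = res I (\<lambda>i. \<beta> i u v) + res I (\<lambda>i. \<beta> i u v')"
    if "u \<in> U" "v \<in> V" "v' \<in> V" for u v v'
    unfolding res_add[symmetric] by (rule res_cong, rule lin_on_add[OF bilin_right[OF assms]]) (use that in auto)
  show "res I (\<lambda>i. \<beta> i u (c *\<^sub>C v)) = c *\<^sub>C res I (\<lambda>i. \<beta> i u v)"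
    if "u \<in> U" "v \<in> V" for c u v
    unfolding res_scale[symmetric] by (rule res_cong, rule lin_on_scale[OF bilin_right[OF assms]]) (use that in auto)
qed (use bilin_mem[OF assms] in \<open>auto simp: dsum_def res_def\<close>)

lemma res_dsum: "(\<And>i. i \<in> I \<Longrightarrow> f i \<in> X i) \<Longrightarrow> res I f \<in> dsum I X"
  by (simp add: dsum_def res_def)

lemma dsum_component: "i \<in> I \<Longrightarrow> lin_on (dsum I X) (X i) (\<lambda>f. f i)"
  by (simp add: lin_on_def dsum_def scaleC_fun_def)

lemma bilin_on_cong:
  assumes "csubspace U" "csubspace V" "\<And>u v. u \<in> U \<Longrightarrow> v \<in> V \<Longrightarrow> \<beta> u v = \<beta>' u v"
  shows "bilin_on U V X \<beta> \<longleftrightarrow> bilin_on U V X \<beta>'"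
proof -
  have "lin_on U X (\<lambda>u. \<beta> u v) \<longleftrightarrow> lin_on U X (\<lambda>u. \<beta>' u v)" if "v \<in> V" for v
    using assms(3)[OF _ that] by (rule lin_on_cong[OF assms(1)])
  moreover have "lin_on V X (\<beta> u) \<longleftrightarrow> lin_on V X (\<beta>' u)" if "u \<in> U" for u
    using assms(3)[OF that] by (rule lin_on_cong[OF assms(2)])
  ultimately show ?thesis by (simp add: bilin_on_def)
qed

text \<open>
  A common factorisation of all composites of the maps of a point of \<open>\<^bold>W\<close> (for \<open>r = 2\<close>) through
  the compositions: \<open>\<Psi> l i\<close> is the map \<open>P\<^sub>i \<otimes> H\<^sub>l\<^sub>i\<^sup>* \<rightarrow> Q\<^sub>l\<close>.
\<close>

definition factors :: "('a::complex_vector, 'b::complex_vector, 'h::complex_vector, 'm::complex_vector,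
    'n::complex_vector) comp_system \<Rightarrow> (nat \<Rightarrow> ('m, 'a) Pvec \<Rightarrow> 'a \<Rightarrow> ('m, 'a) Pvec) \<Rightarrow>
    (('m, 'a) Pvec \<Rightarrow> ('h \<Rightarrow> complex) \<Rightarrow> ('n, 'b) Qvec) \<Rightarrow>
    (nat \<Rightarrow> ('n, 'b) Qvec \<Rightarrow> 'b \<Rightarrow> ('n, 'b) Qvec) \<Rightarrow>
    (nat \<Rightarrow> nat \<Rightarrow> ('m, 'a) Pvec \<Rightarrow> ('h \<Rightarrow> complex) \<Rightarrow> ('n, 'b) Qvec) \<Rightarrow> bool" where
  "factors D x \<psi> y \<Psi> \<longleftrightarrow>
     (\<forall>l\<in>{1..ns D}. \<forall>i\<in>{1,2}. bilin_on (spP D i) (dual (spH D l i)) (spQ D l) (\<Psi> l i)) \<and>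
     (\<forall>p\<in>spP D 1. \<forall>\<chi>\<in>dual (spH D (ns D) 1). \<psi> p \<chi> = \<Psi> (ns D) 1 p \<chi>) \<and>
     (\<forall>l\<in>{1..ns D}. \<forall>p\<in>spP D 2. \<forall>\<chi>\<in>dual (spH D l 1). \<forall>a\<in>spA D 2 1.
        \<Psi> l 1 (x 2 p a) \<chi> = \<Psi> l 2 p (dHA D l 2 1 \<chi> a)) \<and>
     (\<forall>l\<in>{1..<ns D}. \<forall>i\<in>{1,2}. \<forall>p\<in>spP D i. \<forall>\<chi>\<in>dual (spH D (Suc l) i). \<forall>b\<in>spB D (Suc l) l.
        y l (\<Psi> (Suc l) i p \<chi>) b = \<Psi> l i p (dHB D (Suc l) l i \<chi> b))"

lemma factors_bilin: "factors D x \<psi> y \<Psi> \<Longrightarrow> l \<in> {1..ns D} \<Longrightarrow> i \<in> {1,2} \<Longrightarrow>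
    bilin_on (spP D i) (dual (spH D l i)) (spQ D l) (\<Psi> l i)"
  and factors_psi: "factors D x \<psi> y \<Psi> \<Longrightarrow> p \<in> spP D 1 \<Longrightarrow> \<chi> \<in> dual (spH D (ns D) 1) \<Longrightarrow>
    \<psi> p \<chi> = \<Psi> (ns D) 1 p \<chi>"
  and factors_x: "factors D x \<psi> y \<Psi> \<Longrightarrow> l \<in> {1..ns D} \<Longrightarrow> p \<in> spP D 2 \<Longrightarrow> \<chi> \<in> dual (spH D l 1) \<Longrightarrow>
    a \<in> spA D 2 1 \<Longrightarrow> \<Psi> l 1 (x 2 p a) \<chi> = \<Psi> l 2 p (dHA D l 2 1 \<chi> a)"
  and factors_y: "factors D x \<psi> y \<Psi> \<Longrightarrow> l \<in> {1..<ns D} \<Longrightarrow> i \<in> {1,2} \<Longrightarrow> p \<in> spP D i \<Longrightarrow>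
    \<chi> \<in> dual (spH D (Suc l) i) \<Longrightarrow> b \<in> spB D (Suc l) l \<Longrightarrow>
    y l (\<Psi> (Suc l) i p \<chi>) b = \<Psi> l i p (dHB D (Suc l) l i \<chi> b)"
  unfolding factors_def by blast+

text \<open>The hypotheses intertwine the two points without mentioning inverses. The same statement
  therefore goes from \<open>zeta\<close> to its translates, with inverses in the place of
  \<open>g\<close>, and back, with inverses in the place of \<open>h\<close>.\<close>

lemma factors_transport:
  assumes f: "factors D x \<psi> y \<Psi>"
    and g: "\<And>i. i \<in> {1,2} \<Longrightarrow> lin_on (spP D i) (spP D i) (g i)"
    and h: "\<And>l. l \<in> {1..ns D} \<Longrightarrow> lin_on (spQ D l) (spQ D l) (h l)"
    and x': "\<And>p a. p \<in> spP D 2 \<Longrightarrow> a \<in> spA D 2 1 \<Longrightarrow> g 1 (x' 2 p a) = x 2 (g 2 p) a"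
    and \<psi>': "\<And>p \<chi>. p \<in> spP D 1 \<Longrightarrow> \<chi> \<in> dual (spH D (ns D) 1) \<Longrightarrow> \<psi>' p \<chi> = h (ns D) (\<psi> (g 1 p) \<chi>)"
    and y': "\<And>l q b. l \<in> {1..<ns D} \<Longrightarrow> q \<in> spQ D (Suc l) \<Longrightarrow> b \<in> spB D (Suc l) l \<Longrightarrow>
      y' l (h (Suc l) q) b = h l (y l q b)"
  shows "factors D x' \<psi>' y' (\<lambda>l i p \<chi>. h l (\<Psi> l i (g i p) \<chi>))"
  unfolding factors_def
proof (intro conjI ballI)
  show "bilin_on (spP D i) (dual (spH D l i)) (spQ D l) (\<lambda>p \<chi>. h l (\<Psi> l i (g i p) \<chi>))"
    if "l \<in> {1..ns D}" "i \<in> {1,2}" for l i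
    by (rule bilin_compose[where g="\<lambda>\<chi>. \<chi>", OF g[OF that(2)] factors_bilin[OF f that] lin_on_id h[OF that(1)]])
  show "\<psi>' p \<chi> = h (ns D) (\<Psi> (ns D) 1 (g 1 p) \<chi>)" if "p \<in> spP D 1" "\<chi> \<in> dual (spH D (ns D) 1)" for p \<chi>
    using \<psi>'[OF that] factors_psi[OF f lin_on_mem[OF g that(1)] that(2)] by simp
  show "h l (\<Psi> l 1 (g 1 (x' 2 p a)) \<chi>) = h l (\<Psi> l 2 (g 2 p) (dHA D l 2 1 \<chi> a))"
    if "l \<in> {1..ns D}" "p \<in> spP D 2" "\<chi> \<in> dual (spH D l 1)" "a \<in> spA D 2 1" for l p \<chi> a
    using factors_x[OF f that(1) lin_on_mem[OF g that(2)] that(3,4)] x'[OF that(2,4)] by simp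
  show "y' l (h (Suc l) (\<Psi> (Suc l) i (g i p) \<chi>)) b = h l (\<Psi> l i (g i p) (dHB D (Suc l) l i \<chi> b))"
    if l: "l \<in> {1..<ns D}" and i: "i \<in> {1,2}" and p: "p \<in> spP D i" and \<chi>: "\<chi> \<in> dual (spH D (Suc l) i)"
      and b: "b \<in> spB D (Suc l) l" for l i p \<chi> b
  proof -
    have gp: "g i p \<in> spP D i" by (rule lin_on_mem[OF g[OF i] p])
    have "\<Psi> (Suc l) i (g i p) \<chi> \<in> spQ D (Suc l)"
      using l by (intro bilin_mem[OF factors_bilin[OF f _ i] gp \<chi>]) auto
    then show ?thesis using y'[OF l _ b] factors_y[OF f l i gp \<chi> b] by simp
  qed
qed

section \<open>Tensor products with a line and dual bases\<close>

lemma line_tensor: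
  assumes M: "fin_dim M" and A: "A = range (\<lambda>z. z *\<^sub>C e)" and e: "e \<noteq> 0"
  obtains c where "lin_on (tensor M A) M c" "\<And>m. m \<in> M \<Longrightarrow> c (pure_tensor M A m e) = m"
    "\<And>t. t \<in> tensor M A \<Longrightarrow> pure_tensor M A (c t) e = t"
proof -
  have B: "cbasis {e} A" using e by (simp add: cbasis_def A complex_vector.span_singleton)
  obtain c where c: "\<And>b. b \<in> {e} \<Longrightarrow> lin_on (tensor M A) M (c b)"
    "\<And>b u v. b \<in> {e} \<Longrightarrow> u \<in> M \<Longrightarrow> v \<in> A \<Longrightarrow> c b (pure_tensor M A u v) = co {e} b v *\<^sub>C u"
    "\<And>t. t \<in> tensor M A \<Longrightarrow> t = (\<Sum>b\<in>{e}. pure_tensor M A (c b t) b)"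
    by (rule tensor_expand[OF M B], rule that)
  show ?thesis
  proof (rule that[of "c e"])
    show "c e (pure_tensor M A m e) = m" if "m \<in> M" for m
      using c(2)[of e m e] that cbasis_mem[OF B] co_basis[OF B, of e e] by (simp add: scaleC_one)
    show "pure_tensor M A (c e t) e = t" if "t \<in> tensor M A" for t using c(3)[OF that] by simp
  qed (rule c(1)[OF singletonI])
qed

definition dual_unit :: "'a::complex_vector set \<Rightarrow> 'a \<Rightarrow> 'a \<Rightarrow> complex" where
  "dual_unit A e = res A (co {e} e)"

lemma dual_line:
  assumes A: "A = range (\<lambda>z. z *\<^sub>C e)" and e: "e \<noteq> 0"
  shows "f \<in> dual A \<Longrightarrow> f = f e *\<^sub>C dual_unit A e"
    and "dual A = range (\<lambda>z. z *\<^sub>C dual_unit A e)" and "dual_unit A e \<noteq> 0"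
proof -
  have B: "cbasis {e} A" using e by (simp add: cbasis_def A complex_vector.span_singleton)
  have u: "dual_unit A e \<in> dual A"
    unfolding dual_unit_def dual_def by (rule res_Hom[OF cbasis_sub[OF B] co_lin[OF B]])
  show f: "f = f e *\<^sub>C dual_unit A e" if "f \<in> dual A" for f
  proof
    fix v show "f v = (f e *\<^sub>C dual_unit A e) v"
    proof (cases "v \<in> A")
      case True
      then show ?thesis
        using lin_on_co_expand[OF B dual_lin[OF that] True]
        by (simp add: dual_unit_def res_def scaleC_fun_def scaleC_complex_def)
    next
      case False
      then show ?thesis using that by (simp add: dual_unit_def res_def scaleC_fun_def scaleC_complex_def dual_def Hom_iff)
    qed
  qed
  show "dual A = range (\<lambda>z. z *\<^sub>C dual_unit A e)"
    using f u complex_vector.subspace_scale[OF csubspace_dual] by blast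
  have "dual_unit A e e = 1" using cbasis_mem[OF B] co_basis[OF B, of e e] by (simp add: dual_unit_def res_def)
  then show "dual_unit A e \<noteq> 0" by auto
qed

lemma dual_expand:
  assumes B: "cbasis B V" and F: "F \<in> dual V"
  shows "F = (\<Sum>b\<in>B. F b *\<^sub>C res V (co B b))"
proof
  fix v show "F v = (\<Sum>b\<in>B. F b *\<^sub>C res V (co B b)) v"
    using lin_on_co_expand[OF B dual_lin[OF F], of v] F
    by (cases "v \<in> V") (auto simp: sum_fun_apply scaleC_fun_def res_def scaleC_complex_def mult.commute dual_def Hom_iff)
qed

text \<open>Spanning comes from \<open>dual_expand\<close>; independence then follows from the known
  dimension of the dual.\<close>

lemma dual_cbasis:
  assumes B: "cbasis B V"
  shows "cbasis ((\<lambda>b. res V (co B b)) ` B) (dual V)" "inj_on (\<lambda>b. res V (co B b)) B"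
proof -
  let ?f = "\<lambda>b. res V (co B b)"
  have f: "?f b \<in> dual V" for b
    unfolding dual_def by (rule res_Hom[OF cbasis_sub[OF B] co_lin[OF B]])
  have fb: "?f b b' = (if b = b' then 1 else 0)" if "b' \<in> B" for b b'
    using cbasis_mem[OF B that] co_basis[OF B that] by (simp add: res_def)
  show "inj_on ?f B" by (rule inj_onI) (metis fb zero_neq_one)
  have "F \<in> cspan (?f ` B)" if F: "F \<in> dual V" for F
  proof -
    have "F = (\<Sum>b\<in>B. F b *\<^sub>C ?f b)" by (rule dual_expand[OF B F])
    also have "\<dots> \<in> cspan (?f ` B)"
      by (intro complex_vector.span_sum complex_vector.span_scale complex_vector.span_base) auto
    finally show ?thesis .
  qed
  moreover have "cspan (?f ` B) \<subseteq> dual V" using f csubspace_dual by (intro complex_vector.span_minimal) auto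
  ultimately have "cspan (?f ` B) = dual V" by blast
  then show "cbasis (?f ` B) (dual V)"
    using cbasis_finite[OF B] card_image_le[of B ?f] cdim_dual[OF cbasis_fin_dim[OF B]] cbasis_card[OF B]
    by (intro spanning_card_cbasis) auto
qed

text \<open>Both cases of the theorem at once: for \<open>ns D = 1\<close> there is no map
  \<open>y\<close>, and every statement over \<open>{1..<ns D}\<close> is vacuous.\<close>

locale two_step = composition_system D
  for D :: "('a::complex_vector, 'b::complex_vector, 'h::complex_vector, 'm::complex_vector,
    'n::complex_vector) comp_system" +
  assumes r2: "nr D = 2" and s12: "ns D = 1 \<or> ns D = 2"
begin

section \<open>Dimensions of the spaces P and Q, and points of Z, for r = 2\<close>

lemma fin_P: "i \<in> {1,2} \<Longrightarrow> fin_dim (spP D i)"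
  and dim_P1: "cdim (spP D 1) = cdim (spM D 1) * cdim (spA D 1 1) + cdim (spM D 2) * cdim (spA D 2 1)"
  and dim_P2: "cdim (spP D 2) = cdim (spM D 2) * cdim (spA D 2 2)"
proof -
  have *: "fin_dim (spP D i) \<and> cdim (spP D i) = (\<Sum>j\<in>{i..2}. cdim (tensor (spM D j) (spA D j i)))" if "i \<in> {1,2}" for i
    unfolding spP_def r2 using that r2 by (intro dsum_fin_dim fin_dim_tensor fin_M fin_A) auto
  then show "i \<in> {1,2} \<Longrightarrow> fin_dim (spP D i)" by blast
  have t: "cdim (tensor (spM D j) (spA D j i)) = cdim (spM D j) * cdim (spA D j i)" if "1 \<le> i" "i \<le> j" "j \<le> 2" for i j
    using that r2 by (intro cdim_tensor fin_M fin_A) auto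
  have "{1..2} = {1,2::nat}" by auto
  then show "cdim (spP D 1) = cdim (spM D 1) * cdim (spA D 1 1) + cdim (spM D 2) * cdim (spA D 2 1)"
    using *[of 1] t by simp
  show "cdim (spP D 2) = cdim (spM D 2) * cdim (spA D 2 2)"
    using *[of 2] t by simp
qed

lemma fin_Q: "l \<in> {1..ns D} \<Longrightarrow> fin_dim (spQ D l)"
  and dim_Q: "l \<in> {1..ns D} \<Longrightarrow> cdim (spQ D l) = (\<Sum>k\<in>{1..l}. cdim (spN D k) * cdim (spB D l k))"
proof -
  have *: "fin_dim (spQ D l) \<and> cdim (spQ D l) = (\<Sum>k\<in>{1..l}. cdim (tensor (spN D k) (dual (spB D l k))))" if "l \<in> {1..ns D}" for l
    unfolding spQ_def using that by (intro dsum_fin_dim fin_dim_tensor fin_dim_dual fin_N fin_B) auto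
  then show "l \<in> {1..ns D} \<Longrightarrow> fin_dim (spQ D l)" by blast
  have t: "cdim (tensor (spN D k) (dual (spB D l k))) = cdim (spN D k) * cdim (spB D l k)"
    if "l \<in> {1..ns D}" "k \<in> {1..l}" for l k
    using that by (subst cdim_tensor) (auto intro!: fin_dim_dual fin_N fin_B cdim_dual)
  show "l \<in> {1..ns D} \<Longrightarrow> cdim (spQ D l) = (\<Sum>k\<in>{1..l}. cdim (spN D k) * cdim (spB D l k))"
    using * t by simp
qed

lemma dim_line: "V = range (\<lambda>z. z *\<^sub>C e) \<Longrightarrow> e \<noteq> 0 \<Longrightarrow> cdim V = 1"
proof -
  assume "V = range (\<lambda>z. z *\<^sub>C e)" "e \<noteq> 0"
  then have "cbasis {e} V" by (simp add: cbasis_def complex_vector.span_singleton)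
  then show ?thesis by (simp add: cbasis_card)
qed

lemma dim_A_diag: "i \<in> {1,2} \<Longrightarrow> cdim (spA D i i) = 1"
  using A_diag[of i] r2 by (intro dim_line[of _ "eA D i"]) auto

lemma dim_B_diag: "l \<in> {1..ns D} \<Longrightarrow> cdim (spB D l l) = 1"
  using B_diag[of l] by (intro dim_line[of _ "eB D l"]) auto

lemma sub_P: "i \<in> {1,2} \<Longrightarrow> csubspace (spP D i)"
  by (rule fin_dim_sub[OF fin_P])

lemma sub_Q: "l \<in> {1..ns D} \<Longrightarrow> csubspace (spQ D l)"
  by (rule fin_dim_sub[OF fin_Q])

lemma xi_bilin: "bilin_on (spP D 2) (spA D 2 1) (spP D 1) (xi D 2)"
proof -
  have b: "bilin_on (tensor (spM D 2) (spA D 2 2)) (spA D 2 1) (tensor (spM D 2) (spA D 2 1))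
      (\<lambda>t a. id_tensor (spM D 2) (spA D 2 2) (spA D 2 1) (\<lambda>a'. cAA D 2 2 1 a' a) t)"
    using r2 by (intro bilin_swap[OF id_tensor_param] bilin_swap[OF bAA] sub_M sub_A) auto
  \<comment> \<open>The image of \<open>xi\<close> has no component in
    \<open>M\<^sub>1 \<otimes> A\<^sub>1\<^sub>1\<close>; the conditional supplies the value 0
    there, so that the direct sum over both indices can be used.\<close>
  have "bilin_on (spP D 2) (spA D 2 1) (tensor (spM D j) (spA D j 1))
      (\<lambda>p a. if j = 2 then id_tensor (spM D 2) (spA D 2 2) (spA D 2 1) (\<lambda>a'. cAA D 2 2 1 a' a) (p 2) else 0)"
    for j
  proof (cases "j = 2")
    case True
    have "lin_on (spP D 2) (tensor (spM D 2) (spA D 2 2)) (\<lambda>p. p 2)"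
      unfolding spP_def by (rule dsum_component) (simp add: r2)
    from bilin_compose[where g="\<lambda>a. a" and h="\<lambda>t. t", OF this b lin_on_id lin_on_id] show ?thesis
      using True by simp
  next
    case False
    then show ?thesis by (simp add: bilin_on_def lin_on_zero_map csubspace_tensor)
  qed
  from bilin_dsum_res[OF this] have
    "bilin_on (spP D 2) (spA D 2 1) (dsum {1..2} (\<lambda>j. tensor (spM D j) (spA D j 1))) (\<lambda>p a. res {1..2} (\<lambda>j.
      if j = 2 then id_tensor (spM D 2) (spA D 2 2) (spA D 2 1) (\<lambda>a'. cAA D 2 2 1 a' a) (p 2) else 0))" .
  then have "bilin_on (spP D 2) (spA D 2 1) (spP D 1) (\<lambda>p a. res {1..2} (\<lambda>j.
      if j = 2 then id_tensor (spM D 2) (spA D 2 2) (spA D 2 1) (\<lambda>a'. cAA D 2 2 1 a' a) (p 2) else 0))"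
    unfolding spP_def r2 .
  moreover have "xi D 2 p a = res {1..2} (\<lambda>j. if j = 2 then id_tensor (spM D 2) (spA D 2 2) (spA D 2 1)
      (\<lambda>a'. cAA D 2 2 1 a' a) (p 2) else 0)" if "p \<in> spP D 2" "a \<in> spA D 2 1" for p a
    using that by (intro ext) (auto simp: xi_def res_def r2)
  moreover have sA: "csubspace (spA D 2 1)" using r2 by (intro sub_A) auto
  moreover have sP: "csubspace (spP D 2)" by (rule sub_P) simp
  ultimately show ?thesis by (rule_tac iffD2[OF bilin_on_cong[OF sP sA]])
qed

lemma eta_bilin:
  assumes l: "l \<in> {1..<ns D}"
  shows "bilin_on (spQ D (Suc l)) (spB D (Suc l) l) (spQ D l) (eta D l)"
proof -
  have "bilin_on (spQ D (Suc l)) (spB D (Suc l) l) (tensor (spN D k) (dual (spB D l k)))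
      (\<lambda>q b. id_tensor (spN D k) (dual (spB D (Suc l) k)) (dual (spB D l k)) (\<lambda>f. dBB D (Suc l) l k f b) (q k))"
    if k: "k \<in> {1..l}" for k
  proof -
    have b: "bilin_on (tensor (spN D k) (dual (spB D (Suc l) k))) (spB D (Suc l) l) (tensor (spN D k) (dual (spB D l k)))
      (\<lambda>t b. id_tensor (spN D k) (dual (spB D (Suc l) k)) (dual (spB D l k)) (\<lambda>f. dBB D (Suc l) l k f b) t)"
      using l k by (intro bilin_swap[OF id_tensor_param] bilin_swap[OF dBB_bilin] sub_N sub_B csubspace_dual) auto
    have "lin_on (spQ D (Suc l)) (tensor (spN D k) (dual (spB D (Suc l) k))) (\<lambda>q. q k)"
      unfolding spQ_def using k by (intro dsum_component) simp
    from bilin_compose[where g="\<lambda>a. a" and h="\<lambda>t. t", OF this b lin_on_id lin_on_id] show ?thesis .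
  qed
  from bilin_dsum_res[OF this] have b:
    "bilin_on (spQ D (Suc l)) (spB D (Suc l) l) (spQ D l) (\<lambda>q b. res {1..l} (\<lambda>k.
      id_tensor (spN D k) (dual (spB D (Suc l) k)) (dual (spB D l k)) (\<lambda>f. dBB D (Suc l) l k f b) (q k)))"
    unfolding spQ_def .
  have s: "csubspace (spQ D (Suc l))" "csubspace (spB D (Suc l) l)" using l by (auto intro: sub_Q sub_B)
  show ?thesis
    by (rule iffD1[OF bilin_on_cong[OF s] b]) (simp add: eta_def res_def)
qed

lemma zeta_factors:
  assumes "\<phi> \<in> smallW D"
  shows "factors D (res {2..nr D} (xi D)) (gamma D \<phi>) (res {1..<ns D} (eta D)) (gam D \<phi>)"
  unfolding factors_def
proof (intro conjI ballI)
  show "bilin_on (spP D i) (dual (spH D l i)) (spQ D l) (gam D \<phi> l i)" if "l \<in> {1..ns D}" "i \<in> {1,2}" for l i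
    using that r2 by (intro gam_bilin assms) auto
  show "gamma D \<phi> p \<chi> = gam D \<phi> (ns D) 1 p \<chi>" if "p \<in> spP D 1" "\<chi> \<in> dual (spH D (ns D) 1)" for p \<chi>
    by (rule gamma_gam[OF that])
  show "gam D \<phi> l 1 (res {2..nr D} (xi D) 2 p a) \<chi> = gam D \<phi> l 2 p (dHA D l 2 1 \<chi> a)"
    if "l \<in> {1..ns D}" "p \<in> spP D 2" "\<chi> \<in> dual (spH D l 1)" "a \<in> spA D 2 1" for l p \<chi> a
    using gam_dHA(2)[of 1 l \<phi> p \<chi> a] that assms r2 by (simp add: res_def numeral_2_eq_2)
  show "res {1..<ns D} (eta D) l (gam D \<phi> (Suc l) i p \<chi>) b = gam D \<phi> l i p (dHB D (Suc l) l i \<chi> b)"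
    if "l \<in> {1..<ns D}" "i \<in> {1,2}" "p \<in> spP D i" "\<chi> \<in> dual (spH D (Suc l) i)" "b \<in> spB D (Suc l) l" for l i p \<chi> b
    using gam_dHB[of i l \<phi> p \<chi> b] that assms r2 by (auto simp: res_def)
qed

lemma act_bigW:
  assumes g: "\<And>i. i \<in> {1,2} \<Longrightarrow> g i \<in> GL (spP D i)" and h: "\<And>l. l \<in> {1..ns D} \<Longrightarrow> h l \<in> GL (spQ D l)"
    and x: "bilin_on (spP D 2) (spA D 2 1) (spP D 1) (x 2)"
    and \<psi>: "bilin_on (spP D 1) (dual (spH D (ns D) 1)) (spQ D (ns D)) \<psi>"
    and y: "\<And>l. l \<in> {1..<ns D} \<Longrightarrow> bilin_on (spQ D (Suc l)) (spB D (Suc l) l) (spQ D l) (y l)"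
  shows "act D g h (x, \<psi>, y) \<in> bigW D"
proof -
  have gi: "lin_on (spP D i) (spP D i) (inv_into (spP D i) (g i))" if "i \<in> {1,2}" for i
    by (rule GL_inv_lin[OF sub_P[OF that] g[OF that]])
  have hi: "lin_on (spQ D i) (spQ D i) (inv_into (spQ D i) (h i))" if "i \<in> {1..ns D}" for i
    by (rule GL_inv_lin[OF sub_Q[OF that] h[OF that]])
  have n: "ns D \<in> {1..ns D}" using ns by auto
  have sA: "csubspace (spA D 2 1)" using r2 by (intro sub_A) auto
  have X: "bilin_on (spP D 2) (spA D 2 1) (spP D 1) (\<lambda>p a. g 1 (x 2 (inv_into (spP D 2) (g 2) p) a))"
    by (rule bilin_compose[where g="\<lambda>a. a", OF gi x lin_on_id GL_lin[OF g]]) auto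
  have P: "bilin_on (spP D 1) (dual (spH D (ns D) 1)) (spQ D (ns D)) (\<lambda>p \<chi>. h (ns D) (\<psi> (inv_into (spP D 1) (g 1) p) \<chi>))"
    by (rule bilin_compose[where g="\<lambda>a. a", OF gi \<psi> lin_on_id GL_lin[OF h[OF n]]]) auto
  have Y: "bilin_on (spQ D (Suc l)) (spB D (Suc l) l) (spQ D l) (\<lambda>q b. h l (y l (inv_into (spQ D (Suc l)) (h (Suc l)) q) b))"
    if "l \<in> {1..<ns D}" for l
    using that by (intro bilin_compose[where g="\<lambda>a. a", OF hi y lin_on_id GL_lin[OF h]]) auto
  have sB: "csubspace (spB D (Suc l) l)" if "l \<in> {1..<ns D}" for l using that by (intro sub_B) auto
  have "fst (act D g h (x, \<psi>, y)) \<in> dsum {2..nr D} (\<lambda>i. Hom (spP D i) (Hom (spA D i (i - 1)) (spP D (i - 1))))"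
    unfolding act_def using bilin_Hom[OF sub_P sA X] by (auto simp: r2 intro!: res_dsum)
  moreover have "fst (snd (act D g h (x, \<psi>, y))) \<in> Hom (spP D 1) (Hom (dual (spH D (ns D) 1)) (spQ D (ns D)))"
    using bilin_Hom[OF sub_P csubspace_dual P] by (simp add: act_def)
  moreover have "snd (snd (act D g h (x, \<psi>, y))) \<in> dsum {1..<ns D} (\<lambda>l. Hom (spQ D (Suc l)) (Hom (spB D (Suc l) l) (spQ D l)))"
    unfolding act_def prod.case snd_conv
  proof (rule res_dsum)
    fix l assume l: "l \<in> {1..<ns D}"
    then have "csubspace (spQ D (Suc l))" by (intro sub_Q) auto
    from bilin_Hom[OF this sB[OF l] Y[OF l]]
    show "res (spQ D (Suc l)) (\<lambda>q. res (spB D (Suc l) l) (\<lambda>b.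
        h l (y l (inv_into (spQ D (Suc l)) (h (Suc l)) q) b)))
      \<in> Hom (spQ D (Suc l)) (Hom (spB D (Suc l) l) (spQ D l))" .
  qed
  ultimately show ?thesis unfolding bigW_def mem_Times_iff by blast
qed

lemma zeta_bilin:
  assumes "\<phi> \<in> smallW D"
  shows "bilin_on (spP D 1) (dual (spH D (ns D) 1)) (spQ D (ns D)) (gamma D \<phi>)"
proof -
  have b: "bilin_on (spP D 1) (dual (spH D (ns D) 1)) (spQ D (ns D)) (gam D \<phi> (ns D) 1)"
    using r2 ns by (intro gam_bilin assms) auto
  show ?thesis
    by (rule iffD2[OF bilin_on_cong[OF sub_P csubspace_dual] b]) (simp, rule gamma_gam)
qed

lemma Zset_bigW: "Zset D \<subseteq> bigW D"
proof
  fix z assume "z \<in> Zset D"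
  then obtain g h w where z: "z = act D g h (zeta D w)" and g: "\<forall>i\<in>{1..nr D}. g i \<in> GL (spP D i)"
    and h: "\<forall>l\<in>{1..ns D}. h l \<in> GL (spQ D l)" and w: "w \<in> smallW D"
    unfolding Zset_def by blast
  show "z \<in> bigW D"
    unfolding z zeta_def
    by (rule act_bigW) (use g h w r2 xi_bilin eta_bilin zeta_bilin[OF w] in \<open>auto simp: res_def\<close>)
qed

lemma Zset_factors:
  assumes "(x, \<psi>, y) \<in> Zset D"
  obtains \<Psi> where "factors D x \<psi> y \<Psi>"
proof -
  obtain g h w where z: "(x, \<psi>, y) = act D g h (zeta D w)" and g: "\<And>i. i \<in> {1,2} \<Longrightarrow> g i \<in> GL (spP D i)"
    and h: "\<And>l. l \<in> {1..ns D} \<Longrightarrow> h l \<in> GL (spQ D l)" and w: "w \<in> smallW D"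
    using assms r2 unfolding Zset_def by force
  let ?g = "\<lambda>i. inv_into (spP D i) (g i)"
  have gl: "lin_on (spP D i) (spP D i) (?g i)" if "i \<in> {1,2}" for i
    by (rule GL_inv_lin[OF sub_P[OF that] g[OF that]])
  have "factors D x \<psi> y (\<lambda>l i p \<chi>. h l (gam D w l i (?g i p) \<chi>))"
  proof (rule factors_transport[OF zeta_factors[OF w] gl])
    show "lin_on (spQ D l) (spQ D l) (h l)" if "l \<in> {1..ns D}" for l by (rule GL_lin[OF h[OF that]])
    show "?g 1 (x 2 p a) = res {2..nr D} (xi D) 2 (?g 2 p) a" if pa: "p \<in> spP D 2" "a \<in> spA D 2 1" for p a
    proof -
      have "xi D 2 (?g 2 p) a \<in> spP D 1" by (rule bilin_mem[OF xi_bilin lin_on_mem[OF gl] pa(2)]) (use pa in auto)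
      moreover have "x 2 p a = g 1 (xi D 2 (?g 2 p) a)" using z pa r2 by (simp add: act_def zeta_def res_def)
      ultimately show ?thesis using GL_inv_left[OF g[of 1]] r2 by (simp add: res_def)
    qed
    show "\<psi> p \<chi> = h (ns D) (gamma D w (?g 1 p) \<chi>)" if "p \<in> spP D 1" "\<chi> \<in> dual (spH D (ns D) 1)" for p \<chi>
      using z that by (simp add: act_def zeta_def res_def)
    show "y l (h (Suc l) q) b = h l (res {1..<ns D} (eta D) l q b)"
      if l: "l \<in> {1..<ns D}" and q: "q \<in> spQ D (Suc l)" and b: "b \<in> spB D (Suc l) l" for l q b
    proof -
      have hh: "h (Suc l) \<in> GL (spQ D (Suc l))" using l by (intro h) auto
      have "y l (h (Suc l) q) b = h l (eta D l (inv_into (spQ D (Suc l)) (h (Suc l)) (h (Suc l) q)) b)"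
        using z l b GL_mem[OF hh q] by (simp add: act_def zeta_def res_def)
      then show ?thesis using GL_inv_left[OF hh q] l by (simp add: res_def)
    qed
  qed
  then show ?thesis by (rule that)
qed

end

lemma csubspace_Times: "csubspace U \<Longrightarrow> csubspace V \<Longrightarrow> csubspace (U \<times> V)"
  by (auto simp: complex_vector.subspace_def scaleC_prod_def zero_prod_def)

lemma span_image2: "tsurj \<beta> U V W \<Longrightarrow> cspan ((\<lambda>(u, v). \<beta> u v) ` (U \<times> V)) = W"
proof -
  have "(\<lambda>(u, v). \<beta> u v) ` (U \<times> V) = {\<beta> u v |u v. u \<in> U \<and> v \<in> V}" by auto
  then show "tsurj \<beta> U V W \<Longrightarrow> ?thesis" by (simp add: tsurj_def)
qed

lemma tsurj_eq:
  assumes t: "tsurj \<beta> U V W" and b: "bilin_on U V W \<beta>" and W: "csubspace W"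
    and f: "lin_on W X f" "lin_on W X' g" and e: "\<And>u v. u \<in> U \<Longrightarrow> v \<in> V \<Longrightarrow> f (\<beta> u v) = g (\<beta> u v)" and w: "w \<in> W"
  shows "f w = g w"
  by (rule lin_on_eq_span[OF W f, where S="{\<beta> u v |u v. u \<in> U \<and> v \<in> V}"])
    (use t e w bilin_mem[OF b] in \<open>auto simp: tsurj_def\<close>)


section \<open>The closure of \<open>Z\<close>\<close>

context two_step
begin

lemma sub_bigW: "csubspace (bigW D)"
  unfolding bigW_def r2 using ns
  by (intro csubspace_Times csubspace_dsum csubspace_Hom sub_P sub_Q) auto

lemma bigW_bilin:
  assumes "(x, \<psi>, y) \<in> bigW D"
  shows "bilin_on (spP D 2) (spA D 2 1) (spP D 1) (x 2)"
    and "bilin_on (spP D 1) (dual (spH D (ns D) 1)) (spQ D (ns D)) \<psi>"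
    and "l \<in> {1..<ns D} \<Longrightarrow> bilin_on (spQ D (Suc l)) (spB D (Suc l) l) (spQ D l) (y l)"
proof -
  have "x 2 \<in> Hom (spP D 2) (Hom (spA D 2 1) (spP D 1))"
    using assms r2 unfolding bigW_def dsum_def by force
  then show "bilin_on (spP D 2) (spA D 2 1) (spP D 1) (x 2)" by (rule Hom_bilin)
  show "bilin_on (spP D 1) (dual (spH D (ns D) 1)) (spQ D (ns D)) \<psi>"
    using assms unfolding bigW_def by (intro Hom_bilin) auto
  show "bilin_on (spQ D (Suc l)) (spB D (Suc l) l) (spQ D l) (y l)" if "l \<in> {1..<ns D}"
    using assms that unfolding bigW_def dsum_def by (intro Hom_bilin) auto
qed

lemma eval_lin:
  shows "p \<in> spP D 2 \<Longrightarrow> a \<in> spA D 2 1 \<Longrightarrow> lin_on (bigW D) (spP D 1) (\<lambda>w. fst w 2 p a)"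
    and "p \<in> spP D 1 \<Longrightarrow> \<chi> \<in> dual (spH D (ns D) 1) \<Longrightarrow> lin_on (bigW D) (spQ D (ns D)) (\<lambda>w. fst (snd w) p \<chi>)"
    and "l \<in> {1..<ns D} \<Longrightarrow> q \<in> spQ D (Suc l) \<Longrightarrow> b \<in> spB D (Suc l) l \<Longrightarrow>
      lin_on (bigW D) (spQ D l) (\<lambda>w. snd (snd w) l q b)"
  using bilin_mem[OF bigW_bilin(1)] bilin_mem[OF bigW_bilin(2)] bilin_mem[OF bigW_bilin(3)]
  by (auto simp: lin_on_def scaleC_fun_def scaleC_prod_def)

text \<open>\<open>BHA_assoc\<close> after transposition. It makes the two ways of contracting an
  element of the dual of \<open>H\<^sub>m\<^sub>1\<close> down to the dual of
  \<open>H\<^sub>l\<^sub>2\<close> agree.\<close>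

lemma dHA_dHB:
  assumes l: "1 \<le> l" "l \<le> m" "m \<le> ns D" and a: "a \<in> spA D 2 1" and b: "b \<in> spB D m l"
  shows "dHA D l 2 1 (dHB D m l 1 \<chi> b) a = dHB D m l 2 (dHA D m 2 1 \<chi> a) b"
proof
  fix h
  show "dHA D l 2 1 (dHB D m l 1 \<chi> b) a h = dHB D m l 2 (dHA D m 2 1 \<chi> a) b h"
  proof (cases "h \<in> spH D l 2")
    case True
    have "cHA D l 2 1 h a \<in> spH D l 1" using True a l r2 by (intro bilin_mem[OF bHA]) auto
    moreover have "cBH D m l 2 b h \<in> spH D m 2" using True b l r2 by (intro bilin_mem[OF bBH]) auto
    moreover have "cHA D m 2 1 (cBH D m l 2 b h) a = cBH D m l 1 b (cHA D l 2 1 h a)"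
      using True a b l r2 by (intro BHA_assoc) auto
    ultimately show ?thesis using True by (simp add: dHA_def dHB_def res_def)
  qed (simp add: dHA_def dHB_def res_def)
qed

text \<open>Each composite is polynomial in the point, so \<open>closure_factorisation\<close>
  yields a factor for it separately: \<open>\<Gamma>a\<close> for \<psi> after x,
  \<open>\<Gamma>b\<close> for y after \<psi>, \<open>\<Gamma>c\<close> for the triple composite.
  The relations between these factors are then derived at the point itself, from the surjectivity of
  \<open>dHA\<close> and \<open>dHB\<close>.\<close>

lemma closure_factors:
  assumes w: "(x, \<psi>, y) \<in> zariski_closure (bigW D) (Zset D)"
  obtains \<Psi> where "factors D x \<psi> y \<Psi>"
proof -
  let ?W = "bigW D" and ?s = "ns D"
  let ?X = "\<lambda>w p a. fst w 2 p a" and ?S = "\<lambda>w p \<chi>. fst (snd w) p \<chi>" and ?Y = "\<lambda>w q b. snd (snd w) 1 q b"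
  have wW: "(x, \<psi>, y) \<in> ?W" using w by (simp add: zariski_closure_def)
  have s: "?s \<in> {1..?s}" using ns by simp
  have i12: "1 \<in> {1, 2::nat}" "2 \<in> {1, 2::nat}" by auto
  note bx = bigW_bilin(1) and bp = bigW_bilin(2) and b_y = bigW_bilin(3)
  have Xm: "?X w p a \<in> spP D 1" if "w \<in> ?W" "p \<in> spP D 2" "a \<in> spA D 2 1" for w p a
    using bilin_mem[OF bx that(2,3)] that(1) by (metis prod.collapse)
  have Xl: "lin_on (spP D 2) (spP D 1) (\<lambda>p. ?X w p a)" if "w \<in> ?W" "a \<in> spA D 2 1" for w a
    using bilin_left[OF bx that(2)] that(1) by (metis prod.collapse)
  have Sm: "?S w p \<chi> \<in> spQ D ?s" if "w \<in> ?W" "p \<in> spP D 1" "\<chi> \<in> dual (spH D ?s 1)" for w p \<chi>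
    using bilin_mem[OF bp that(2,3)] that(1) by (metis prod.collapse)
  have Sl: "lin_on (spP D 1) (spQ D ?s) (\<lambda>p. ?S w p \<chi>)" if "w \<in> ?W" "\<chi> \<in> dual (spH D ?s 1)" for w \<chi>
    using bilin_left[OF bp that(2)] that(1) by (metis prod.collapse)
  have pX: "poly_map ?W (spP D 1) (\<lambda>w. ?X w p a)" if "p \<in> spP D 2" "a \<in> spA D 2 1" for p a
    by (rule poly_map_lin[OF sub_bigW eval_lin(1)[OF that]])
  have pS: "poly_map ?W (spQ D ?s) (\<lambda>w. ?S w p \<chi>)" if "p \<in> spP D 1" "\<chi> \<in> dual (spH D ?s 1)" for p \<chi>
    by (rule poly_map_lin[OF sub_bigW eval_lin(2)[OF that]])
  \<comment> \<open>Both maps vary with the point, so the dependence is quadratic; adding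
    \<open>y\<close> below makes it cubic.\<close>
  have pSX: "poly_map ?W (spQ D ?s) (\<lambda>w. ?S w (?X w p a) \<chi>)"
    if "p \<in> spP D 2" "a \<in> spA D 2 1" "\<chi> \<in> dual (spH D ?s 1)" for p a \<chi>
    by (rule poly_map_bilin[where G="\<lambda>w v. ?S w v \<chi>", OF fin_P[OF i12(1)] sub_Q[OF s] pX[OF that(1,2)] pS[OF _ that(3)] Sl[OF _ that(3)]])
  have Zf: "\<exists>\<Psi>. factors D (fst z) (fst (snd z)) (snd (snd z)) \<Psi>" if "z \<in> Zset D" for z
    using Zset_factors[of "fst z" "fst (snd z)" "snd (snd z)"] that by (metis prod.collapse)
  have ZW: "z \<in> ?W" if "z \<in> Zset D" for z using Zset_bigW that by blast
  have fH: "fin_dim (dual (spH D l i))" if "1 \<le> l" "l \<le> ?s" "i \<in> {1,2}" for l i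
    using that r2 by (intro fin_dim_dual fin_H) auto
  have sA: "tsurj (dHA D l 2 1) (dual (spH D l 1)) (spA D 2 1) (dual (spH D l 2))" if "1 \<le> l" "l \<le> ?s" for l
    using that r2 by (intro dHA_surj) auto
  have bA: "bilin_on (dual (spH D l 1)) (spA D 2 1) (dual (spH D l 2)) (dHA D l 2 1)" if "1 \<le> l" "l \<le> ?s" for l
    using that r2 by (intro dHA_bilin) auto
  obtain \<Gamma>a where Ga: "bilin_on (spP D 2) (dual (spH D ?s 2)) (spQ D ?s) \<Gamma>a"
    "\<And>p i. p \<in> spP D 2 \<Longrightarrow> i \<in> dual (spH D ?s 1) \<times> spA D 2 1 \<Longrightarrow>
      (\<lambda>(\<chi>, a). ?S (x, \<psi>, y) (?X (x, \<psi>, y) p a) \<chi>) i = \<Gamma>a p ((\<lambda>(\<chi>, a). dHA D ?s 2 1 \<chi> a) i)"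
  proof (rule closure_factorisation[where F="\<lambda>w p (\<chi>, a). ?S w (?X w p a) \<chi>", OF fH[OF ns _ i12(2)] span_image2[OF sA[OF ns]] fin_Q[OF s] _ Zset_bigW _ w])
    show "poly_map ?W (spQ D ?s) (\<lambda>w. case i of (\<chi>, a) \<Rightarrow> ?S w (?X w p a) \<chi>)"
      if "p \<in> spP D 2" "i \<in> dual (spH D ?s 1) \<times> spA D 2 1" for p i
      using pSX that by auto
    show "lin_on (spP D 2) (spQ D ?s) (\<lambda>p. case i of (\<chi>, a) \<Rightarrow> ?S (x, \<psi>, y) (?X (x, \<psi>, y) p a) \<chi>)"
      if "i \<in> dual (spH D ?s 1) \<times> spA D 2 1" for i
      using that lin_on_compose[OF Xl[OF wW] Sl[OF wW]] by auto
    fix z p assume z: "z \<in> Zset D" and p: "p \<in> spP D 2"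
    obtain \<Psi> where f: "factors D (fst z) (fst (snd z)) (snd (snd z)) \<Psi>" using Zf[OF z] by blast
    show "\<exists>\<Gamma>. lin_on (dual (spH D ?s 2)) (spQ D ?s) \<Gamma> \<and>
        (\<forall>i\<in>dual (spH D ?s 1) \<times> spA D 2 1. (case i of (\<chi>, a) \<Rightarrow> ?S z (?X z p a) \<chi>) = \<Gamma> (case i of (\<chi>, a) \<Rightarrow> dHA D ?s 2 1 \<chi> a))"
      using bilin_right[OF factors_bilin[OF f s i12(2)] p] factors_psi[OF f Xm[OF ZW[OF z] p]] factors_x[OF f s p]
      by (intro exI[of _ "\<Psi> ?s 2 p"]) auto
  qed (use that in auto)
  have Ga': "\<psi> (x 2 p a) \<chi> = \<Gamma>a p (dHA D ?s 2 1 \<chi> a)" if "p \<in> spP D 2" "\<chi> \<in> dual (spH D ?s 1)" "a \<in> spA D 2 1" for p \<chi> a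
    using Ga(2)[OF that(1), of "(\<chi>, a)"] that by simp
  show ?thesis
  proof (cases "?s = 1")
    case True
    have "factors D x \<psi> y (\<lambda>l i. if i = 1 then \<psi> else \<Gamma>a)"
      unfolding factors_def using True bp[OF wW] Ga(1) Ga' by auto
    then show ?thesis by (rule that)
  next
    case False
    then have s2: "?s = 2" using s12 by simp
    have l1: "1 \<in> {1..<?s}" "1 \<in> {1..?s}" using s2 by auto
    have Suc1: "Suc 1 = 2" by simp
    note by1 = b_y[OF _ l1(1), unfolded Suc1]
    have Yl: "lin_on (spQ D 2) (spQ D 1) (\<lambda>q. ?Y w q b)" if "w \<in> ?W" "b \<in> spB D 2 1" for w b
      using bilin_left[OF by1 that(2)] that(1) by (metis prod.collapse)
    have pY: "poly_map ?W (spQ D 1) (\<lambda>w. ?Y w q b)" if "q \<in> spQ D 2" "b \<in> spB D 2 1" for q b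
      using that l1 by (intro poly_map_lin[OF sub_bigW eval_lin(3)[of 1, unfolded Suc1]]) auto
    have sQ1: "csubspace (spQ D 1)" by (rule sub_Q[OF l1(2)])
    have fQ2: "fin_dim (spQ D 2)" using s2 by (intro fin_Q) auto
    have pYS: "poly_map ?W (spQ D 1) (\<lambda>w. ?Y w (?S w p \<chi>) b)"
      if "p \<in> spP D 1" "\<chi> \<in> dual (spH D 2 1)" "b \<in> spB D 2 1" for p \<chi> b
      by (rule poly_map_bilin[where G="\<lambda>w v. ?Y w v b", OF fQ2 sQ1 _ pY[OF _ that(3)] Yl[OF _ that(3)]])
        (use pS that s2 in auto)
    have pYSX: "poly_map ?W (spQ D 1) (\<lambda>w. ?Y w (?S w (?X w p a) \<chi>) b)"
      if "p \<in> spP D 2" "a \<in> spA D 2 1" "\<chi> \<in> dual (spH D 2 1)" "b \<in> spB D 2 1" for p a \<chi> b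
      by (rule poly_map_bilin[where G="\<lambda>w v. ?Y w v b", OF fQ2 sQ1 _ pY[OF _ that(4)] Yl[OF _ that(4)]])
        (use pSX that s2 in auto)
    have sB: "tsurj (dHB D 2 1 i) (dual (spH D 2 i)) (spB D 2 1) (dual (spH D 1 i))" if "i \<in> {1,2}" for i
      using that r2 s2 by (intro dHB_surj) auto
    have bB: "bilin_on (dual (spH D 2 i)) (spB D 2 1) (dual (spH D 1 i)) (dHB D 2 1 i)" if "i \<in> {1,2}" for i
      using that r2 s2 by (intro dHB_bilin) auto
    have fH1: "fin_dim (dual (spH D 1 i))" if "i \<in> {1,2}" for i using that s2 by (intro fH) auto
    obtain \<Gamma>b where Gb: "bilin_on (spP D 1) (dual (spH D 1 1)) (spQ D 1) \<Gamma>b"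
      "\<And>p i. p \<in> spP D 1 \<Longrightarrow> i \<in> dual (spH D 2 1) \<times> spB D 2 1 \<Longrightarrow>
        (\<lambda>(\<chi>, b). ?Y (x, \<psi>, y) (?S (x, \<psi>, y) p \<chi>) b) i = \<Gamma>b p ((\<lambda>(\<chi>, b). dHB D 2 1 1 \<chi> b) i)"
    proof (rule closure_factorisation[where F="\<lambda>w p (\<chi>, b). ?Y w (?S w p \<chi>) b", OF fH1[OF i12(1)] span_image2[OF sB[OF i12(1)]] fin_Q[OF l1(2)] _ Zset_bigW _ w])
      show "poly_map ?W (spQ D 1) (\<lambda>w. case i of (\<chi>, b) \<Rightarrow> ?Y w (?S w p \<chi>) b)"
        if "p \<in> spP D 1" "i \<in> dual (spH D 2 1) \<times> spB D 2 1" for p i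
        using pYS that by auto
      show "lin_on (spP D 1) (spQ D 1) (\<lambda>p. case i of (\<chi>, b) \<Rightarrow> ?Y (x, \<psi>, y) (?S (x, \<psi>, y) p \<chi>) b)"
        if "i \<in> dual (spH D 2 1) \<times> spB D 2 1" for i
        using that lin_on_compose[OF Sl[OF wW, unfolded s2] Yl[OF wW]] by auto
      fix z p assume z: "z \<in> Zset D" and p: "p \<in> spP D 1"
      obtain \<Psi> where f: "factors D (fst z) (fst (snd z)) (snd (snd z)) \<Psi>" using Zf[OF z] by blast
      show "\<exists>\<Gamma>. lin_on (dual (spH D 1 1)) (spQ D 1) \<Gamma> \<and>
          (\<forall>i\<in>dual (spH D 2 1) \<times> spB D 2 1. (case i of (\<chi>, b) \<Rightarrow> ?Y z (?S z p \<chi>) b) = \<Gamma> (case i of (\<chi>, b) \<Rightarrow> dHB D 2 1 1 \<chi> b))"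
        using bilin_right[OF factors_bilin[OF f l1(2) i12(1)] p] factors_psi[OF f p, unfolded s2]
          factors_y[OF f l1(1) i12(1) p, unfolded Suc1]
        by (intro exI[of _ "\<Psi> 1 1 p"]) auto
    qed (use that in auto)
    have Gb': "y 1 (\<psi> p \<chi>) b = \<Gamma>b p (dHB D 2 1 1 \<chi> b)" if "p \<in> spP D 1" "\<chi> \<in> dual (spH D 2 1)" "b \<in> spB D 2 1" for p \<chi> b
      using Gb(2)[OF that(1), of "(\<chi>, b)"] that by simp
    let ?I = "dual (spH D 2 1) \<times> spA D 2 1 \<times> spB D 2 1"
    let ?K = "\<lambda>(\<chi>, a, b). dHB D 2 1 2 (dHA D 2 2 1 \<chi> a) b"
    have "1 \<le> (2::nat)" "2 \<le> ?s" using s2 by auto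
    note sA2 = sA[OF this] and bA2 = bA[OF this]
    \<comment> \<open>The surjectivity of the two contractions combines: the functionals obtained
      from \<chi> by applying first \<open>a\<close> and then \<open>b\<close> span the dual of
      \<open>H\<^sub>1\<^sub>2\<close>.\<close>
    have span3: "cspan (?K ` ?I) = dual (spH D 1 2)"
    proof
      have "?K ` ?I \<subseteq> dual (spH D 1 2)" using bilin_mem[OF bB[OF i12(2)]] bilin_mem[OF bA2] by auto
      then show "cspan (?K ` ?I) \<subseteq> dual (spH D 1 2)" by (rule complex_vector.span_minimal[OF _ csubspace_dual])
      have "dHB D 2 1 2 \<eta> b \<in> cspan (?K ` ?I)" if \<eta>: "\<eta> \<in> dual (spH D 2 2)" and b: "b \<in> spB D 2 1" for \<eta> b
      proof (rule lin_on_span_into[where f="\<lambda>\<eta>. dHB D 2 1 2 \<eta> b", OF csubspace_dual bilin_left[OF bB[OF i12(2)] b] complex_vector.subspace_span])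
        show "\<eta> \<in> cspan {dHA D 2 2 1 \<chi> a |\<chi> a. \<chi> \<in> dual (spH D 2 1) \<and> a \<in> spA D 2 1}"
          using \<eta> sA2 by (simp add: tsurj_def)
        show "{dHA D 2 2 1 \<chi> a |\<chi> a. \<chi> \<in> dual (spH D 2 1) \<and> a \<in> spA D 2 1} \<subseteq> dual (spH D 2 2)"
          using bilin_mem[OF bA2] by auto
        fix s assume "s \<in> {dHA D 2 2 1 \<chi> a |\<chi> a. \<chi> \<in> dual (spH D 2 1) \<and> a \<in> spA D 2 1}"
        then show "dHB D 2 1 2 s b \<in> cspan (?K ` ?I)" using b by (intro complex_vector.span_base) force
      qed
      then have "{dHB D 2 1 2 \<eta> b |\<eta> b. \<eta> \<in> dual (spH D 2 2) \<and> b \<in> spB D 2 1} \<subseteq> cspan (?K ` ?I)" by blast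
      then have "cspan {dHB D 2 1 2 \<eta> b |\<eta> b. \<eta> \<in> dual (spH D 2 2) \<and> b \<in> spB D 2 1} \<subseteq> cspan (?K ` ?I)"
        by (rule complex_vector.span_minimal[OF _ complex_vector.subspace_span])
      then show "dual (spH D 1 2) \<subseteq> cspan (?K ` ?I)" using sB[OF i12(2)] by (simp add: tsurj_def)
    qed
    obtain \<Gamma>c where Gc: "bilin_on (spP D 2) (dual (spH D 1 2)) (spQ D 1) \<Gamma>c"
      "\<And>p i. p \<in> spP D 2 \<Longrightarrow> i \<in> ?I \<Longrightarrow>
        (\<lambda>(\<chi>, a, b). ?Y (x, \<psi>, y) (?S (x, \<psi>, y) (?X (x, \<psi>, y) p a) \<chi>) b) i = \<Gamma>c p (?K i)"
    proof (rule closure_factorisation[where F="\<lambda>w p (\<chi>, a, b). ?Y w (?S w (?X w p a) \<chi>) b", OF fH1[OF i12(2)] span3 fin_Q[OF l1(2)] _ Zset_bigW _ w])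
      show "poly_map ?W (spQ D 1) (\<lambda>w. case i of (\<chi>, a, b) \<Rightarrow> ?Y w (?S w (?X w p a) \<chi>) b)"
        if "p \<in> spP D 2" "i \<in> ?I" for p i
        using pYSX that by auto
      show "lin_on (spP D 2) (spQ D 1) (\<lambda>p. case i of (\<chi>, a, b) \<Rightarrow> ?Y (x, \<psi>, y) (?S (x, \<psi>, y) (?X (x, \<psi>, y) p a) \<chi>) b)"
        if "i \<in> ?I" for i
        using that lin_on_compose[OF lin_on_compose[OF Xl[OF wW] Sl[OF wW, unfolded s2]] Yl[OF wW]] by auto
      fix z p assume z: "z \<in> Zset D" and p: "p \<in> spP D 2"
      obtain \<Psi> where f: "factors D (fst z) (fst (snd z)) (snd (snd z)) \<Psi>" using Zf[OF z] by blast
      have "?Y z (?S z (?X z p a) \<chi>) b = \<Psi> 1 2 p (dHB D 2 1 2 (dHA D 2 2 1 \<chi> a) b)"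
        if "\<chi> \<in> dual (spH D 2 1)" "a \<in> spA D 2 1" "b \<in> spB D 2 1" for \<chi> a b
      proof -
        have "?S z (?X z p a) \<chi> = \<Psi> 2 2 p (dHA D 2 2 1 \<chi> a)"
          using factors_psi[OF f Xm[OF ZW[OF z] p]] factors_x[OF f s p] that by (simp add: s2)
        then show ?thesis
          using factors_y[OF f l1(1) i12(2) p, unfolded Suc1, OF bilin_mem[OF bA2 that(1,2)] that(3)] by simp
      qed
      then show "\<exists>\<Gamma>. lin_on (dual (spH D 1 2)) (spQ D 1) \<Gamma> \<and>
          (\<forall>i\<in>?I. (case i of (\<chi>, a, b) \<Rightarrow> ?Y z (?S z (?X z p a) \<chi>) b) = \<Gamma> (?K i))"
        using bilin_right[OF factors_bilin[OF f l1(2) i12(2)] p]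
        by (intro exI[of _ "\<Psi> 1 2 p"]) auto
    qed (use that in auto)
    have Gc': "y 1 (\<psi> (x 2 p a) \<chi>) b = \<Gamma>c p (dHB D 2 1 2 (dHA D 2 2 1 \<chi> a) b)"
      if "p \<in> spP D 2" "\<chi> \<in> dual (spH D 2 1)" "a \<in> spA D 2 1" "b \<in> spB D 2 1" for p \<chi> a b
      using Gc(2)[OF that(1), of "(\<chi>, a, b)"] that by simp
    note Ga2 = Ga(1)[unfolded s2] and Ga2' = Ga'[unfolded s2]
    have y1: "lin_on (spQ D 2) (spQ D 1) (\<lambda>q. y 1 q b)" if "b \<in> spB D 2 1" for b using Yl[OF wW that] by simp
    have x1: "x 2 p a \<in> spP D 1" if "p \<in> spP D 2" "a \<in> spA D 2 1" for p a using Xm[OF wW that] by simp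
    \<comment> \<open>Both sides are linear in \<open>\<chi>'\<close>, so it suffices to take some
      \<chi> contracted by \<open>b\<close>. There both sides equal the triple composite, by
      \<open>dHA_dHB\<close>.\<close>
    have e1: "\<Gamma>b (x 2 p a) \<chi>' = \<Gamma>c p (dHA D 1 2 1 \<chi>' a)"
      if p: "p \<in> spP D 2" and \<chi>': "\<chi>' \<in> dual (spH D 1 1)" and a: "a \<in> spA D 2 1" for p \<chi>' a
    proof (rule tsurj_eq[OF sB[OF i12(1)] bB[OF i12(1)] csubspace_dual bilin_right[OF Gb(1) x1[OF p a]] _ _ \<chi>'])
      show "lin_on (dual (spH D 1 1)) (spQ D 1) (\<lambda>\<chi>'. \<Gamma>c p (dHA D 1 2 1 \<chi>' a))"
        using l1 by (intro lin_on_compose[OF bilin_left[OF bA a] bilin_right[OF Gc(1) p]]) auto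
      show "\<Gamma>b (x 2 p a) (dHB D 2 1 1 \<chi> b) = \<Gamma>c p (dHA D 1 2 1 (dHB D 2 1 1 \<chi> b) a)"
        if "\<chi> \<in> dual (spH D 2 1)" "b \<in> spB D 2 1" for \<chi> b
        using Gb'[OF x1[OF p a] that] Gc'[OF p that(1) a that(2)] dHA_dHB[of 1 2 a b \<chi>] a that s2 by simp
    qed
    have e2: "y 1 (\<Gamma>a p \<eta>) b = \<Gamma>c p (dHB D 2 1 2 \<eta> b)"
      if p: "p \<in> spP D 2" and \<eta>: "\<eta> \<in> dual (spH D 2 2)" and b: "b \<in> spB D 2 1" for p \<eta> b
    proof (rule tsurj_eq[where f="\<lambda>\<eta>. y 1 (\<Gamma>a p \<eta>) b", OF sA2 bA2 csubspace_dual lin_on_compose[OF bilin_right[OF Ga2 p] y1[OF b]]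
          lin_on_compose[OF bilin_left[OF bB[OF i12(2)] b] bilin_right[OF Gc(1) p]] _ \<eta>])
      show "y 1 (\<Gamma>a p (dHA D 2 2 1 \<chi> a)) b = \<Gamma>c p (dHB D 2 1 2 (dHA D 2 2 1 \<chi> a) b)"
        if "\<chi> \<in> dual (spH D 2 1)" "a \<in> spA D 2 1" for \<chi> a
        using Ga2'[OF p that] Gc'[OF p that b] by simp
    qed
    let ?P = "\<lambda>l i. if l = (1::nat) then if i = (1::nat) then \<Gamma>b else \<Gamma>c else if i = 1 then \<psi> else \<Gamma>a"
    have r: "l = 1 \<or> l = 2" if "l \<in> {1..?s}" for l using that s2 by auto
    have r': "l = 1" if "l \<in> {1..<?s}" for l using that s2 by auto
    have "factors D x \<psi> y ?P"
      unfolding factors_def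
    proof (intro conjI ballI)
      show "bilin_on (spP D i) (dual (spH D l i)) (spQ D l) (?P l i)" if "l \<in> {1..?s}" "i \<in> {1,2}" for l i
        using r[OF that(1)] that(2) bp[OF wW] Ga2 Gb(1) Gc(1) s2 by auto
      show "\<psi> p \<chi> = ?P ?s 1 p \<chi>" for p \<chi> by (simp add: s2)
      show "?P l 1 (x 2 p a) \<chi> = ?P l 2 p (dHA D l 2 1 \<chi> a)"
        if "l \<in> {1..?s}" "p \<in> spP D 2" "\<chi> \<in> dual (spH D l 1)" "a \<in> spA D 2 1" for l p \<chi> a
        using r[OF that(1)] that(2-4) e1 Ga2' by auto
      show "y l (?P (Suc l) i p \<chi>) b = ?P l i p (dHB D (Suc l) l i \<chi> b)"
        if "l \<in> {1..<?s}" "i \<in> {1,2}" "p \<in> spP D i" "\<chi> \<in> dual (spH D (Suc l) i)" "b \<in> spB D (Suc l) l" for l i p \<chi> b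
        using r'[OF that(1)] that(2-5) e2 Gb' by (auto simp: numeral_2_eq_2)
    qed
    then show ?thesis by (rule that)
  qed
qed

end

section \<open>Points of \<open>Z\<close>\<close>

text \<open>The inclusion \<open>M\<^sub>i = M\<^sub>i \<otimes> A\<^sub>i\<^sub>i \<subseteq> P\<^sub>i\<close>.\<close>

definition eps :: "('a::complex_vector, 'b, 'h, 'm::complex_vector, 'n) comp_system \<Rightarrow> nat \<Rightarrow> 'm \<Rightarrow> ('m, 'a) Pvec" where
  "eps D i m = (\<lambda>j. if j = i then pure_tensor (spM D i) (spA D i i) m (eA D i) else 0)"

text \<open>The form with value 1 at \<open>eB D l\<close>; every element of the dual line is a
  multiple of it, the factor being its value at \<open>eB D l\<close>.\<close>

definition unitB :: "('a, 'b::complex_vector, 'h, 'm, 'n) comp_system \<Rightarrow> nat \<Rightarrow> 'b \<Rightarrow> complex" where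
  "unitB D l = dual_unit (spB D l l) (eB D l)"

text \<open>The isomorphism \<open>N\<^sub>l \<otimes> B\<^sub>l\<^sub>l\<^sup>* \<cong> N\<^sub>l\<close>.\<close>

definition nu :: "('a, 'b::complex_vector, 'h, 'm, 'n::complex_vector) comp_system \<Rightarrow> nat \<Rightarrow>
    ('n, 'b \<Rightarrow> complex) tens \<Rightarrow> 'n" where
  "nu D l = inv_into (spN D l) (\<lambda>n. pure_tensor (spN D l) (dual (spB D l l)) n (unitB D l))"

lemma lin_on_single:
  assumes "i \<in> I" "\<And>j. j \<in> I \<Longrightarrow> csubspace (X j)"
  shows "lin_on (X i) (dsum I X) (\<lambda>t j. if j = i then t else 0)"
  using assms complex_vector.subspace_0
  by (intro lin_onI) (auto simp: dsum_def plus_fun_def scaleC_fun_def)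

context two_step
begin

lemma unitB_dual: "l \<in> {1..ns D} \<Longrightarrow> unitB D l \<in> dual (spB D l l)"
  and unitB_expand: "l \<in> {1..ns D} \<Longrightarrow> f \<in> dual (spB D l l) \<Longrightarrow> f = f (eB D l) *\<^sub>C unitB D l"
  using dual_line[of "spB D l l" "eB D l"] B_diag[of l] complex_vector.subspace_scale
  unfolding unitB_def by (auto intro: range_eqI[of _ _ 1] simp: scaleC_one)

lemma nu_props:
  assumes l: "l \<in> {1..ns D}"
  shows "lin_on (tensor (spN D l) (dual (spB D l l))) (spN D l) (nu D l)"
    and "n \<in> spN D l \<Longrightarrow> nu D l (pure_tensor (spN D l) (dual (spB D l l)) n (unitB D l)) = n"
    and "t \<in> tensor (spN D l) (dual (spB D l l)) \<Longrightarrow> pure_tensor (spN D l) (dual (spB D l l)) (nu D l t) (unitB D l) = t"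
proof -
  let ?N = "spN D l" and ?B = "dual (spB D l l)"
  let ?p = "\<lambda>n. pure_tensor ?N ?B n (unitB D l)"
  have fN: "fin_dim ?N" using l by (intro fin_N) auto
  have u: "?B = range (\<lambda>z. z *\<^sub>C unitB D l)" "unitB D l \<noteq> 0"
    using dual_line(2,3)[of "spB D l l" "eB D l"] B_diag[of l] l unfolding unitB_def by auto
  obtain c where c: "lin_on (tensor ?N ?B) ?N c" "\<And>m. m \<in> ?N \<Longrightarrow> c (?p m) = m"
    "\<And>t. t \<in> tensor ?N ?B \<Longrightarrow> ?p (c t) = t"
    by (rule line_tensor[OF fN u], rule that)
  have inj: "inj_on ?p ?N" by (rule inj_onI) (metis c(2))
  have nu: "nu D l t = c t" if "t \<in> tensor ?N ?B" for t
    unfolding nu_def by (rule inv_into_f_eq[OF inj lin_on_mem[OF c(1) that] c(3)[OF that]])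
  show "lin_on (tensor ?N ?B) ?N (nu D l)" by (rule iffD2[OF lin_on_cong[OF csubspace_tensor nu] c(1)])
  show "n \<in> ?N \<Longrightarrow> nu D l (?p n) = n" unfolding nu_def by (rule inv_into_f_f[OF inj])
  show "t \<in> tensor ?N ?B \<Longrightarrow> ?p (nu D l t) = t" using nu c(3) by simp
qed

lemma eps_props:
  assumes i: "i \<in> {1,2}"
  shows "lin_on (spM D i) (spP D i) (eps D i)"
    and "m \<in> spM D i \<Longrightarrow> eps D i m = 0 \<Longrightarrow> m = 0"
    and "t \<in> tensor (spM D i) (spA D i i) \<Longrightarrow> \<exists>m\<in>spM D i. (\<lambda>j. if j = i then t else 0) = eps D i m"
proof -
  let ?M = "spM D i" and ?A = "spA D i i"
  have fM: "fin_dim ?M" using i r2 by (intro fin_M) auto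
  have A: "?A = range (\<lambda>z. z *\<^sub>C eA D i)" "eA D i \<noteq> 0" using A_diag[of i] i r2 by auto
  have e: "eA D i \<in> ?A" using A(1) scaleC_one[of "eA D i"] by (metis rangeI)
  obtain c where c: "lin_on (tensor ?M ?A) ?M c" "\<And>m. m \<in> ?M \<Longrightarrow> c (pure_tensor ?M ?A m (eA D i)) = m"
    "\<And>t. t \<in> tensor ?M ?A \<Longrightarrow> pure_tensor ?M ?A (c t) (eA D i) = t"
    by (rule line_tensor[OF fM A], rule that)
  note p = bilin_left[OF bilin_pure e]
  show "lin_on ?M (spP D i) (eps D i)"
    unfolding eps_def spP_def
    by (rule lin_on_compose[OF p lin_on_single[where X="\<lambda>j. tensor (spM D j) (spA D j i)"]])
      (use i r2 csubspace_tensor in auto)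
  show "m = 0" if "m \<in> ?M" "eps D i m = 0"
    using fun_cong[OF that(2), of i] c(2)[OF that(1)] lin_on_0[OF csubspace_tensor c(1)] by (simp add: eps_def)
  show "\<exists>m\<in>?M. (\<lambda>j. if j = i then t else 0) = eps D i m" if t: "t \<in> tensor ?M ?A"
    using c(3)[OF t] lin_on_mem[OF c(1) t] by (intro bexI[of _ "c t"]) (auto simp: eps_def)
qed

lemma P2_eps: "p \<in> spP D 2 \<Longrightarrow> \<exists>m\<in>spM D 2. p = eps D 2 m"
proof -
  assume p: "p \<in> spP D 2"
  then have "p 2 \<in> tensor (spM D 2) (spA D 2 2)" "p = (\<lambda>j. if j = 2 then p 2 else 0)"
    by (auto simp: spP_def dsum_def r2)
  then show ?thesis using eps_props(3)[of 2 "p 2"] by auto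
qed

text \<open>The inclusion \<open>M\<^sub>2 \<otimes> A\<^sub>2\<^sub>1 \<subseteq> P\<^sub>1\<close>, which is \<open>\<xi>\<^sub>2\<close>.\<close>

definition incl2 :: "('m, 'a) tens \<Rightarrow> ('m, 'a) Pvec" where
  "incl2 t = (\<lambda>j. if j = 2 then t else 0)"

lemma incl2_lin: "lin_on (tensor (spM D 2) (spA D 2 1)) (spP D 1) incl2"
  unfolding incl2_def spP_def
  by (rule lin_on_single[where X="\<lambda>j. tensor (spM D j) (spA D j 1)"]) (use r2 csubspace_tensor in auto)

lemma eA_mem: "i \<in> {1,2} \<Longrightarrow> eA D i \<in> spA D i i"
  using A_diag[of i] r2 scaleC_one[of "eA D i"] by (metis (no_types, lifting) insertE one_le_numeral order_refl rangeI singletonD)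

lemma xi_eps:
  assumes m: "m \<in> spM D 2" and a: "a \<in> spA D 2 1"
  shows "xi D 2 (eps D 2 m) a = incl2 (pure_tensor (spM D 2) (spA D 2 1) m a)"
proof -
  have e: "eA D 2 \<in> spA D 2 2" by (rule eA_mem) simp
  have d: "lin_on (spA D 2 2) (spA D 2 1) (\<lambda>a'. cAA D 2 2 1 a' a)"
    using a r2 by (intro bilin_left[OF bAA]) auto
  have "id_tensor (spM D 2) (spA D 2 2) (spA D 2 1) (\<lambda>a'. cAA D 2 2 1 a' a) (eps D 2 m 2) = pure_tensor (spM D 2) (spA D 2 1) m a"
    using id_tensor_lin(2)[OF sub_M sub_A d m e] AA_unit[of 1 2 a] a r2 by (simp add: eps_def)
  moreover have "eps D 2 m \<in> spP D 2" using lin_on_mem[OF eps_props(1) m] by simp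
  ultimately show ?thesis using a by (auto simp: xi_def res_def incl2_def r2)
qed

text \<open>For r = 2 the space \<open>P\<^sub>1\<close> is the sum of \<open>M\<^sub>1\<close> and
  \<open>M\<^sub>2 \<otimes> A\<^sub>2\<^sub>1\<close>, and by \<open>xi_eps\<close> the second
  summand is spanned by the values of \<open>xi\<close> on \<open>M\<^sub>2\<close>.\<close>

lemma P1_eqI:
  assumes f: "lin_on (spP D 1) X f" and g: "lin_on (spP D 1) X' g"
    and 1: "\<And>m. m \<in> spM D 1 \<Longrightarrow> f (eps D 1 m) = g (eps D 1 m)"
    and 2: "\<And>m a. m \<in> spM D 2 \<Longrightarrow> a \<in> spA D 2 1 \<Longrightarrow> f (xi D 2 (eps D 2 m) a) = g (xi D 2 (eps D 2 m) a)"
    and p: "p \<in> spP D 1"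
  shows "f p = g p"
proof -
  have pj: "p 1 \<in> tensor (spM D 1) (spA D 1 1)" "p 2 \<in> tensor (spM D 2) (spA D 2 1)" and p0: "\<And>j. j \<notin> {1,2} \<Longrightarrow> p j = 0"
    using p by (auto simp: spP_def dsum_def r2)
  obtain m where m: "m \<in> spM D 1" "(\<lambda>j. if j = 1 then p 1 else 0) = eps D 1 m" using eps_props(3)[OF _ pj(1)] by auto
  have e: "eps D 1 m j = (if j = 1 then p 1 else 0)" for j using fun_cong[OF m(2), of j] by simp
  have "p j = (eps D 1 m + incl2 (p 2)) j" for j
    using p0[of j] unfolding plus_fun_apply e incl2_def by (cases "j = 1 \<or> j = 2") auto
  then have eq: "p = eps D 1 m + incl2 (p 2)" by (rule ext)
  have "eps D 1 m \<in> spP D 1" using lin_on_mem[OF eps_props(1) m(1)] by simp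
  moreover have "incl2 (p 2) \<in> spP D 1" by (rule lin_on_mem[OF incl2_lin pj(2)])
  moreover have "f (incl2 (p 2)) = g (incl2 (p 2))"
    by (rule tensor_ext[where f="\<lambda>t. f (incl2 t)", OF lin_on_compose[OF incl2_lin f] lin_on_compose[OF incl2_lin g] _ pj(2)])
      (use 2 xi_eps in simp)
  ultimately have "f (eps D 1 m + incl2 (p 2)) = g (eps D 1 m + incl2 (p 2))"
    using lin_on_add[OF f] lin_on_add[OF g] 1[OF m(1)] by simp
  then show ?thesis using eq by metis
qed

section \<open>The map eta as contraction with elements of B\<close>

lemma eta_pure:
  assumes s: "ns D = 2" and n: "n \<in> spN D 1" and f: "f \<in> dual (spB D 2 1)" and b: "b \<in> spB D 2 1"
  shows "id_tensor (spN D 1) (dual (spB D 2 1)) (dual (spB D 1 1)) (\<lambda>f. dBB D 2 1 1 f b) (pure_tensor (spN D 1) (dual (spB D 2 1)) n f)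
    = f b *\<^sub>C pure_tensor (spN D 1) (dual (spB D 1 1)) n (unitB D 1)"
proof -
  have l: "1 \<in> {1..ns D}" using s by simp
  have sN: "csubspace (spN D 1)" using s by (intro sub_N) auto
  have bb: "bilin_on (dual (spB D 2 1)) (spB D 2 1) (dual (spB D 1 1)) (dBB D 2 1 1)" using s by (intro dBB_bilin) auto
  have d: "dBB D 2 1 1 f b \<in> dual (spB D 1 1)" by (rule bilin_mem[OF bb f b])
  have "eB D 1 \<in> spB D 1 1" using B_diag[of 1] s scaleC_one[of "eB D 1"] by (metis l atLeastAtMost_iff rangeI)
  then have "dBB D 2 1 1 f b (eB D 1) = f b" using BB_unit[of 1 2 b] b s by (simp add: dBB_def res_def)
  then have "dBB D 2 1 1 f b = f b *\<^sub>C unitB D 1" using unitB_expand[OF l d] by simp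
  then show ?thesis
    using id_tensor_lin(2)[OF sN csubspace_dual bilin_left[OF bb b] n f] lin_on_scale[OF bilin_right[OF bilin_pure n] unitB_dual[OF l]] by simp
qed

text \<open>By \<open>eta_pure\<close>, contracting with a basis vector \<open>b'\<close> isolates
  the coefficient of the dual basis vector, so \<open>q 1\<close> is determined by its contractions.
  The component \<open>q 2\<close> is invisible to \<open>eta\<close>.\<close>

lemma eta_injective:
  assumes s: "ns D = 2" and q: "q \<in> spQ D 2" and z: "\<And>b. b \<in> spB D 2 1 \<Longrightarrow> eta D 1 q b = 0"
  shows "q 1 = 0"
proof -
  let ?N = "spN D 1" and ?B = "spB D 2 1"
  have l: "1 \<in> {1..ns D}" using s by simp
  have fN: "fin_dim ?N" and fB: "fin_dim ?B" using s by (auto intro: fin_N fin_B)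
  obtain B where B: "cbasis B ?B" using fB by (rule fin_dim_cbasis)
  let ?f = "\<lambda>b. res ?B (co B b)"
  note Bd = dual_cbasis[OF B]
  obtain c where c: "\<And>f. f \<in> ?f ` B \<Longrightarrow> lin_on (tensor ?N (dual ?B)) ?N (c f)"
    "\<And>f u v. f \<in> ?f ` B \<Longrightarrow> u \<in> ?N \<Longrightarrow> v \<in> dual ?B \<Longrightarrow> c f (pure_tensor ?N (dual ?B) u v) = co (?f ` B) f v *\<^sub>C u"
    "\<And>t. t \<in> tensor ?N (dual ?B) \<Longrightarrow> t = (\<Sum>f\<in>?f ` B. pure_tensor ?N (dual ?B) (c f t) f)"
    by (rule tensor_expand[OF fN Bd(1)], rule that)
  have q1: "q 1 \<in> tensor ?N (dual ?B)" using q by (simp add: spQ_def dsum_def)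
  have fd: "?f b \<in> dual ?B" if "b \<in> B" for b using cbasis_mem[OF Bd(1)] that by blast
  have cm: "c (?f b) (q 1) \<in> ?N" if "b \<in> B" for b using lin_on_mem[OF c(1) q1] that by blast
  have exp: "q 1 = (\<Sum>b\<in>B. pure_tensor ?N (dual ?B) (c (?f b) (q 1)) (?f b))"
    using c(3)[OF q1] unfolding sum.reindex[OF Bd(2)] o_def .
  have "c (?f b') (q 1) = 0" if b': "b' \<in> B" for b'
  proof -
    have b'B: "b' \<in> ?B" by (rule cbasis_mem[OF B b'])
    let ?L = "id_tensor ?N (dual ?B) (dual (spB D 1 1)) (\<lambda>f. dBB D 2 1 1 f b')"
    let ?p = "\<lambda>n. pure_tensor ?N (dual (spB D 1 1)) n (unitB D 1)"
    have d: "lin_on (dual ?B) (dual (spB D 1 1)) (\<lambda>f. dBB D 2 1 1 f b')"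
      using s b'B by (intro bilin_left[OF dBB_bilin]) auto
    have L: "lin_on (tensor ?N (dual ?B)) (tensor ?N (dual (spB D 1 1))) ?L"
      by (rule id_tensor_lin(1)[OF fin_dim_sub[OF fN] csubspace_dual d])
    have "0 = ?L (q 1)" using fun_cong[OF z[OF b'B], of 1] q b'B by (simp add: eta_def res_def numeral_2_eq_2)
    also have "\<dots> = ?L (\<Sum>b\<in>B. pure_tensor ?N (dual ?B) (c (?f b) (q 1)) (?f b))" using exp by simp
    also have "\<dots> = (\<Sum>b\<in>B. ?L (pure_tensor ?N (dual ?B) (c (?f b) (q 1)) (?f b)))"
      by (rule lin_on_sum[OF csubspace_tensor L pure_mem[OF cm fd]])
    also have "\<dots> = (\<Sum>b\<in>B. ?f b b' *\<^sub>C ?p (c (?f b) (q 1)))"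
      by (rule sum.cong[OF refl], rule eta_pure[OF s cm fd b'B])
    also have "\<dots> = (\<Sum>b\<in>B. if b = b' then ?p (c (?f b) (q 1)) else 0)"
    proof (rule sum.cong[OF refl])
      show "?f b b' *\<^sub>C ?p (c (?f b) (q 1)) = (if b = b' then ?p (c (?f b) (q 1)) else 0)" for b
        using b'B co_basis[OF B b', of b] by (cases "b = b'") (simp_all add: res_def scaleC_one)
    qed
    also have "\<dots> = ?p (c (?f b') (q 1))" using cbasis_finite[OF B] b' by simp
    finally have "nu D 1 (?p (c (?f b') (q 1))) = nu D 1 0" by simp
    then show ?thesis
      using nu_props(2)[OF l cm[OF b']] lin_on_0[OF csubspace_tensor nu_props(1)[OF l]] by simp
  qed
  then show "q 1 = 0"
    using exp fd lin_on_0[OF fin_dim_sub[OF fN] bilin_left[OF bilin_pure fd]] by simp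
qed

text \<open>The map is read as
  \<open>Q\<^sub>2 \<rightarrow> Hom(B\<^sub>2\<^sub>1, Q\<^sub>1)\<close>, which is the form in
  which surjectivity of \<open>y\<close> is meant.\<close>

lemma eta_Hom:
  assumes s: "ns D = 2" and y: "bilin_on (spQ D 2) (spB D 2 1) (spQ D 1) y"
  shows "lin_on (spQ D 2) (Hom (spB D 2 1) (spQ D 1)) (\<lambda>q. res (spB D 2 1) (y q))"
proof -
  have sB: "csubspace (spB D 2 1)" using s by (intro sub_B) auto
  have sQ: "csubspace (spQ D 2)" using s by (intro sub_Q) auto
  have "lin_on (spQ D 2) (Hom (spB D 2 1) (spQ D 1)) (res (spQ D 2) (\<lambda>q. res (spB D 2 1) (y q)))"
    by (rule Hom_lin[OF bilin_Hom[OF sQ sB y]])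
  then show ?thesis unfolding lin_on_res[OF sQ] .
qed

text \<open>A preimage of \<open>f\<close> is the sum of \<open>f(b)\<close> tensored with the dual
  vector of \<open>b\<close>, over a basis of \<open>B\<^sub>2\<^sub>1\<close>, placed in the
  summand of \<open>Q\<^sub>2\<close> that belongs to \<open>N\<^sub>1\<close>; \<open>nu\<close>
  brings \<open>f(b)\<close> from \<open>Q\<^sub>1\<close> to \<open>N\<^sub>1\<close>.\<close>

lemma eta_surj:
  assumes s: "ns D = 2" and f: "f \<in> Hom (spB D 2 1) (spQ D 1)"
  shows "\<exists>q\<in>spQ D 2. res (spB D 2 1) (eta D 1 q) = f"
proof -
  let ?N = "spN D 1" and ?B = "spB D 2 1"
  have l: "1 \<in> {1..ns D}" using s by simp
  have fN: "fin_dim ?N" and fB: "fin_dim ?B" using s by (auto intro: fin_N fin_B)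
  obtain B where B: "cbasis B ?B" using fB by (rule fin_dim_cbasis)
  let ?f = "\<lambda>b. res ?B (co B b)"
  let ?p = "\<lambda>n. pure_tensor ?N (dual (spB D 1 1)) n (unitB D 1)"
  have fd: "?f b \<in> dual ?B" if "b \<in> B" for b using cbasis_mem[OF dual_cbasis(1)[OF B]] that by blast
  have f1: "f b 1 \<in> tensor ?N (dual (spB D 1 1))" if "b \<in> ?B" for b
    using Hom_mem[OF f that] by (simp add: spQ_def dsum_def)
  have n: "nu D 1 (f b 1) \<in> ?N" if "b \<in> ?B" for b by (rule lin_on_mem[OF nu_props(1)[OF l] f1[OF that]])
  note BB = cbasis_mem[OF B]
  let ?t = "\<Sum>b\<in>B. pure_tensor ?N (dual ?B) (nu D 1 (f b 1)) (?f b)"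
  let ?q = "\<lambda>k. if k = (1::nat) then ?t else 0"
  have t: "?t \<in> tensor ?N (dual ?B)"
    by (rule complex_vector.subspace_sum[OF csubspace_tensor]) (rule pure_mem[OF n[OF BB] fd])
  then have q: "?q \<in> spQ D 2" using complex_vector.subspace_0[OF csubspace_tensor] by (auto simp: spQ_def dsum_def)
  have "eta D 1 ?q b' = f b'" if b': "b' \<in> ?B" for b'
  proof
    fix k
    let ?L = "id_tensor ?N (dual ?B) (dual (spB D 1 1)) (\<lambda>f. dBB D 2 1 1 f b')"
    have d: "lin_on (dual ?B) (dual (spB D 1 1)) (\<lambda>f. dBB D 2 1 1 f b')"
      using s b' by (intro bilin_left[OF dBB_bilin]) auto
    have L: "lin_on (tensor ?N (dual ?B)) (tensor ?N (dual (spB D 1 1))) ?L"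
      by (rule id_tensor_lin(1)[OF fin_dim_sub[OF fN] csubspace_dual d])
    have "?L ?t = (\<Sum>b\<in>B. ?L (pure_tensor ?N (dual ?B) (nu D 1 (f b 1)) (?f b)))"
      by (rule lin_on_sum[OF csubspace_tensor L pure_mem[OF n[OF BB] fd]])
    also have "\<dots> = (\<Sum>b\<in>B. ?f b b' *\<^sub>C ?p (nu D 1 (f b 1)))"
      by (rule sum.cong[OF refl], rule eta_pure[OF s n[OF BB] fd b'])
    also have "\<dots> = (\<Sum>b\<in>B. co B b b' *\<^sub>C f b 1)"
      using b' nu_props(3)[OF l f1[OF BB]] by (intro sum.cong refl) (simp add: res_def)
    also have "\<dots> = (\<Sum>b\<in>B. co B b b' *\<^sub>C f b) 1" by (simp add: sum_fun_apply scaleC_fun_def)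
    also have "\<dots> = f b' 1" using lin_on_co_expand[OF B Hom_lin[OF f] b'] by simp
    finally show "eta D 1 ?q b' k = f b' k"
      using q b' Hom_mem[OF f b'] by (auto simp: eta_def res_def numeral_2_eq_2 spQ_def dsum_def)
  qed
  then have "res ?B (eta D 1 ?q) = f" using Hom_off[OF f] by (auto simp: res_def fun_eq_iff)
  then show ?thesis using q by blast
qed

section \<open>Recovering phi from a factorisation\<close>

lemma gam_eps:
  assumes \<phi>: "\<phi> \<in> smallW D" and l: "l \<in> {1..ns D}" and i: "i \<in> {1,2}" and m: "m \<in> spM D i"
    and \<chi>: "\<chi> \<in> dual (spH D l i)"
  shows "gam D \<phi> l i (eps D i m) \<chi> l = inner D l l i i \<chi> (eA D i) (\<phi> l i m)"
proof -
  have idx: "1 \<le> i" "i \<le> i" "i \<le> nr D" "1 \<le> l" "l \<le> l" "l \<le> ns D" using i l r2 by auto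
  let ?t = "\<lambda>j. tensor_lift (spM D j) (spA D j i) (\<lambda>\<mu> a. inner D l l j i \<chi> a (\<phi> l j \<mu>)) (eps D i m j)"
  have "gam D \<phi> l i (eps D i m) \<chi> l = (\<Sum>j = i..nr D. ?t j)" using l by (simp add: gam_def res_def)
  also have "\<dots> = (\<Sum>j = i..nr D. if j = i then ?t i else 0)"
    by (rule sum.cong) (auto simp: eps_def tensor_lift_def)
  also have "\<dots> = ?t i" using idx by simp
  also have "\<dots> = inner D l l i i \<chi> (eA D i) (\<phi> l i m)"
    using tensor_lift_pure_bilin[OF sub_M[OF idx(1,3)] sub_A[OF idx(1,2,3)] gam_bilin_aux(1)[OF idx \<phi> \<chi>] m eA_mem[OF i]]
    by (simp add: eps_def)
  finally show ?thesis .
qed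

lemma inner_pure:
  assumes l: "l \<in> {1..ns D}" and i: "i \<in> {1,2}" and \<chi>: "\<chi> \<in> dual (spH D l i)" and n: "n \<in> spN D l" and h: "h \<in> spH D l i"
  shows "inner D l l i i \<chi> (eA D i) (pure_tensor (spN D l) (spH D l i) n h)
    = \<chi> h *\<^sub>C pure_tensor (spN D l) (dual (spB D l l)) n (unitB D l)"
proof -
  have idx: "1 \<le> i" "i \<le> i" "i \<le> nr D" "1 \<le> l" "l \<le> l" "l \<le> ns D" using i l r2 by auto
  have th: "theta D l l i i \<chi> (eA D i) h \<in> dual (spB D l l)"
    by (rule lin_on_mem[OF theta_lin(1)[OF idx \<chi> eA_mem[OF i]] h])
  have "eB D l \<in> spB D l l" using B_diag[OF idx(4,6)] scaleC_one[of "eB D l"] by (metis rangeI)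
  then have "theta D l l i i \<chi> (eA D i) h (eB D l) = \<chi> h"
    using HA_unit[OF idx(1,3,4,6) h] BH_unit[OF idx(1,3,4,6) h] by (simp add: theta_def res_def)
  then have "theta D l l i i \<chi> (eA D i) h = \<chi> h *\<^sub>C unitB D l" using unitB_expand[OF l th] by simp
  then show ?thesis
    using tensor_lift_pure_bilin[OF sub_N[OF idx(4,6)] sub_H[OF idx(1,3,4,6)] inner_bilin(1)[OF idx \<chi> eA_mem[OF i]] n h]
      lin_on_scale[OF bilin_right[OF bilin_pure n] unitB_dual[OF l]]
    by (simp add: inner_def)
qed

text \<open>The map \<open>\<phi> l i\<close> is what \<Psi> does from
  \<open>M\<^sub>i \<subseteq> P\<^sub>i\<close> to the top summand \<open>N\<^sub>l\<close> of
  \<open>Q\<^sub>l\<close>, where only units are composed. Everything else about \<Psi> is forced by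
  the relations with \<open>xi\<close> and \<open>eta\<close>, and \<open>gam\<close> satisfies the
  same relations.\<close>

lemma gam_reconstruct:
  assumes f: "factors D (res {2..nr D} (xi D)) \<psi> (res {1..<ns D} (eta D)) \<Psi>"
  obtains \<phi> where "\<phi> \<in> smallW D" "\<And>p \<chi>. p \<in> spP D 1 \<Longrightarrow> \<chi> \<in> dual (spH D (ns D) 1) \<Longrightarrow> gamma D \<phi> p \<chi> = \<psi> p \<chi>"
proof -
  have "\<exists>C. l \<in> {1..ns D} \<longrightarrow> i \<in> {1,2} \<longrightarrow> cbasis C (spH D l i)" for l i
  proof (cases "l \<in> {1..ns D} \<and> i \<in> {1,2}")
    case True
    then have "fin_dim (spH D l i)" using r2 by (intro fin_H) auto
    then show ?thesis using fin_dim_cbasis by blast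
  qed blast
  then obtain C where C: "\<And>l i. l \<in> {1..ns D} \<Longrightarrow> i \<in> {1,2} \<Longrightarrow> cbasis (C l i) (spH D l i)" by metis
  let ?F = "\<lambda>l i m \<chi>. nu D l (\<Psi> l i (eps D i m) \<chi> l)"
  let ?h = "\<lambda>l i h. res (spH D l i) (co (C l i) h)"
  \<comment> \<open>A bilinear map from M and the dual of H to N becomes a map from M to the tensor
    product of N and H by summing over a basis of H and its dual basis.\<close>
  let ?\<phi>0 = "\<lambda>l i m. \<Sum>h\<in>C l i. pure_tensor (spN D l) (spH D l i) (?F l i m (?h l i h)) h"
  define \<phi> where "\<phi> = res {1..ns D} (\<lambda>l. res {1..nr D} (\<lambda>i. res (spM D i) (?\<phi>0 l i)))"
  have F: "bilin_on (spM D i) (dual (spH D l i)) (spN D l) (?F l i)" if l: "l \<in> {1..ns D}" and i: "i \<in> {1,2}" for l i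
  proof -
    have c: "lin_on (spQ D l) (tensor (spN D l) (dual (spB D l l))) (\<lambda>q. q l)"
      unfolding spQ_def using l by (intro dsum_component) auto
    show ?thesis
      by (rule bilin_compose[where g="\<lambda>\<chi>. \<chi>", OF eps_props(1)[OF i] factors_bilin[OF f l i] lin_on_id lin_on_compose[OF c nu_props(1)[OF l]]])
  qed
  have hd: "?h l i h \<in> dual (spH D l i)" if "l \<in> {1..ns D}" "i \<in> {1,2}" for l i h
    unfolding dual_def by (rule res_Hom[OF cbasis_sub[OF C[OF that]] co_lin[OF C[OF that]]])
  have \<phi>0: "lin_on (spM D i) (tensor (spN D l) (spH D l i)) (?\<phi>0 l i)" if "l \<in> {1..ns D}" "i \<in> {1,2}" for l i
    by (intro lin_on_sum_map csubspace_tensor lin_on_compose[OF bilin_left[OF F[OF that] hd[OF that]] bilin_left[OF bilin_pure]]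
        cbasis_mem[OF C[OF that]])
  have \<phi>: "\<phi> \<in> smallW D"
    unfolding \<phi>_def smallW_def
  proof (intro res_dsum)
    fix l i assume "l \<in> {1..ns D}" and i: "i \<in> {1..nr D}"
    moreover from i have "i \<in> {1,2}" using r2 by auto
    moreover have "csubspace (spM D i)" using i by (intro sub_M) auto
    ultimately show "res (spM D i) (?\<phi>0 l i) \<in> Hom (spM D i) (tensor (spN D l) (spH D l i))"
      by (intro res_Hom \<phi>0)
  qed
  have diag: "gam D \<phi> l i (eps D i m) \<chi> l = \<Psi> l i (eps D i m) \<chi> l"
    if l: "l \<in> {1..ns D}" and i: "i \<in> {1,2}" and m: "m \<in> spM D i" and \<chi>: "\<chi> \<in> dual (spH D l i)" for l i m \<chi>
  proof -
    let ?p = "\<lambda>n. pure_tensor (spN D l) (dual (spB D l l)) n (unitB D l)"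
    have idx: "1 \<le> i" "i \<le> i" "i \<le> nr D" "1 \<le> l" "l \<le> l" "l \<le> ns D" using i l r2 by auto
    note CH = cbasis_mem[OF C[OF l i]] and Fm = bilin_mem[OF F[OF l i] m]
    have "gam D \<phi> l i (eps D i m) \<chi> l = inner D l l i i \<chi> (eA D i) (?\<phi>0 l i m)"
      using gam_eps[OF \<phi> l i m \<chi>] m l i r2 by (auto simp: \<phi>_def res_def)
    also have "\<dots> = (\<Sum>h\<in>C l i. inner D l l i i \<chi> (eA D i) (pure_tensor (spN D l) (spH D l i) (?F l i m (?h l i h)) h))"
      by (rule lin_on_sum[OF csubspace_tensor bilin_right[OF inner_bilin(2)[OF idx \<chi>] eA_mem[OF i]]])
        (rule pure_mem[OF Fm[OF hd[OF l i]] CH])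
    also have "\<dots> = (\<Sum>h\<in>C l i. \<chi> h *\<^sub>C ?p (?F l i m (?h l i h)))"
      by (rule sum.cong[OF refl], rule inner_pure[OF l i \<chi> Fm[OF hd[OF l i]] CH])
    also have "\<dots> = (\<Sum>h\<in>C l i. ?p (?F l i m (\<chi> h *\<^sub>C ?h l i h)))"
      using lin_on_scale[OF lin_on_compose[OF bilin_right[OF F[OF l i] m] bilin_left[OF bilin_pure unitB_dual[OF l]]] hd[OF l i]]
      by simp
    also have "\<dots> = ?p (?F l i m (\<Sum>h\<in>C l i. \<chi> h *\<^sub>C ?h l i h))"
      by (rule lin_on_sum[symmetric, OF csubspace_dual lin_on_compose[OF bilin_right[OF F[OF l i] m] bilin_left[OF bilin_pure unitB_dual[OF l]]]])
        (rule complex_vector.subspace_scale[OF csubspace_dual hd[OF l i]])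
    also have "\<dots> = ?p (?F l i m \<chi>)" using dual_expand[OF C[OF l i] \<chi>] by simp
    also have "\<dots> = \<Psi> l i (eps D i m) \<chi> l"
    proof (rule nu_props(3)[OF l])
      have "\<Psi> l i (eps D i m) \<chi> \<in> spQ D l" by (rule bilin_mem[OF factors_bilin[OF f l i] lin_on_mem[OF eps_props(1)[OF i] m] \<chi>])
      then show "\<Psi> l i (eps D i m) \<chi> l \<in> tensor (spN D l) (dual (spB D l l))" using l by (simp add: spQ_def dsum_def)
    qed
    finally show ?thesis .
  qed
  have fg: "factors D (res {2..nr D} (xi D)) (gamma D \<phi>) (res {1..<ns D} (eta D)) (gam D \<phi>)" by (rule zeta_factors[OF \<phi>])
  have eps: "gam D \<phi> l i (eps D i m) \<chi> = \<Psi> l i (eps D i m) \<chi>"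
    if l: "l \<in> {1..ns D}" and i: "i \<in> {1,2}" and m: "m \<in> spM D i" and \<chi>: "\<chi> \<in> dual (spH D l i)"
      and IH: "\<And>l' p \<chi>. l = Suc l' \<Longrightarrow> 1 \<le> l' \<Longrightarrow> p \<in> spP D i \<Longrightarrow> \<chi> \<in> dual (spH D l' i) \<Longrightarrow> gam D \<phi> l' i p \<chi> = \<Psi> l' i p \<chi>"
    for l i m \<chi>
  proof
    fix k
    have em: "eps D i m \<in> spP D i" by (rule lin_on_mem[OF eps_props(1)[OF i] m])
    have q: "gam D \<phi> l i (eps D i m) \<chi> \<in> spQ D l" "\<Psi> l i (eps D i m) \<chi> \<in> spQ D l"
      using bilin_mem[OF factors_bilin[OF fg l i] em \<chi>] bilin_mem[OF factors_bilin[OF f l i] em \<chi>] by auto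
    \<comment> \<open>Since \<open>ns D \<le> 2\<close>, the only summand below the top one is that
      of \<open>N\<^sub>1\<close> in \<open>Q\<^sub>2\<close>.\<close>
    consider "k = l" | "k \<notin> {1..l}" | "k = 1" "l = 2" "ns D = 2" using l s12 by force
    then show "gam D \<phi> l i (eps D i m) \<chi> k = \<Psi> l i (eps D i m) \<chi> k"
    proof cases
      case 1
      then show ?thesis using diag[OF l i m \<chi>] by simp
    next
      case 2
      then show ?thesis using q by (simp add: spQ_def dsum_def)
    next
      case 3
      have l1: "1 \<in> {1..<ns D}" using 3 by simp
      \<comment> \<open>By the case \<open>l = 1\<close> both vectors have the same contractions, so
        the first component of their difference vanishes by \<open>eta_injective\<close>.\<close>
      let ?q = "gam D \<phi> l i (eps D i m) \<chi> - \<Psi> l i (eps D i m) \<chi>"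
      have sQ: "csubspace (spQ D 2)" using 3 by (intro sub_Q) auto
      have \<chi>2: "\<chi> \<in> dual (spH D 2 i)" using \<chi> 3 by simp
      have "?q 1 = 0"
      proof (rule eta_injective[OF 3(3)])
        show "?q \<in> spQ D 2" using q 3 sQ by (auto intro: complex_vector.subspace_diff)
        fix b assume b: "b \<in> spB D 2 1"
        note Y = factors_y[OF _ l1 i em, of _ _ _ _ \<chi> b, unfolded Suc_1]
        have "dHB D 2 1 i \<chi> b \<in> dual (spH D 1 i)" using i r2 3 by (intro bilin_mem[OF dHB_bilin \<chi>2 b]) auto
        then have "eta D 1 (gam D \<phi> l i (eps D i m) \<chi>) b = eta D 1 (\<Psi> l i (eps D i m) \<chi>) b"
          using Y[OF fg \<chi>2 b] Y[OF f \<chi>2 b] IH[of 1] em 3 by (simp add: res_def)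
        moreover have Lq: "lin_on (spQ D 2) (spQ D 1) (\<lambda>q. eta D 1 q b)"
          using bilin_left[OF eta_bilin[OF l1]] b by (simp add: numeral_2_eq_2)
        ultimately show "eta D 1 ?q b = 0" using lin_on_diff[OF sQ Lq] q 3 by simp
      qed
      then show ?thesis using 3 by simp
    qed
  qed
  have eq: "gam D \<phi> l i p \<chi> = \<Psi> l i p \<chi>"
    if "l \<in> {1..ns D}" "i \<in> {1,2}" "p \<in> spP D i" "\<chi> \<in> dual (spH D l i)" for l i p \<chi>
    using that
  \<comment> \<open>Upwards in \<open>l\<close>, because \<open>eta\<close> compares level
    \<open>l\<close> with the level below; within a level \<open>i = 2\<close> precedes
    \<open>i = 1\<close>, because \<open>P\<^sub>1\<close> contains the image of
    \<open>xi\<close>.\<close>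
  proof (induction l arbitrary: i p \<chi>)
    case 0
    then show ?case by simp
  next
    case (Suc l)
    have IH: "gam D \<phi> l' i p \<chi> = \<Psi> l' i p \<chi>"
      if "Suc l = Suc l'" "1 \<le> l'" "p \<in> spP D i" "\<chi> \<in> dual (spH D l' i)" "i \<in> {1,2}" for l' i p \<chi>
      using Suc.IH[of i p \<chi>] Suc.prems(1) that by simp
    have 2: "gam D \<phi> (Suc l) 2 p \<chi> = \<Psi> (Suc l) 2 p \<chi>" if p: "p \<in> spP D 2" and \<chi>: "\<chi> \<in> dual (spH D (Suc l) 2)" for p \<chi>
    proof -
      obtain m where m: "m \<in> spM D 2" "p = eps D 2 m" using P2_eps[OF p] by blast
      show ?thesis unfolding m(2) by (rule eps[OF Suc.prems(1) _ m(1) \<chi> IH]) auto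
    qed
    show ?case
    proof (cases "i = 2")
      case True
      then show ?thesis using 2 Suc.prems by simp
    next
      case False
      then have i: "i = 1" using Suc.prems by simp
      note \<chi> = Suc.prems(4)[unfolded i]
      show ?thesis unfolding i
      proof (rule P1_eqI[where f="\<lambda>p. gam D \<phi> (Suc l) 1 p \<chi>",
            OF bilin_left[OF factors_bilin[OF fg Suc.prems(1)] \<chi>] bilin_left[OF factors_bilin[OF f Suc.prems(1)] \<chi>]])
        show "gam D \<phi> (Suc l) 1 (eps D 1 m) \<chi> = \<Psi> (Suc l) 1 (eps D 1 m) \<chi>" if "m \<in> spM D 1" for m
          by (rule eps[OF Suc.prems(1) _ that \<chi> IH]) auto
        fix m a assume m: "m \<in> spM D 2" and a: "a \<in> spA D 2 1"
        have em: "eps D 2 m \<in> spP D 2" using lin_on_mem[OF eps_props(1) m] by simp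
        have "dHA D (Suc l) 2 1 \<chi> a \<in> dual (spH D (Suc l) 2)"
          using Suc.prems(1) r2 by (intro bilin_mem[OF dHA_bilin \<chi> a]) auto
        then show "gam D \<phi> (Suc l) 1 (xi D 2 (eps D 2 m) a) \<chi> = \<Psi> (Suc l) 1 (xi D 2 (eps D 2 m) a) \<chi>"
          using factors_x[OF fg Suc.prems(1) em \<chi> a] factors_x[OF f Suc.prems(1) em \<chi> a] 2[OF em] r2 by (simp add: res_def)
      qed (use Suc.prems i in auto)
    qed
  qed
  show ?thesis
  proof (rule that[OF \<phi>])
    fix p \<chi> assume p: "p \<in> spP D 1" and \<chi>: "\<chi> \<in> dual (spH D (ns D) 1)"
    have "gamma D \<phi> p \<chi> = gam D \<phi> (ns D) 1 p \<chi>" by (rule gamma_gam[OF p \<chi>])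
    also have "\<dots> = \<Psi> (ns D) 1 p \<chi>" using ns p \<chi> by (intro eq) auto
    also have "\<dots> = \<psi> p \<chi>" by (rule factors_psi[OF f p \<chi>, symmetric])
    finally show "gamma D \<phi> p \<chi> = \<psi> p \<chi>" .
  qed
qed

text \<open>Injectivity lets an automorphism of \<open>P\<^sub>1\<close> carry the inclusion
  \<open>\<xi>\<^sub>2\<close> to x, and surjectivity lets one of \<open>Q\<^sub>2\<close> match y
  with \<eta>. The translated point then has the linear data of \<open>zeta\<close>, and
  \<open>gam_reconstruct\<close> writes its middle component as \<open>gamma\<close>.\<close>

lemma nondegenerate_in_Zset:
  assumes w: "(x, \<psi>, y) \<in> bigW D" and f: "factors D x \<psi> y \<Psi>"
    and L: "lin_on (tensor (spM D 2) (spA D 2 1)) (spP D 1) L"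
      "\<And>m a. m \<in> spM D 2 \<Longrightarrow> a \<in> spA D 2 1 \<Longrightarrow> L (pure_tensor (spM D 2) (spA D 2 1) m a) = x 2 (eps D 2 m) a"
    and inj: "\<And>t. t \<in> tensor (spM D 2) (spA D 2 1) \<Longrightarrow> L t = 0 \<Longrightarrow> t = 0"
    and surj: "ns D = 2 \<Longrightarrow> y 1 ` spQ D 2 = Hom (spB D 2 1) (spQ D 1)"
  shows "(x, \<psi>, y) \<in> Zset D"
proof -
  have i12: "1 \<in> {1, 2::nat}" "2 \<in> {1, 2::nat}" by auto
  have s: "ns D \<in> {1..ns D}" using ns by simp
  have fT: "fin_dim (tensor (spM D 2) (spA D 2 1))" using r2 by (intro fin_dim_tensor fin_M fin_A) auto
  have i0: "t = 0" if "incl2 t = 0" for t :: "('m, 'a) tens" using fun_cong[OF that, of 2] by (simp add: incl2_def)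
  obtain u where u: "u \<in> GL (spP D 1)" "\<And>t. t \<in> tensor (spM D 2) (spA D 2 1) \<Longrightarrow> u (incl2 t) = L t"
    using GL_conjugate_inj[OF fin_P[OF i12(1)] fT incl2_lin _ L(1) inj] i0 by blast
  have ux: "u (xi D 2 p a) = x 2 p a" if p: "p \<in> spP D 2" and a: "a \<in> spA D 2 1" for p a
  proof -
    obtain m where m: "m \<in> spM D 2" "p = eps D 2 m" using P2_eps[OF p] by blast
    show ?thesis unfolding m(2) xi_eps[OF m(1) a] using u(2)[OF pure_mem[OF m(1) a]] L(2)[OF m(1) a] by simp
  qed
  \<comment> \<open>The implication inside the existential gives one \<open>v\<close> for both
    values of \<open>ns D\<close>.\<close>
  have "\<exists>v. ns D = 2 \<longrightarrow> v \<in> GL (spQ D 2) \<and> (\<forall>q\<in>spQ D 2. \<forall>b\<in>spB D 2 1. y 1 (v q) b = eta D 1 q b)"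
  proof (cases "ns D = 2")
    case True
    then have l1: "1 \<in> {1..<ns D}" by simp
    have fQ: "fin_dim (spQ D 2)" using True by (intro fin_Q) auto
    note by1 = bigW_bilin(3)[OF w l1, unfolded Suc_1] and be = eta_bilin[OF l1, unfolded Suc_1]
    have y1: "y 1 \<in> Hom (spQ D 2) (Hom (spB D 2 1) (spQ D 1))"
      using w l1 unfolding bigW_def dsum_def by (auto simp: numeral_2_eq_2)
    have "res (spB D 2 1) (y 1 q) = y 1 q" if "q \<in> spQ D 2" for q
      using Hom_off[OF Hom_mem[OF y1 that]] by (auto simp: res_def fun_eq_iff)
    then have imy: "(\<lambda>q. res (spB D 2 1) (y 1 q)) ` spQ D 2 = Hom (spB D 2 1) (spQ D 1)" using surj[OF True] by simp
    have ime: "(\<lambda>q. res (spB D 2 1) (eta D 1 q)) ` spQ D 2 = Hom (spB D 2 1) (spQ D 1)"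
      using eta_surj[OF True] lin_on_mem[OF eta_Hom[OF True be]] by blast
    obtain v where v: "v \<in> GL (spQ D 2)" "\<And>q. q \<in> spQ D 2 \<Longrightarrow> res (spB D 2 1) (y 1 (v q)) = res (spB D 2 1) (eta D 1 q)"
      using GL_conjugate_surj[OF fQ eta_Hom[OF True by1] imy eta_Hom[OF True be] ime] by blast
    have "y 1 (v q) b = eta D 1 q b" if "q \<in> spQ D 2" "b \<in> spB D 2 1" for q b
      using fun_cong[OF v(2)[OF that(1)], of b] that(2) by (simp add: res_def)
    then show ?thesis using v(1) by blast
  qed blast
  then obtain v where v: "ns D = 2 \<Longrightarrow> v \<in> GL (spQ D 2)"
    "\<And>q b. ns D = 2 \<Longrightarrow> q \<in> spQ D 2 \<Longrightarrow> b \<in> spB D 2 1 \<Longrightarrow> y 1 (v q) b = eta D 1 q b" by blast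
  define g where "g = (\<lambda>i. if i = 1 then u else res (spP D i) (\<lambda>p. p))"
  define h where "h = (\<lambda>l. if l = 2 then v else res (spQ D l) (\<lambda>q. q))"
  have g: "g i \<in> GL (spP D i)" if "i \<in> {1,2}" for i
    using that u(1) GL_id[OF sub_P[OF that]] by (auto simp: g_def)
  have h: "h l \<in> GL (spQ D l)" if "l \<in> {1..ns D}" for l
  proof (cases "l = 2")
    case True
    then show ?thesis using v(1) that s12 by (auto simp: h_def)
  next
    case False
    then show ?thesis using GL_id[OF sub_Q[OF that]] by (simp add: h_def)
  qed
  have g2: "g 2 p = p" if "p \<in> spP D 2" for p using that by (simp add: g_def res_def)
  have g2i: "inv_into (spP D 2) (g 2) p = p" if "p \<in> spP D 2" for p
    using GL_inv_left[OF g[OF i12(2)] that] g2[OF that] by simp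
  let ?hi = "\<lambda>l. inv_into (spQ D l) (h l)"
  have hi: "lin_on (spQ D l) (spQ D l) (?hi l)" if "l \<in> {1..ns D}" for l
    by (rule GL_inv_lin[OF sub_Q[OF that] h[OF that]])
  have h1: "h 1 q = q" if "q \<in> spQ D 1" for q using that by (simp add: h_def res_def)
  have h1i: "?hi 1 q = q" if "q \<in> spQ D 1" for q
    using GL_inv_left[OF h that] h1[OF that] ns by simp
  have y_eta: "y 1 q b = eta D 1 (?hi 2 q) b" if "ns D = 2" "q \<in> spQ D 2" "b \<in> spB D 2 1" for q b
  proof -
    have h2: "h 2 \<in> GL (spQ D 2)" using that by (intro h) auto
    show ?thesis
      using v(2)[OF that(1) GL_inv_mem[OF h2 that(2)] that(3)] GL_inv_right[OF h2 that(2)] by (simp add: h_def)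
  qed
  let ?\<psi> = "\<lambda>p \<chi>. ?hi (ns D) (\<psi> (g 1 p) \<chi>)"
  have fac: "factors D (res {2..nr D} (xi D)) ?\<psi> (res {1..<ns D} (eta D)) (\<lambda>l i p \<chi>. ?hi l (\<Psi> l i (g i p) \<chi>))"
  proof (rule factors_transport[OF f])
    show "lin_on (spP D i) (spP D i) (g i)" if "i \<in> {1,2}" for i by (rule GL_lin[OF g[OF that]])
    show "g 1 (res {2..nr D} (xi D) 2 p a) = x 2 (g 2 p) a" if "p \<in> spP D 2" "a \<in> spA D 2 1" for p a
      using ux[OF that] g2[OF that(1)] r2 by (simp add: g_def res_def)
    show "res {1..<ns D} (eta D) l (?hi (Suc l) q) b = ?hi l (y l q b)"
      if l: "l \<in> {1..<ns D}" and q: "q \<in> spQ D (Suc l)" and b: "b \<in> spB D (Suc l) l" for l q b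
    proof -
      have "l = 1" "ns D = 2" using l s12 by auto
      then show ?thesis
        using y_eta q b h1i bilin_mem[OF bigW_bilin(3)[OF w l] q b] by (simp add: res_def numeral_2_eq_2)
    qed
  qed (use hi in auto)
  obtain \<phi> where \<phi>: "\<phi> \<in> smallW D"
    "\<And>p \<chi>. p \<in> spP D 1 \<Longrightarrow> \<chi> \<in> dual (spH D (ns D) 1) \<Longrightarrow> gamma D \<phi> p \<chi> = ?\<psi> p \<chi>"
    by (rule gam_reconstruct[OF fac], rule that)
  \<comment> \<open>Equality of points is equality of the representing functions, so their values
    off the domains, all 0, have to be compared as well.\<close>
  have "x i = fst (act D g h (zeta D \<phi>)) i" for i
  proof (cases "i = 2")
    case True
    have x2: "x 2 \<in> Hom (spP D 2) (Hom (spA D 2 1) (spP D 1))"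
      using w r2 unfolding bigW_def dsum_def by force
    have "x 2 p a = res (spP D 2) (\<lambda>p. res (spA D 2 1) (\<lambda>a. u (xi D 2 (inv_into (spP D 2) (g 2) p) a))) p a" for p a
      using ux g2i Hom_off[OF x2] Hom_off[OF Hom_mem[OF x2]] by (auto simp: res_def)
    then show ?thesis using True r2 by (auto simp: act_def zeta_def res_def g_def fun_eq_iff)
  next
    case False
    then show ?thesis using w r2 by (auto simp: act_def zeta_def res_def bigW_def dsum_def)
  qed
  moreover have "\<psi> p \<chi> = fst (snd (act D g h (zeta D \<phi>))) p \<chi>" for p \<chi>
  proof (cases "p \<in> spP D 1 \<and> \<chi> \<in> dual (spH D (ns D) 1)")
    case True
    have gp: "inv_into (spP D 1) (g 1) p \<in> spP D 1" "g 1 (inv_into (spP D 1) (g 1) p) = p"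
      using GL_inv_mem[OF g[OF i12(1)]] GL_inv_right[OF g[OF i12(1)]] True by auto
    have "fst (snd (act D g h (zeta D \<phi>))) p \<chi> = h (ns D) (?hi (ns D) (\<psi> p \<chi>))"
      using True \<phi>(2)[OF gp(1)] gp(2) by (simp add: act_def zeta_def res_def)
    also have "\<dots> = \<psi> p \<chi>" using GL_inv_right[OF h[OF s]] bilin_mem[OF bigW_bilin(2)[OF w]] True by simp
    finally show ?thesis by simp
  next
    case False
    have H: "\<psi> \<in> Hom (spP D 1) (Hom (dual (spH D (ns D) 1)) (spQ D (ns D)))" using w unfolding bigW_def by auto
    have "\<psi> p \<chi> = 0" using False Hom_off[OF H, of p] Hom_off[OF Hom_mem[OF H]] by (cases "p \<in> spP D 1") auto
    then show ?thesis using False by (auto simp: act_def zeta_def res_def)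
  qed
  moreover have "y l = snd (snd (act D g h (zeta D \<phi>))) l" for l
  proof (cases "l \<in> {1..<ns D}")
    case True
    then have l: "l = 1" and s2: "ns D = 2" using s12 by auto
    have y1: "y 1 \<in> Hom (spQ D 2) (Hom (spB D 2 1) (spQ D 1))"
      using w True l unfolding bigW_def dsum_def by (auto simp: numeral_2_eq_2)
    have "y 1 q b \<in> spQ D 1" if "q \<in> spQ D 2" "b \<in> spB D 2 1" for q b
      using bilin_mem[OF bigW_bilin(3)[OF w True]] that l by (simp add: numeral_2_eq_2)
    then have "eta D 1 (?hi 2 q) b \<in> spQ D 1" if "q \<in> spQ D 2" "b \<in> spB D 2 1" for q b
      using that unfolding y_eta[OF s2 that, symmetric] by blast
    then have "y 1 q b = res (spQ D 2) (\<lambda>q. res (spB D 2 1) (\<lambda>b. h 1 (eta D 1 (?hi 2 q) b))) q b" for q b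
      using y_eta[OF s2] h1 Hom_off[OF y1] Hom_off[OF Hom_mem[OF y1]] by (auto simp: res_def)
    then show ?thesis using l s2 by (auto simp: act_def zeta_def res_def fun_eq_iff numeral_2_eq_2)
  next
    case False
    then show ?thesis using w by (auto simp: act_def zeta_def res_def bigW_def dsum_def)
  qed
  ultimately have "(x, \<psi>, y) = act D g h (zeta D \<phi>)"
    by (intro prod_eqI) (auto simp: fun_eq_iff)
  moreover have "i \<in> {1,2}" if "i \<in> {1..nr D}" for i using that r2 by auto
  then have "\<forall>i\<in>{1..nr D}. g i \<in> GL (spP D i)" using g by blast
  moreover have "\<forall>l\<in>{1..ns D}. h l \<in> GL (spQ D l)" using h by blast
  ultimately show ?thesis unfolding Zset_def using \<phi>(1) by blast
qed

end

section \<open>Destabilising families\<close>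

lemma ann_spanI:
  assumes "v \<in> V" "\<And>F. F \<in> S \<Longrightarrow> F v = 0"
  shows "v \<in> ann V (cspan S)"
proof -
  have "F v \<in> {0}" if "F \<in> cspan S" for F
    by (rule lin_on_span_into[OF complex_vector.subspace_UNIV lin_on_eval complex_vector.subspace_single_0 subset_UNIV _ that])
      (use assms(2) in simp)
  then show ?thesis using assms(1) by (simp add: ann_def)
qed

text \<open>Here \<open>k\<close> and \<open>t\<close> are the dimensions of P_1' and M',
  \<open>a\<close> is a_21 and \<open>C\<close> is the sum of beta_l c_l. Multiplying the stability
  inequality by \<open>a\<close> makes the hypothesis on \<open>C\<close> applicable, and what is
  left contradicts \<open>k < t * a\<close>.\<close>

lemma unstable_arith_x:
  fixes al1 al2 :: real
  assumes "al1 * k + al2 * t \<le> C * k" "k < t * a" "al2 > 0" "a * C \<le> a * al1 + al2" "0 \<le> a" "0 \<le> k"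
  shows False
proof -
  have "a * (al1 * k + al2 * t) \<le> a * (C * k)" using assms(1,5) by (rule mult_left_mono)
  also have "\<dots> \<le> (a * al1 + al2) * k" using mult_right_mono[OF assms(4,6)] by (simp add: mult.assoc)
  finally have "al2 * (t * a) \<le> al2 * k" by (simp add: algebra_simps)
  then show False using assms(2,3) by simp
qed

text \<open>The test spaces are annihilators of spaces of dimensions \<open>s1\<close>,
  \<open>s2\<close>, \<open>t\<close>, \<open>k\<close>. Since the total weights balance, the
  stability inequality reverses when it is rewritten in these dimensions, and the computation of
  \<open>unstable_arith_x\<close> applies with the two sides exchanged.\<close>

lemma unstable_arith_y:
  fixes al1 al2 be1 be2 d1 d2 :: real and p1 p2 q1 q2 s1 s2 t k b :: nat
  assumes "al1 * p1' + al2 * p2' \<le> be1 * q1' + be2 * q2'"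
    and "p1' + s1 = p1" "p2' + s2 = p2" "q1' + t = q1" "q2' + k = q2"
    and "al1 * p1 + al2 * p2 = be1 * q1 + be2 * q2" "s1 \<le> d1 * k" "s2 \<le> d2 * k"
    and "al1 > 0" "al2 > 0" "be1 > 0" "b * (al1 * d1 + al2 * d2) \<le> be1 + b * be2"
    and "real k < real t * real b"
  shows False
proof -
  have "be1 * t + be2 * k \<le> al1 * s1 + al2 * s2"
    using assms(1,6) unfolding assms(2-5)[symmetric] by (simp add: algebra_simps)
  also have "\<dots> \<le> al1 * (d1 * k) + al2 * (d2 * k)"
    using assms(7-10) by (intro add_mono mult_left_mono) auto
  finally have "b * (be1 * t + be2 * k) \<le> b * (al1 * (d1 * k) + al2 * (d2 * k))"
    by (rule mult_left_mono) simp
  also have "\<dots> \<le> (be1 + b * be2) * k"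
    using mult_right_mono[OF assms(12), of "real k"] by (simp add: algebra_simps)
  finally have "be1 * (real t * b) \<le> be1 * k" by (simp add: algebra_simps)
  then show False using assms(11,13) by simp
qed

context two_step
begin

lemma semistableD:
  assumes st: "(x, \<psi>, y) \<in> semistable D al be"
    and P: "\<And>i. i \<in> {1,2} \<Longrightarrow> csubspace (P' i) \<and> P' i \<subseteq> spP D i"
    and Q: "\<And>l. l \<in> {1..ns D} \<Longrightarrow> csubspace (Q' l) \<and> Q' l \<subseteq> spQ D l"
    and n0: "\<not> ((\<forall>i\<in>{1,2}. P' i = {0}) \<and> (\<forall>l\<in>{1..ns D}. Q' l = {0}))"
    and n1: "\<not> ((\<forall>i\<in>{1,2}. P' i = spP D i) \<and> (\<forall>l\<in>{1..ns D}. Q' l = spQ D l))"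
    and x: "\<And>p a. p \<in> P' 2 \<Longrightarrow> a \<in> spA D 2 1 \<Longrightarrow> x 2 p a \<in> P' 1"
    and \<psi>: "\<And>p \<chi>. p \<in> P' 1 \<Longrightarrow> \<chi> \<in> dual (spH D (ns D) 1) \<Longrightarrow> \<psi> p \<chi> \<in> Q' (ns D)"
    and y: "\<And>l q b. l \<in> {1..<ns D} \<Longrightarrow> q \<in> Q' (Suc l) \<Longrightarrow> b \<in> spB D (Suc l) l \<Longrightarrow> y l q b \<in> Q' l"
  shows "al 1 * real (cdim (P' 1)) + al 2 * real (cdim (P' 2)) \<le> (\<Sum>l = 1..ns D. be l * real (cdim (Q' l)))"
proof -
  have r: "{1..nr D} = {1,2}" "{2..nr D} = {2}" using r2 by auto
  have "(\<Sum>i\<in>{1..nr D}. al i * real (cdim (P' i))) - (\<Sum>l = 1..ns D. be l * real (cdim (Q' l))) \<le> 0"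
    using st unfolding semistable_def
    by (elim CollectE case_prodE conjE) (simp only: prod.inject, elim conjE allE[of _ P'] allE[of _ Q'] impE,
      use P Q n0 n1 x \<psi> y r in auto)
  then show ?thesis unfolding r by simp
qed

lemma degenerate_x_unstable:
  assumes w: "(x, \<psi>, y) \<in> bigW D" and f: "factors D x \<psi> y \<Psi>"
    and L: "lin_on (tensor (spM D 2) (spA D 2 1)) (spP D 1) L"
      "\<And>m a. m \<in> spM D 2 \<Longrightarrow> a \<in> spA D 2 1 \<Longrightarrow> L (pure_tensor (spM D 2) (spA D 2 1) m a) = x 2 (eps D 2 m) a"
    and K: "t0 \<in> tensor (spM D 2) (spA D 2 1)" "t0 \<noteq> 0" "L t0 = 0"
    and pos: "al 2 > 0" "\<And>l. l \<in> {1..ns D} \<Longrightarrow> be l > 0"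
    and ineq: "dimA D 2 1 * (\<Sum>l = 1..ns D. be l * c_const D l) \<le> dimA D 2 1 * al 1 + al 2"
  shows "(x, \<psi>, y) \<notin> semistable D al be"
proof
  assume st: "(x, \<psi>, y) \<in> semistable D al be"
  let ?T = "spM D 2" and ?V = "spA D 2 1"
  let ?\<beta> = "\<lambda>m a. x 2 (eps D 2 m) a"
  have i12: "1 \<in> {1, 2::nat}" "2 \<in> {1, 2::nat}" by auto
  have fT: "fin_dim ?T" and fV: "fin_dim ?V" using r2 by (auto intro: fin_M fin_A)
  note e = eps_props(1)[OF i12(2)]
  have \<beta>: "bilin_on ?T ?V (spP D 1) ?\<beta>"
    by (rule bilin_compose[where g="\<lambda>a. a" and h="\<lambda>p. p", OF e bigW_bilin(1)[OF w] lin_on_id lin_on_id])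
  let ?K = "{t \<in> tensor ?T ?V. L t = 0}"
  have Kt: "?K \<subseteq> tensor ?T ?V" by blast
  obtain T' where T': "csubspace T'" "T' \<subseteq> ?T" "?K \<subseteq> subtensor ?T ?V T' ?V"
    "\<And>T1. csubspace T1 \<Longrightarrow> T1 \<subseteq> ?T \<Longrightarrow> ?K \<subseteq> subtensor ?T ?V T1 ?V \<Longrightarrow> T' \<subseteq> T1"
    by (rule tensor_support_exists[OF fT fV Kt], rule that)
  let ?I = "cspan {?\<beta> t v |t v. t \<in> T' \<and> v \<in> ?V}"
  \<comment> \<open>Described by the factored map \<Psi>, not by composites of \<psi> and
    \<open>y\<close>, because in this form \<open>codim_bound\<close> estimates the
    dimension.\<close>
  let ?R = "\<lambda>l. cspan {\<Psi> l 2 (eps D 2 t) \<eta> |t \<eta>. t \<in> T' \<and> \<eta> \<in> dual (spH D l 2)}"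
  have \<sigma>: "bilin_on ?T (dual (spH D l 2)) (spQ D l) (\<lambda>t \<eta>. \<Psi> l 2 (eps D 2 t) \<eta>)" if "l \<in> {1..ns D}" for l
    by (rule bilin_compose[where g="\<lambda>a. a" and h="\<lambda>p. p", OF e factors_bilin[OF f that i12(2)] lin_on_id lin_on_id])
  have bound: "real (cdim (?R l)) \<le> c_const D l * real (cdim ?I)" if l: "l \<in> {1..ns D}" for l
    unfolding c_const_def
  proof (rule codim_bound[OF fT fV _ \<beta> sub_P[OF i12(1)] L K T' _ _ \<sigma>[OF l] sub_Q[OF l] factors_bilin[OF f l i12(1)]])
    show "fin_dim (dual (spH D l 2))" using l r2 by (intro fin_dim_dual fin_H) auto
    show "bilin_on (dual (spH D l 1)) ?V (dual (spH D l 2)) (dHA D l 2 1)" using l r2 by (intro dHA_bilin) auto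
    show "tsurj (dHA D l 2 1) (dual (spH D l 1)) ?V (dual (spH D l 2))" using l r2 by (intro dHA_surj) auto
    show "\<Psi> l 1 (x 2 (eps D 2 t) v) \<chi> = \<Psi> l 2 (eps D 2 t) (dHA D l 2 1 \<chi> v)"
      if "t \<in> ?T" "v \<in> ?V" "\<chi> \<in> dual (spH D l 1)" for t v \<chi>
      by (rule factors_x[OF f l lin_on_mem[OF e that(1)] that(3,2)])
  qed
  have strict: "cdim ?I < cdim T' * cdim ?V"
    by (rule support_image_strict[OF fT fV L K T'(1-3)])
  let ?P = "\<lambda>i. if i = (1::nat) then ?I else eps D 2 ` T'"
  have eT: "lin_on T' (spP D 2) (eps D 2)" using e T'(2) by (rule lin_on_subset) simp
  have fT': "fin_dim T'" by (rule fin_dim_subspace[OF fT T'(1,2)])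
  have dT': "cdim (eps D 2 ` T') = cdim T'"
    by (rule cdim_image_inj[OF fT' eT]) (use eps_props(2)[OF i12(2)] T'(2) in auto)
  have I_sub: "?I \<subseteq> spP D 1"
    using T'(2) bilin_mem[OF \<beta>] by (intro complex_vector.span_minimal sub_P[OF i12(1)]) auto
  have R_sub: "?R l \<subseteq> spQ D l" if "l \<in> {1..ns D}" for l
    using T'(2) bilin_mem[OF \<sigma>[OF that]] by (intro complex_vector.span_minimal sub_Q[OF that]) auto
  \<comment> \<open>Invariance of the family rests on the factorisation: on a value of
    \<open>x\<close> the map \<open>\<Psi> l 1\<close> becomes \<open>\<Psi> l 2\<close> at a
    contracted functional, which stays inside \<open>?R l\<close>.\<close>
  have \<psi>R: "\<Psi> l 1 p \<chi> \<in> ?R l" if l: "l \<in> {1..ns D}" and p: "p \<in> ?I" and \<chi>: "\<chi> \<in> dual (spH D l 1)" for l p \<chi>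
  proof (rule lin_on_span_into[where f="\<lambda>p. \<Psi> l 1 p \<chi>", OF sub_P[OF i12(1)] bilin_left[OF factors_bilin[OF f l i12(1)] \<chi>] complex_vector.subspace_span _ _ p])
    show "{?\<beta> t v |t v. t \<in> T' \<and> v \<in> ?V} \<subseteq> spP D 1" using T'(2) bilin_mem[OF \<beta>] by auto
    fix s assume "s \<in> {?\<beta> t v |t v. t \<in> T' \<and> v \<in> ?V}"
    then obtain t v where tv: "s = ?\<beta> t v" "t \<in> T'" "v \<in> ?V" by blast
    have "dHA D l 2 1 \<chi> v \<in> dual (spH D l 2)" using l r2 by (intro bilin_mem[OF dHA_bilin \<chi> tv(3)]) auto
    moreover have "\<Psi> l 1 s \<chi> = \<Psi> l 2 (eps D 2 t) (dHA D l 2 1 \<chi> v)"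
      unfolding tv(1) by (rule factors_x[OF f l lin_on_mem[OF eT tv(2)] \<chi> tv(3)])
    ultimately show "\<Psi> l 1 s \<chi> \<in> ?R l" using tv(2) by (intro complex_vector.span_base) blast
  qed
  have st': "al 1 * real (cdim (?P 1)) + al 2 * real (cdim (?P 2)) \<le> (\<Sum>l = 1..ns D. be l * real (cdim (?R l)))"
  proof (rule semistableD[OF st])
    show "csubspace (?P i) \<and> ?P i \<subseteq> spP D i" if "i \<in> {1,2}" for i
      using that I_sub lin_on_image_subspace[OF T'(1) eT] lin_on_mem[OF eT] by auto
    show "csubspace (?R l) \<and> ?R l \<subseteq> spQ D l" if "l \<in> {1..ns D}" for l using R_sub[OF that] by simp
    \<comment> \<open>The strict drop in rank excludes both trivial families: it forces
      \<open>T'\<close> to be nonzero, and it keeps \<open>?I\<close> smaller than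
      \<open>P\<^sub>1\<close>.\<close>
    have "cdim T' \<noteq> 0"
    proof
      assume "cdim T' = 0"
      then have "cdim T' * cdim ?V = 0" by (simp only: mult_zero_left)
      then show False using strict by linarith
    qed
    then have "?P 2 \<noteq> {0}" using dT' by auto
    then show "\<not> ((\<forall>i\<in>{1,2}. ?P i = {0}) \<and> (\<forall>l\<in>{1..ns D}. ?R l = {0}))" using i12(2) by blast
    have "cdim T' * cdim ?V \<le> cdim ?T * cdim ?V" by (intro mult_right_mono cdim_mono[OF fT T'(1,2)]) simp
    then have "cdim ?I \<noteq> cdim (spP D 1)" using strict dim_P1 by linarith
    then have "?I \<noteq> spP D 1" by metis
    then have "?P 1 \<noteq> spP D 1" unfolding if_P[OF refl] .
    then show "\<not> ((\<forall>i\<in>{1,2}. ?P i = spP D i) \<and> (\<forall>l\<in>{1..ns D}. ?R l = spQ D l))" using i12(1) by blast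
    show "x 2 p a \<in> ?P 1" if "p \<in> ?P 2" "a \<in> ?V" for p a
      using that by (auto intro: complex_vector.span_base)
    show "\<psi> p \<chi> \<in> ?R (ns D)" if "p \<in> ?P 1" "\<chi> \<in> dual (spH D (ns D) 1)" for p \<chi>
      using that \<psi>R[of "ns D" p \<chi>] factors_psi[OF f _ that(2), of p] I_sub ns by auto
    fix l q b assume l: "l \<in> {1..<ns D}" and q: "q \<in> ?R (Suc l)" and b: "b \<in> spB D (Suc l) l"
    have Sl: "Suc l \<in> {1..ns D}" using l by auto
    show "y l q b \<in> ?R l"
    proof (rule lin_on_span_into[where f="\<lambda>q. y l q b", OF sub_Q[OF Sl] bilin_left[OF bigW_bilin(3)[OF w l] b] complex_vector.subspace_span _ _ q])
      show "{\<Psi> (Suc l) 2 (eps D 2 t) \<eta> |t \<eta>. t \<in> T' \<and> \<eta> \<in> dual (spH D (Suc l) 2)} \<subseteq> spQ D (Suc l)"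
        using T'(2) bilin_mem[OF \<sigma>[OF Sl]] by auto
      fix s assume "s \<in> {\<Psi> (Suc l) 2 (eps D 2 t) \<eta> |t \<eta>. t \<in> T' \<and> \<eta> \<in> dual (spH D (Suc l) 2)}"
      then obtain t \<eta> where te: "s = \<Psi> (Suc l) 2 (eps D 2 t) \<eta>" "t \<in> T'" "\<eta> \<in> dual (spH D (Suc l) 2)" by blast
      have "dHB D (Suc l) l 2 \<eta> b \<in> dual (spH D l 2)" using l r2 by (intro bilin_mem[OF dHB_bilin te(3) b]) auto
      moreover have "y l s b = \<Psi> l 2 (eps D 2 t) (dHB D (Suc l) l 2 \<eta> b)"
        unfolding te(1) by (rule factors_y[OF f l i12(2) lin_on_mem[OF eT te(2)] te(3) b])
      ultimately show "y l s b \<in> ?R l" using te(2) by (intro complex_vector.span_base) blast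
    qed
  qed
  let ?k = "real (cdim ?I)" and ?t = "real (cdim T')" and ?a = "dimA D 2 1"
  have d: "real (cdim (?P 1)) = ?k" "real (cdim (?P 2)) = ?t" using dT' by (simp_all only: if_P[OF refl]) simp
  have "(\<Sum>l = 1..ns D. be l * real (cdim (?R l))) \<le> (\<Sum>l = 1..ns D. be l * c_const D l) * ?k"
    unfolding sum_distrib_right mult.assoc by (rule sum_mono, rule mult_left_mono[OF bound less_imp_le[OF pos(2)]])
  then have "al 1 * ?k + al 2 * ?t \<le> (\<Sum>l = 1..ns D. be l * c_const D l) * ?k"
    using st' unfolding d by (rule order_trans[rotated])
  moreover have "?k < ?t * ?a" using strict unfolding of_nat_mult[symmetric] of_nat_less_iff .
  ultimately show False by (rule unstable_arith_x[OF _ _ pos(1) ineq of_nat_0_le_iff of_nat_0_le_iff])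
qed

text \<open>The argument for x is applied to the transpose of y, a map from
  \<open>N\<^sub>1\<^sup>* \<otimes> B\<^sub>2\<^sub>1\<close> to \<open>Q\<^sub>2\<^sup>*\<close>,
  which has a nonzero kernel when y is not onto. The spaces obtained in this way live in the duals,
  and their annihilators are the destabilising family.\<close>

lemma degenerate_y_unstable:
  assumes w: "(x, \<psi>, y) \<in> bigW D" and f: "factors D x \<psi> y \<Psi>" and s: "ns D = 2"
    and ns: "y 1 ` spQ D 2 \<noteq> Hom (spB D 2 1) (spQ D 1)"
    and pos: "al 1 > 0" "al 2 > 0" "be 1 > 0"
    and total: "al 1 * real (cdim (spP D 1)) + al 2 * real (cdim (spP D 2)) = be 1 * real (cdim (spQ D 1)) + be 2 * real (cdim (spQ D 2))"
    and ineq: "dimB D 2 1 * (al 1 * d_const D 1 + al 2 * d_const D 2) \<le> be 1 + dimB D 2 1 * be 2"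
  shows "(x, \<psi>, y) \<notin> semistable D al be"
proof
  assume st: "(x, \<psi>, y) \<in> semistable D al be"
  let ?N = "spN D 1" and ?V = "spB D 2 1" and ?Q1 = "spQ D 1" and ?Q2 = "spQ D 2"
  let ?T = "dual ?N"
  have i12: "1 \<in> {1, 2::nat}" "2 \<in> {1, 2::nat}" by auto
  have l12: "1 \<in> {1..ns D}" "2 \<in> {1..ns D}" "1 \<in> {1..<ns D}" using s by auto
  have fN: "fin_dim ?N" and fV: "fin_dim ?V" using s by (auto intro: fin_N fin_B)
  note sN = fin_dim_sub[OF fN] and sV = fin_dim_sub[OF fV]
  have fT: "fin_dim ?T" by (rule fin_dim_dual[OF fN])
  note fQ1 = fin_Q[OF l12(1)] and fQ2 = fin_Q[OF l12(2)]
  note sQ1 = fin_dim_sub[OF fQ1] and sQ2 = fin_dim_sub[OF fQ2]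
  note by1 = bigW_bilin(3)[OF w l12(3), unfolded Suc_1]
  have y1: "y 1 \<in> Hom ?Q2 (Hom ?V ?Q1)"
    using w l12 unfolding bigW_def dsum_def by (auto simp: numeral_2_eq_2)

  \<comment> \<open>Since \<open>B\<^sub>1\<^sub>1\<close> is a line, \<open>?j\<close> and
    \<open>?\<iota>\<close> identify \<open>Q\<^sub>1\<close> with \<open>N\<^sub>1\<close>.\<close>
  let ?j = "\<lambda>q. nu D 1 (q 1)" and ?\<iota> = "\<lambda>n k. if k = (1::nat) then pure_tensor ?N (dual (spB D 1 1)) n (unitB D 1) else 0"
  have c1: "lin_on ?Q1 (tensor ?N (dual (spB D 1 1))) (\<lambda>q. q 1)" unfolding spQ_def by (rule dsum_component) simp
  have j: "lin_on ?Q1 ?N ?j" by (rule lin_on_compose[OF c1 nu_props(1)[OF l12(1)]])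
  have \<iota>: "lin_on ?N ?Q1 ?\<iota>"
    unfolding spQ_def
    by (rule lin_on_compose[OF bilin_left[OF bilin_pure unitB_dual[OF l12(1)]] lin_on_single[where X="\<lambda>m. tensor (spN D m) (dual (spB D 1 m))"]])
      (auto intro: csubspace_tensor)
  have \<iota>j: "?\<iota> (?j q) = q" if "q \<in> ?Q1" for q
    using nu_props(3)[OF l12(1) lin_on_mem[OF c1 that]] that by (auto simp: spQ_def dsum_def)
  have j\<iota>: "?j (?\<iota> n) = n" if "n \<in> ?N" for n using nu_props(2)[OF l12(1) that] by simp

  have G: "bilin_on ?Q2 ?V ?N (\<lambda>q b. ?j (y 1 q b))"
    by (rule bilin_compose[where f="\<lambda>q. q" and g="\<lambda>b. b", OF lin_on_id by1 lin_on_id j])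
  let ?\<beta> = "\<lambda>F b. res ?Q2 (\<lambda>q. F (?j (y 1 q b)))"
  have \<beta>: "bilin_on ?T ?V (dual ?Q2) ?\<beta>" by (rule dual_comp_bilin[OF sQ2 G])
  obtain L where L: "lin_on (tensor ?T ?V) (dual ?Q2) L"
    "\<And>F b. F \<in> ?T \<Longrightarrow> b \<in> ?V \<Longrightarrow> L (pure_tensor ?T ?V F b) = ?\<beta> F b"
    by (rule bilin_lift[OF fT fV csubspace_dual \<beta>], rule that)

  \<comment> \<open>A functional \<Theta> on \<open>Hom(B\<^sub>2\<^sub>1, Q\<^sub>1)\<close> that
    kills the image of \<open>y\<close> is the same thing as an element of
    \<open>N\<^sub>1\<^sup>* \<otimes> B\<^sub>2\<^sub>1\<close>, and as such it lies in the kernel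
    of \<open>L\<close>.\<close>
  have "\<exists>t0. t0 \<in> tensor ?T ?V \<and> t0 \<noteq> 0 \<and> L t0 = 0"
  proof -
    let ?H = "Hom ?V ?Q1"
    have fH: "fin_dim ?H" by (rule fin_dim_Hom[OF fV fQ1])
    have "csubspace (y 1 ` ?Q2)" by (rule lin_on_image_subspace[OF sQ2 Hom_lin[OF y1]])
    moreover have "y 1 ` ?Q2 \<subset> ?H" using ns Hom_mem[OF y1] by auto
    ultimately obtain \<Theta> where \<Theta>: "\<Theta> \<in> dual ?H" "\<And>u. u \<in> y 1 ` ?Q2 \<Longrightarrow> \<Theta> u = 0" "\<exists>g\<in>?H. \<Theta> g \<noteq> 0"
      using dual_annihilates_proper[OF fH] by blast
    obtain B where B: "cbasis B ?V" using fV by (rule fin_dim_cbasis)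
    \<comment> \<open>The rank one maps built from a coordinate functional and a vector of
      \<open>N\<^sub>1\<close>; they span the Hom space, and the values of \<Theta> on them are the
      coefficients \<open>?f b\<close>.\<close>
    let ?E = "\<lambda>b n. res ?V (\<lambda>v. co B b v *\<^sub>C ?\<iota> n)"
    have "bilin_on ?N ?V ?Q1 (\<lambda>n v. co B b v *\<^sub>C ?\<iota> n)" for b
      unfolding bilin_on_def
      using lin_on_scale_map[OF sQ1 \<iota>] lin_on_coeff[OF sQ1 co_lin[OF B] lin_on_mem[OF \<iota>]] by blast
    from bilin_Hom[OF sN sV this] have "lin_on ?N ?H (res ?N (?E b))" for b by (rule Hom_lin)
    then have E: "lin_on ?N ?H (?E b)" for b unfolding lin_on_res[OF sN] .
    let ?f = "\<lambda>b. res ?N (\<lambda>n. \<Theta> (?E b n))"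
    have fd: "?f b \<in> ?T" for b
      by (rule iffD2[OF dual_iff res_Hom[OF sN lin_on_compose[OF E dual_lin[OF \<Theta>(1)]]]])
    have \<Theta>g: "\<Theta> g = (\<Sum>b\<in>B. ?f b (?j (g b)))" if g: "g \<in> ?H" for g
    proof -
      have gb: "g b \<in> ?Q1" if "b \<in> B" for b by (rule Hom_mem[OF g cbasis_mem[OF B that]])
      have "g = (\<Sum>b\<in>B. ?E b (?j (g b)))"
      proof
        fix v
        show "g v = (\<Sum>b\<in>B. ?E b (?j (g b))) v"
        proof (cases "v \<in> ?V")
          case True
          have "(\<Sum>b\<in>B. ?E b (?j (g b))) v = (\<Sum>b\<in>B. co B b v *\<^sub>C ?\<iota> (?j (g b)))"
            using True by (simp add: sum_fun_apply res_def)
          also have "\<dots> = (\<Sum>b\<in>B. co B b v *\<^sub>C g b)"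
            by (rule sum.cong[OF refl]) (simp only: \<iota>j[OF gb])
          finally show ?thesis using lin_on_co_expand[OF B Hom_lin[OF g] True] by simp
        next
          case False
          then show ?thesis using Hom_off[OF g] by (simp add: sum_fun_apply res_def)
        qed
      qed
      then have "\<Theta> g = \<Theta> (\<Sum>b\<in>B. ?E b (?j (g b)))" by simp
      also have "\<dots> = (\<Sum>b\<in>B. \<Theta> (?E b (?j (g b))))"
        by (rule lin_on_sum[OF csubspace_Hom[OF sQ1] dual_lin[OF \<Theta>(1)]]) (rule lin_on_mem[OF E lin_on_mem[OF j gb]])
      also have "\<dots> = (\<Sum>b\<in>B. ?f b (?j (g b)))"
      proof (rule sum.cong[OF refl])
        fix b assume "b \<in> B"
        then have "?j (g b) \<in> ?N" by (rule lin_on_mem[OF j gb])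
        then show "\<Theta> (?E b (?j (g b))) = ?f b (?j (g b))" unfolding res_def[of ?N] by simp
      qed
      finally show ?thesis .
    qed
    let ?t = "\<Sum>b\<in>B. pure_tensor ?T ?V (?f b) b"
    note pm = pure_mem[OF fd cbasis_mem[OF B]]
    have t: "?t \<in> tensor ?T ?V" by (rule complex_vector.subspace_sum[OF csubspace_tensor pm])
    have "L ?t = (\<Sum>b\<in>B. L (pure_tensor ?T ?V (?f b) b))" by (rule lin_on_sum[OF csubspace_tensor L(1) pm])
    also have "\<dots> = (\<Sum>b\<in>B. ?\<beta> (?f b) b)" by (rule sum.cong[OF refl], rule L(2)[OF fd cbasis_mem[OF B]])
    also have "\<dots> = 0"
    proof
      fix q
      show "(\<Sum>b\<in>B. ?\<beta> (?f b) b) q = 0 q"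
      proof (cases "q \<in> ?Q2")
        case True
        have "(\<Sum>b\<in>B. ?\<beta> (?f b) b) q = (\<Sum>b\<in>B. ?f b (?j (y 1 q b)))"
          using True by (simp only: sum_fun_apply res_def[of ?Q2] if_True)
        also have "\<dots> = \<Theta> (y 1 q)" by (rule \<Theta>g[OF Hom_mem[OF y1 True], symmetric])
        finally show ?thesis using \<Theta>(2)[of "y 1 q"] True by simp
      next
        case False
        then show ?thesis by (simp add: sum_fun_apply res_def[of ?Q2])
      qed
    qed
    finally have Lt: "L ?t = 0" .
    \<comment> \<open>If the tensor vanished, so would all its coefficients \<open>?f b\<close>, and
      by the expansion of \<open>\<Theta> g\<close> also \<Theta>.\<close>
    have "?t \<noteq> 0"
    proof
      assume t0: "?t = 0"
      obtain c where c: "\<And>b. b \<in> B \<Longrightarrow> lin_on (tensor ?T ?V) ?T (c b)"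
        "\<And>b u v. b \<in> B \<Longrightarrow> u \<in> ?T \<Longrightarrow> v \<in> ?V \<Longrightarrow> c b (pure_tensor ?T ?V u v) = co B b v *\<^sub>C u"
        "\<And>t. t \<in> tensor ?T ?V \<Longrightarrow> t = (\<Sum>b\<in>B. pure_tensor ?T ?V (c b t) b)"
        by (rule tensor_expand[OF fT B], rule that)
      have "?f b = 0" if b: "b \<in> B" for b
      proof -
        have "0 = c b ?t" unfolding t0 by (rule lin_on_0[OF csubspace_tensor c(1)[OF b], symmetric])
        also have "\<dots> = (\<Sum>b'\<in>B. c b (pure_tensor ?T ?V (?f b') b'))"
          by (rule lin_on_sum[OF csubspace_tensor c(1)[OF b] pm])
        also have "\<dots> = (\<Sum>b'\<in>B. co B b b' *\<^sub>C ?f b')"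
          by (rule sum.cong[OF refl], rule c(2)[OF b fd cbasis_mem[OF B]])
        also have "\<dots> = (\<Sum>b'\<in>B. if b' = b then ?f b' else 0)"
        proof (rule sum.cong[OF refl])
          fix b' assume "b' \<in> B"
          then show "co B b b' *\<^sub>C ?f b' = (if b' = b then ?f b' else 0)"
            using co_basis[OF B, of b' b] by (cases "b' = b") (simp_all only: scaleC_one complex_vector.scale_zero_left if_True if_False not_sym simp_thms)
        qed
        also have "\<dots> = ?f b" using b cbasis_finite[OF B] by simp
        finally show ?thesis by (rule sym)
      qed
      then have "\<Theta> g = 0" if "g \<in> ?H" for g
        unfolding \<Theta>g[OF that] by (intro sum.neutral ballI) (simp only: zero_fun_apply)
      then show False using \<Theta>(3) by blast
    qed
    then show ?thesis using t Lt by blast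
  qed
  then obtain t0 where K: "t0 \<in> tensor ?T ?V" "t0 \<noteq> 0" "L t0 = 0" by blast
  let ?K = "{t \<in> tensor ?T ?V. L t = 0}"
  have Kt: "?K \<subseteq> tensor ?T ?V" by blast
  obtain T' where T': "csubspace T'" "T' \<subseteq> ?T" "?K \<subseteq> subtensor ?T ?V T' ?V"
    "\<And>T1. csubspace T1 \<Longrightarrow> T1 \<subseteq> ?T \<Longrightarrow> ?K \<subseteq> subtensor ?T ?V T1 ?V \<Longrightarrow> T' \<subseteq> T1"
    by (rule tensor_support_exists[OF fT fV Kt], rule that)
  \<comment> \<open>The transposes of \<open>\<Psi> 1 i\<close> and \<open>\<Psi> 2 i\<close> take
    the places of \<sigma> and \<rho> in \<open>codim_bound\<close>, with the dual of
    \<open>Q\<^sub>2\<close> as the intermediate space.\<close>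
  let ?\<sigma> = "\<lambda>i F \<eta>. res (spP D i) (\<lambda>p. F (?j (\<Psi> 1 i p \<eta>)))"
  let ?\<rho> = "\<lambda>i F \<chi>. res (spP D i) (\<lambda>p. F (\<Psi> 2 i p \<chi>))"
  let ?I = "cspan {?\<beta> F b |F b. F \<in> T' \<and> b \<in> ?V}"
  let ?S = "\<lambda>i. cspan {?\<sigma> i F \<eta> |F \<eta>. F \<in> T' \<and> \<eta> \<in> dual (spH D 1 i)}"
  have \<sigma>: "bilin_on ?T (dual (spH D 1 i)) (dual (spP D i)) (?\<sigma> i)" if "i \<in> {1,2}" for i
    by (rule dual_comp_bilin[OF sub_P[OF that]
          bilin_compose[where f="\<lambda>p. p" and g="\<lambda>b. b", OF lin_on_id factors_bilin[OF f l12(1) that] lin_on_id j]])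
  have \<rho>: "bilin_on (dual ?Q2) (dual (spH D 2 i)) (dual (spP D i)) (?\<rho> i)" if "i \<in> {1,2}" for i
    by (rule dual_comp_bilin[OF sub_P[OF that] factors_bilin[OF f l12(2) that]])
  have Y: "y 1 (\<Psi> 2 i p \<chi>) b = \<Psi> 1 i p (dHB D 2 1 i \<chi> b)"
    if "i \<in> {1,2}" "p \<in> spP D i" "\<chi> \<in> dual (spH D 2 i)" "b \<in> ?V" for i p \<chi> b
    using factors_y[OF f l12(3) that(1,2), unfolded Suc_1, OF that(3,4)] .
  have bB: "bilin_on (dual (spH D 2 i)) ?V (dual (spH D 1 i)) (dHB D 2 1 i)" if "i \<in> {1,2}" for i
    using that r2 s by (intro dHB_bilin) auto
  have bound: "real (cdim (?S i)) \<le> d_const D i * real (cdim ?I)" if i: "i \<in> {1,2}" for i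
    unfolding d_const_def
  proof (rule codim_bound[OF fT fV _ \<beta> csubspace_dual L K T' bB[OF i] _ \<sigma>[OF i] csubspace_dual \<rho>[OF i]])
    show "fin_dim (dual (spH D 1 i))" using i r2 s by (intro fin_dim_dual fin_H) auto
    show "tsurj (dHB D 2 1 i) (dual (spH D 2 i)) ?V (dual (spH D 1 i))" using i r2 s by (intro dHB_surj) auto
    show "?\<rho> i (?\<beta> t v) \<chi> = ?\<sigma> i t (dHB D 2 1 i \<chi> v)"
      if "t \<in> ?T" "v \<in> ?V" "\<chi> \<in> dual (spH D 2 i)" for t v \<chi>
    proof (rule res_cong)
      fix p assume p: "p \<in> spP D i"
      have "\<Psi> 2 i p \<chi> \<in> ?Q2" by (rule bilin_mem[OF factors_bilin[OF f l12(2) i] p that(3)])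
      then have "?\<beta> t v (\<Psi> 2 i p \<chi>) = t (?j (y 1 (\<Psi> 2 i p \<chi>) v))" by (simp add: res_def)
      then show "?\<beta> t v (\<Psi> 2 i p \<chi>) = t (?j (\<Psi> 1 i p (dHB D 2 1 i \<chi> v)))" using Y[OF i p that(3,2)] by simp
    qed
  qed
  have strict: "cdim ?I < cdim T' * cdim ?V" by (rule support_image_strict[OF fT fV L K T'(1-3)])
  have fT': "fin_dim T'" by (rule fin_dim_subspace[OF fT T'(1,2)])
  \<comment> \<open>The transpose of \<open>?j\<close> moves \<open>T'\<close> into the dual of
    \<open>Q\<^sub>1\<close> without changing its dimension.\<close>
  let ?r = "\<lambda>F. res ?Q1 (\<lambda>q. F (?j q))"
  let ?J = "?r ` T'"
  have r: "lin_on ?T (dual ?Q1) ?r"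
  proof (rule lin_onI)
    show "?r F \<in> dual ?Q1" if "F \<in> ?T" for F
      unfolding dual_def[of ?Q1] by (rule res_Hom[OF sQ1 lin_on_compose[OF j dual_lin[OF that]]])
  qed (auto simp: res_def fun_eq_iff plus_fun_def scaleC_fun_def)
  have rT': "lin_on T' (dual ?Q1) ?r" using r T'(2) by (rule lin_on_subset) simp
  have J: "csubspace ?J" "?J \<subseteq> dual ?Q1"
    using lin_on_image_subspace[OF T'(1) rT'] lin_on_mem[OF rT'] by auto
  have dJ: "cdim ?J = cdim T'"
  proof (rule cdim_image_inj[OF fT' rT'])
    fix F assume F: "F \<in> T'" "?r F = 0"
    have "F n = 0" for n
    proof (cases "n \<in> ?N")
      case True
      have "?r F (?\<iota> n) = F n" unfolding res_def using lin_on_mem[OF \<iota> True] j\<iota>[OF True] by simp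
      then show ?thesis using F(2) by simp
    next
      case False
      then show ?thesis using F(1) T'(2) by (auto simp: dual_def Hom_iff)
    qed
    then show "F = 0" by (simp add: fun_eq_iff)
  qed
  have I: "csubspace ?I" "?I \<subseteq> dual ?Q2"
    by (rule complex_vector.subspace_span)
      (rule complex_vector.span_minimal[OF _ csubspace_dual], use T'(2) bilin_mem[OF \<beta>] in blast)
  have S: "csubspace (?S i)" "?S i \<subseteq> dual (spP D i)" if "i \<in> {1,2}" for i
    by (rule complex_vector.subspace_span)
      (rule complex_vector.span_minimal[OF _ csubspace_dual], use T'(2) bilin_mem[OF \<sigma>[OF that]] in blast)
  \<comment> \<open>Annihilators turn the dimensions of \<open>?S i\<close>, \<open>?J\<close> and
    \<open>?I\<close> into codimensions, which is the form that \<open>unstable_arith_y\<close>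
    expects.\<close>
  let ?P = "\<lambda>i. ann (spP D i) (?S i)"
  let ?Q = "\<lambda>l. if l = (1::nat) then ann ?Q1 ?J else ann ?Q2 ?I"
  have dP: "cdim (?P i) + cdim (?S i) = cdim (spP D i)" if "i \<in> {1,2}" for i
    by (rule cdim_ann[OF fin_P[OF that] S[OF that]])
  have dQ1: "cdim (?Q 1) + cdim T' = cdim ?Q1" using cdim_ann[OF fQ1 J] dJ by simp
  have dQ2: "cdim (?Q 2) + cdim ?I = cdim ?Q2" using cdim_ann[OF fQ2 I] by simp
  have annP: "F (?j (\<Psi> 1 i p \<eta>)) = 0"
    if "i \<in> {1,2}" "p \<in> ?P i" "F \<in> T'" "\<eta> \<in> dual (spH D 1 i)" for i p F \<eta>
  proof -
    have "?\<sigma> i F \<eta> \<in> ?S i" using that(3,4) by (intro complex_vector.span_base) blast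
    then have "?\<sigma> i F \<eta> p = 0" "p \<in> spP D i" using that(2) unfolding ann_def by blast+
    then show ?thesis by (simp add: res_def)
  qed
  have annQ: "F (?j (y 1 q b)) = 0" if "q \<in> ann ?Q2 ?I" "F \<in> T'" "b \<in> ?V" for q F b
  proof -
    have "?\<beta> F b \<in> ?I" using that(2,3) by (intro complex_vector.span_base) blast
    then have "?\<beta> F b q = 0" "q \<in> ?Q2" using that(1) unfolding ann_def by blast+
    then show ?thesis by (simp add: res_def)
  qed
  have st': "al 1 * real (cdim (?P 1)) + al 2 * real (cdim (?P 2)) \<le> (\<Sum>l = 1..ns D. be l * real (cdim (?Q l)))"
  proof (rule semistableD[OF st])
    show "csubspace (?P i) \<and> ?P i \<subseteq> spP D i" if "i \<in> {1,2}" for i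
      using csubspace_ann[OF sub_P[OF that] S(2)[OF that]] by (auto simp: ann_def)
    show "csubspace (?Q l) \<and> ?Q l \<subseteq> spQ D l" if "l \<in> {1..ns D}" for l
    proof -
      have "l = 1 \<or> l = 2" using that s by auto
      then show ?thesis using csubspace_ann[OF sQ1 J(2)] csubspace_ann[OF sQ2 I(2)] by (auto simp: ann_def)
    qed
    \<comment> \<open>The dimension of \<open>?I\<close> stays below n_1 b_21, the dimension of one
      summand of \<open>Q\<^sub>2\<close>, so its annihilator is nonzero and the family is not the
      zero family.\<close>
    have "cdim T' * cdim ?V \<le> cdim ?T * cdim ?V" by (intro mult_right_mono cdim_mono[OF fT T'(1,2)]) simp
    then have "cdim T' * cdim ?V \<le> cdim ?N * cdim ?V" unfolding cdim_dual[OF fN] .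
    then have "cdim ?I < cdim ?N * cdim ?V" using strict by linarith
    moreover have "{1..2::nat} = {1,2}" by auto
    ultimately have "cdim ?I < cdim ?Q2" using dim_Q[OF l12(2)] by simp
    then have "?Q 2 \<noteq> {0}" using dQ2 by auto
    then show "\<not> ((\<forall>i\<in>{1,2}. ?P i = {0}) \<and> (\<forall>l\<in>{1..ns D}. ?Q l = {0}))" using l12 by blast
    have "cdim T' \<noteq> 0"
    proof
      assume "cdim T' = 0"
      then have "cdim T' * cdim ?V = 0" by (simp only: mult_zero_left)
      then show False using strict by linarith
    qed
    then have "?Q 1 \<noteq> ?Q1" using dQ1 by auto
    then show "\<not> ((\<forall>i\<in>{1,2}. ?P i = spP D i) \<and> (\<forall>l\<in>{1..ns D}. ?Q l = spQ D l))" using l12 by blast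
    show "x 2 p a \<in> ?P 1" if p: "p \<in> ?P 2" and a: "a \<in> spA D 2 1" for p a
    proof (rule ann_spanI)
      have pP: "p \<in> spP D 2" using p by (simp add: ann_def)
      show xp: "x 2 p a \<in> spP D 1" by (rule bilin_mem[OF bigW_bilin(1)[OF w] pP a])
      fix F assume "F \<in> {?\<sigma> 1 F \<eta> |F \<eta>. F \<in> T' \<and> \<eta> \<in> dual (spH D 1 1)}"
      then obtain F' \<eta> where F: "F = ?\<sigma> 1 F' \<eta>" "F' \<in> T'" "\<eta> \<in> dual (spH D 1 1)" by blast
      have d: "dHA D 1 2 1 \<eta> a \<in> dual (spH D 1 2)" using r2 s by (intro bilin_mem[OF dHA_bilin F(3) a]) auto
      have "F (x 2 p a) = F' (?j (\<Psi> 1 1 (x 2 p a) \<eta>))" using xp unfolding F(1) res_def by simp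
      then show "F (x 2 p a) = 0"
        using factors_x[OF f l12(1) pP F(3) a] annP[OF i12(2) p F(2) d] by simp
    qed
    show "\<psi> p \<chi> \<in> ?Q (ns D)" if p: "p \<in> ?P 1" and \<chi>: "\<chi> \<in> dual (spH D (ns D) 1)" for p \<chi>
    proof -
      have pP: "p \<in> spP D 1" using p by (simp add: ann_def)
      note \<chi>2 = \<chi>[unfolded s]
      have "\<Psi> 2 1 p \<chi> \<in> ann ?Q2 ?I"
      proof (rule ann_spanI)
        show m: "\<Psi> 2 1 p \<chi> \<in> ?Q2" by (rule bilin_mem[OF factors_bilin[OF f l12(2) i12(1)] pP \<chi>2])
        fix F assume "F \<in> {?\<beta> F b |F b. F \<in> T' \<and> b \<in> ?V}"
        then obtain F' b where F: "F = ?\<beta> F' b" "F' \<in> T'" "b \<in> ?V" by blast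
        have "F (\<Psi> 2 1 p \<chi>) = F' (?j (y 1 (\<Psi> 2 1 p \<chi>) b))" using m unfolding F(1) res_def by simp
        then show "F (\<Psi> 2 1 p \<chi>) = 0"
          using Y[OF i12(1) pP \<chi>2 F(3)] annP[OF i12(1) p F(2) bilin_mem[OF bB[OF i12(1)] \<chi>2 F(3)]] by simp
      qed
      then show ?thesis using factors_psi[OF f pP \<chi>] s by simp
    qed
    fix l q b assume l: "l \<in> {1..<ns D}" and q: "q \<in> ?Q (Suc l)" and b: "b \<in> spB D (Suc l) l"
    have l1: "l = 1" using l s by auto
    have q2: "q \<in> ann ?Q2 ?I" using q l1 by simp
    have b2: "b \<in> ?V" using b unfolding l1 Suc_1 .
    have "y 1 q b \<in> ann ?Q1 ?J"
    proof -
      have yq: "y 1 q b \<in> ?Q1" using q2 b2 by (intro bilin_mem[OF by1]) (auto simp: ann_def)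
      then show ?thesis using annQ[OF q2 _ b2] unfolding ann_def by (auto simp: res_def)
    qed
    then show "y l q b \<in> ?Q l" using l1 by simp
  qed
  have "{1..ns D} = {1, 2}" using s by auto
  then have "al 1 * real (cdim (?P 1)) + al 2 * real (cdim (?P 2)) \<le> be 1 * real (cdim (?Q 1)) + be 2 * real (cdim (?Q 2))"
    using st' by (simp only: sum.insert_remove sum.empty finite.intros Diff_insert_absorb empty_iff insert_iff simp_thms) simp
  moreover have "real (cdim ?I) < real (cdim T') * dimB D 2 1" using strict unfolding of_nat_mult[symmetric] of_nat_less_iff .
  ultimately show False
    by (rule unstable_arith_y[OF _ dP[OF i12(1)] dP[OF i12(2)] dQ1 dQ2 total bound[OF i12(1)] bound[OF i12(2)] pos ineq])
qed

text \<open>The hypotheses are the inequalities of the theorem expressed in \<open>al\<close> and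
  \<open>be\<close>. In this form s = 1 and s = 2 are treated alike on the side of x, and the
  balance of total weights enters only for the dual family.\<close>

lemma closure_boundary_unstable:
  assumes pos: "al 1 > 0" "al 2 > 0" "\<And>l. l \<in> {1..ns D} \<Longrightarrow> be l > 0"
    and x: "dimA D 2 1 * (\<Sum>l = 1..ns D. be l * c_const D l) \<le> dimA D 2 1 * al 1 + al 2"
    and y: "ns D = 2 \<Longrightarrow> dimB D 2 1 * (al 1 * d_const D 1 + al 2 * d_const D 2) \<le> be 1 + dimB D 2 1 * be 2"
    and total: "ns D = 2 \<Longrightarrow> al 1 * real (cdim (spP D 1)) + al 2 * real (cdim (spP D 2))
      = be 1 * real (cdim (spQ D 1)) + be 2 * real (cdim (spQ D 2))"
  shows "(zariski_closure (bigW D) (Zset D) - Zset D) \<inter> semistable D al be = {}"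
proof -
  have False if z: "z \<in> zariski_closure (bigW D) (Zset D)" "z \<notin> Zset D" "z \<in> semistable D al be" for z
  proof -
    obtain x \<psi> y where zz: "z = (x, \<psi>, y)" by (cases z)
    have w: "(x, \<psi>, y) \<in> bigW D" using z(1) zz by (simp add: zariski_closure_def)
    obtain \<Psi> where f: "factors D x \<psi> y \<Psi>" using closure_factors z(1) zz by blast
    have i12: "1 \<in> {1, 2::nat}" "2 \<in> {1, 2::nat}" by auto
    have fM: "fin_dim (spM D 2)" and fA: "fin_dim (spA D 2 1)" using r2 by (auto intro: fin_M fin_A)
    obtain L where L: "lin_on (tensor (spM D 2) (spA D 2 1)) (spP D 1) L"
      "\<And>m a. m \<in> spM D 2 \<Longrightarrow> a \<in> spA D 2 1 \<Longrightarrow> L (pure_tensor (spM D 2) (spA D 2 1) m a) = x 2 (eps D 2 m) a"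
      by (rule bilin_lift[OF fM fA sub_P[OF i12(1)] bilin_compose[where g="\<lambda>a. a" and h="\<lambda>p. p",
            OF eps_props(1)[OF i12(2)] bigW_bilin(1)[OF w] lin_on_id lin_on_id]], rule that)
    \<comment> \<open>A point that degenerates in neither way belongs to \<open>Z\<close>, so the
      last alternative contradicts the choice of \<open>z\<close>.\<close>
    consider "\<exists>t. t \<in> tensor (spM D 2) (spA D 2 1) \<and> t \<noteq> 0 \<and> L t = 0"
      | "ns D = 2" "y 1 ` spQ D 2 \<noteq> Hom (spB D 2 1) (spQ D 1)"
      | "\<And>t. t \<in> tensor (spM D 2) (spA D 2 1) \<Longrightarrow> L t = 0 \<Longrightarrow> t = 0"
        "ns D = 2 \<Longrightarrow> y 1 ` spQ D 2 = Hom (spB D 2 1) (spQ D 1)"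
      by blast
    then show False
    proof cases
      case 1
      then show ?thesis using degenerate_x_unstable[OF w f L _ _ _ pos(2,3) x] z(3) zz by blast
    next
      case 2
      then show ?thesis using degenerate_y_unstable[OF w f 2 pos(1,2) _ total[OF 2(1)] assms(5)[OF 2(1)]] pos(3)[of 1] z(3) zz by simp
    next
      case 3
      then show ?thesis using nondegenerate_in_Zset[OF w f L 3] z(2) zz by blast
    qed
  qed
  then show ?thesis by blast
qed

end

theorem proposition8p1p3:
  fixes D :: "('a::complex_vector, 'b::complex_vector, 'h::complex_vector,
               'm::complex_vector, 'n::complex_vector) comp_system"
    and lam mu al be :: "nat \<Rightarrow> real"
  assumes "composition_system D"
    and "polarization D lam mu"
    and "associated_polarization D lam mu al be"
    and "\<forall>i\<in>{1..nr D}. al i > 0"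
    and "\<forall>l\<in>{1..ns D}. be l > 0"
    and "lam 2 \<ge> dimA D 2 1 * (\<Sum>l = 1..ns D. mu l * c_const D l)"
    and "ns D \<ge> 2 \<Longrightarrow> mu (ns D - 1) \<ge>
           dimB D (ns D) (ns D - 1) * d_const D 1 * (\<Sum>i = 1..nr D. al i * dimA D i 1)"
    and "(nr D = 2 \<and> ns D = 1 \<and> lam 2 \<ge> c_const D 1 * dimA D 2 1 * mu 1) \<or>
         (nr D = 2 \<and> ns D = 2 \<and>
          lam 2 \<ge> (mu 1 * c_const D 1 + mu 2 * (c_const D 2 - dimB D 2 1 * c_const D 1)) * dimA D 2 1 \<and>
          mu 1 \<ge> (lam 1 * (d_const D 1 - d_const D 2 * dimA D 2 1) + lam 2 * d_const D 2) * dimB D 2 1)"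
  shows "(zariski_closure (bigW D) (Zset D) - Zset D) \<inter> semistable D al be = {}"
proof -
  interpret composition_system D by (rule assms(1))
  interpret two_step D by unfold_locales (use assms(8) in auto)
  have e2: "{1..2::nat} = {1,2}" "{2..2::nat} = {2}" "{1..1::nat} = {1}" by auto
  \<comment> \<open>The diagonal spaces are lines, so the triangular system for the associated
    polarization has ones on its diagonal.\<close>
  have dA: "dimA D 1 1 = 1" "dimA D 2 2 = 1" using dim_A_diag by auto
  have lam: "lam 1 = al 1" "lam 2 = dimA D 2 1 * al 1 + al 2"
    using assms(3) r2 dA e2 by (auto simp: associated_polarization_def)
  have al: "al 1 > 0" "al 2 > 0" using assms(4) r2 by auto
  have be: "be l > 0" if "l \<in> {1..ns D}" for l using assms(5) that by blast
  have polM: "lam 1 * dimM D 1 + lam 2 * dimM D 2 = 1"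
    using assms(2) r2 e2 by (simp add: polarization_def)
  show ?thesis
  proof (cases "ns D = 1")
    case True
    have "dimB D 1 1 = 1" using dim_B_diag True by simp
    then have "mu 1 = be 1" using assms(3) True e2 by (simp add: associated_polarization_def)
    then show ?thesis
      using assms(8) True lam e2
      by (intro closure_boundary_unstable al be) (auto simp: algebra_simps)
  next
    case False
    then have s: "ns D = 2" using s12 by simp
    have dB: "dimB D 1 1 = 1" "dimB D 2 2 = 1" using dim_B_diag s by auto
    have mu: "mu 1 = be 1 + dimB D 2 1 * be 2" "mu 2 = be 2"
      using assms(3) s dB e2 by (auto simp: associated_polarization_def)
    have polN: "mu 1 * dimN D 1 + mu 2 * dimN D 2 = 1"
      using assms(2) s e2 by (simp add: polarization_def)
    have P: "real (cdim (spP D 1)) = dimM D 1 + dimM D 2 * dimA D 2 1" "real (cdim (spP D 2)) = dimM D 2"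
      using dim_P1 dim_P2 dA by simp_all
    have Q: "real (cdim (spQ D 1)) = dimN D 1" "real (cdim (spQ D 2)) = dimN D 1 * dimB D 2 1 + dimN D 2"
      using dim_Q[of 1] dim_Q[of 2] dB s e2 by simp_all
    show ?thesis
    proof (rule closure_boundary_unstable[OF al be])
      show "dimA D 2 1 * (\<Sum>l = 1..ns D. be l * c_const D l) \<le> dimA D 2 1 * al 1 + al 2"
        using assms(8) s lam mu e2 by (auto simp: algebra_simps)
      show "dimB D 2 1 * (al 1 * d_const D 1 + al 2 * d_const D 2) \<le> be 1 + dimB D 2 1 * be 2"
        using assms(8) s lam mu by (auto simp: algebra_simps)
      \<comment> \<open>Both sides equal 1: regrouped by the summands of the spaces P and Q, they
        are the sums of lambda_i m_i and of mu_l n_l.\<close>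
      show "al 1 * real (cdim (spP D 1)) + al 2 * real (cdim (spP D 2))
          = be 1 * real (cdim (spQ D 1)) + be 2 * real (cdim (spQ D 2))"
        using polM polN unfolding P Q lam mu by (simp add: algebra_simps)
    qed
  qed
qed

end
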